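(* Let $T>0$, let $p>0$ be a constant, and let $q:\mathbb{R}\to\mathbb{R}$ be a $2\pi$-periodic function with $q(x)\ge0$ and $\overline q>0$ that is bandlimited (for some $\omega_{\max}$, $\hat q(\omega)=0$ for all integers $|\omega|>\omega_{\max}$). Let $m\ge4$ be an integer and let $\mathbf f=(f,g)\in H^{m+1}_p([0,2\pi])\times H^m_p([0,2\pi])$. Consider the problem $u_{tt}+Lu=0$ on $(0,2\pi)\times(0,T)$, $Lu=-p\,u_{xx}+q(x)u$, with $u(x,0)=f(x)$, $u_t(x,0)=g(x)$ and periodic boundary conditions, and write $\mathbf u(x,t)=(u(x,t),u_t(x,t))$ for its exact solution. Let $\mathbf u_N(\cdot,t_n)=\tilde S_N(\Delta t)^n\,\mathcal I_N\mathbf f$, $t_n=n\Delta t$, be the approximate solution computed with $N$ grid points and time step $\Delta t$ by the two-node block Krylov subspace spectral (KSS) method with prescribed nodes. Then the method is convergent of order $(2,m-1)$: there exist constants $C_t$ and $C_x$, independent of $\Delta t$ and of the grid spacing $\Delta x=2\pi/N$, such that $$\|\mathbf u(\cdot,t_n)-\mathbf u_N(\cdot,t_n)\|_C\le C_t\,\Delta t^2+C_x\,\Delta x^{m-1}$$ for all even positive integers $N$, all $0<\Delta t\le T$ and all integers $n\ge0$ with $0\le t_n\le T$.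
   Context: Function spaces and coefficients. $H^s_p([0,2\pi])$ is the Sobolev space of $2\pi$-periodic functions of order $s$. $\hat q(\omega)=\frac1{2\pi}\int_0^{2\pi}e^{-i\omega x}q(x)\,dx$; $\overline q$ is the average of $q$ over $[0,2\pi]$, $\overline p=p$. Grid. $N$ is even, $\Delta x=2\pi/N$, grid points $x_j=j\Delta x$, $j=0,\dots,N-1$; wave numbers $\omega\in\hat I_N=\{-N/2+1,\dots,N/2\}$. The discrete Fourier transform is the $N\times N$ matrix $F_N$ with entries $[F_N]_{\omega,j}=\frac1N e^{-i\omega x_j}$ (rows indexed by $\omega\in\hat I_N$). $D_N=F_N^{-1}\,\mathrm{diag}(i\omega)_{\omega\in\hat I_N}F_N$ is the Fourier first-derivative matrix. $Q_N$ is the diagonal matrix of values of $q$ at the grid points, and $L_N=-p\,D_N^2+Q_N$ is the discretization of $L$. KSS operator. Let $f_{11}(\lambda)=f_{22}(\lambda)=\cos(\lambda^{1/2}\Delta t)$, $f_{12}(\lambda)=\lambda^{-1/2}\sin(\lambda^{1/2}\Delta t)$, $f_{21}(\lambda)=-\lambda f_{12}(\lambda)$, with values at $\lambda=0$ defined by continuity. For $\omega\in\hat I_N$ the nodes are $l_{1,\omega}=0$ and $l_{2,\omega}=\overline p\,\omega^2+\overline q$, and $M_{ij,\omega}=\frac{f_{ij}(l_{2,\omega})-f_{ij}(l_{1,\omega})}{l_{2,\omega}-l_{1,\omega}}$. For $i,j\in\{1,2\}$, $S_{N,ij}(\Delta t)$ is the $N\times N$ matrix such that for every vector $\mathbf w\in\mathbb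 C^N$ and every $\omega\in\hat I_N$, $$[F_NS_{N,ij}(\Delta t)\mathbf w]_\omega=f_{ij}(l_{2,\omega})[F_N\mathbf w]_\omega+M_{ij,\omega}\,[F_N(L_N-l_{2,\omega}I)\mathbf w]_\omega .$$ $S_N(\Delta t)$ is the $2N\times2N$ block matrix with blocks $S_{N,ij}(\Delta t)$. Restriction and interpolation. For a pair of continuous periodic functions $\mathbf h=(h_1,h_2)$, $\mathcal R_N\mathbf h$ is the pair of vectors of their grid values. For a pair of $N$-vectors $\mathbf g=(\mathbf g_1,\mathbf g_2)$, $\mathcal T_N\mathbf g$ is the pair of trigonometric polynomials $\sum_{\omega\in\hat I_N}e^{i\omega x}[F_N\mathbf g_r]_\omega$, $r=1,2$. $\mathcal I_N=\mathcal T_N\mathcal R_N$ (componentwise Fourier interpolation) and $\tilde S_N(\Delta t)=\mathcal T_NS_N(\Delta t)\mathcal R_N$. Norm. $\|(u,v)\|_C^2=\langle u,Cu\rangle+\langle v,v\rangle$ with $C=-\overline p\,\partial_{xx}+\overline q I$ and $\langle\cdot,\cdot\rangle$ the standard $L^2$ inner product on $(0,2\pi)$; i.e. $\|(u,v)\|_C^2=\int_0^{2\pi}\overline p|u'|^2+\overline q|u|^2+|v|^2\,dx$.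
   Formalization: q is additionally assumed continuous, so that it equals its finite Fourier series everywhere; bandlimitedness alone ignores null sets, and changing q at the grid points (q=2 on rational multiples of 2π, q=1 elsewhere) makes the claim false. *)

theory Defs
  imports
    "HOL-Analysis.Analysis"
    "Jordan_Normal_Form.Determinant"
    "Jordan_Normal_Form.Gauss_Jordan_Elimination"
begin

unbundle no vec_syntax

definition periodic2pi :: "(real \<Rightarrow> 'a) \<Rightarrow> bool" where
  "periodic2pi h \<longleftrightarrow> (\<forall>x. h (x + 2 * pi) = h x)"

definition fourier_coeff :: "(real \<Rightarrow> complex) \<Rightarrow> int \<Rightarrow> complex" where
  "fourier_coeff h \<omega> =
     (LINT x:{0..2*pi}|lebesgue. exp (- \<i> * of_int \<omega> * of_real x) * h x) / of_real (2 * pi)"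

definition average :: "(real \<Rightarrow> real) \<Rightarrow> real" where
  "average h = (LINT x:{0..2*pi}|lebesgue. h x) / (2 * pi)"

text \<open>Fourier coefficients are insensitive to null sets: only a continuous bandlimited function is a trigonometric
  polynomial everywhere.\<close>

definition bandlimited :: "(real \<Rightarrow> complex) \<Rightarrow> bool" where
  "bandlimited h \<longleftrightarrow> (\<exists>\<omega>max::int. \<forall>\<omega>. \<bar>\<omega>\<bar> > \<omega>max \<longrightarrow> fourier_coeff h \<omega> = 0)"

text \<open>Like \<open>bandlimited\<close>, membership only depends on the almost-everywhere class of \<open>h\<close> on a period.  For
  \<open>s > 1/2\<close> each class has a continuous representative; where grid values are taken,
  continuity has to be assumed in addition.\<close>

definition periodic_sobolev :: "real \<Rightarrow> (real \<Rightarrow> complex) set" where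
  "periodic_sobolev s = {h. periodic2pi h \<and>
     set_borel_measurable lebesgue {0..2*pi} h \<and>
     set_integrable lebesgue {0..2*pi} (\<lambda>x. (cmod (h x))\<^sup>2) \<and>
     (\<lambda>\<omega>::int. (1 + (real_of_int \<omega>)\<^sup>2) powr s * (cmod (fourier_coeff h \<omega>))\<^sup>2) summable_on UNIV}"

text \<open>Classical solutions of \<open>u\<^sub>t\<^sub>t - p u\<^sub>x\<^sub>x + q u = 0\<close> that are regular up to \<open>t = 0\<close> and
  \<open>t = T\<close>; time derivatives at the two ends are one-sided.  The argument \<open>ut\<close> is the time
  derivative of \<open>u\<close>.  Periodic boundary conditions are expressed by extending \<open>u\<close>
  periodically to the whole line.\<close>

definition wave_solution ::
  "real \<Rightarrow> (real \<Rightarrow> real) \<Rightarrow> real \<Rightarrow> (real \<Rightarrow> complex) \<Rightarrow> (real \<Rightarrow> complex) \<Rightarrow>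
   (real \<Rightarrow> real \<Rightarrow> complex) \<Rightarrow> (real \<Rightarrow> real \<Rightarrow> complex) \<Rightarrow> bool" where
  "wave_solution p q T f g u ut \<longleftrightarrow>
     (\<forall>t\<in>{0..T}. periodic2pi (\<lambda>x. u x t)) \<and>
     (\<exists>ux uxx utt.
        (\<forall>w\<in>{u, ux, uxx, ut, utt}. continuous_on (UNIV \<times> {0..T}) (\<lambda>(x, t). w x t)) \<and>
        (\<forall>x. \<forall>t\<in>{0..T}.
           ((\<lambda>y. u y t) has_vector_derivative ux x t) (at x) \<and>
           ((\<lambda>y. ux y t) has_vector_derivative uxx x t) (at x) \<and>
           ((\<lambda>\<tau>. u x \<tau>) has_vector_derivative ut x t) (at t within {0..T}) \<and>
           ((\<lambda>\<tau>. ut x \<tau>) has_vector_derivative utt x t) (at t within {0..T})) \<and>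
        (\<forall>x\<in>{0<..<2*pi}. \<forall>t\<in>{0<..<T}.
           utt x t + (- of_real p * uxx x t + of_real (q x) * u x t) = 0)) \<and>
     (\<forall>x. u x 0 = f x \<and> ut x 0 = g x)"

text \<open>The energy norm of \<open>C = - p \<partial>\<^sup>2 + average q\<close>; since \<open>p\<close> is constant, it is its own
  average, here and in \<open>node2\<close>.\<close>

definition C_norm :: "real \<Rightarrow> (real \<Rightarrow> real) \<Rightarrow> (real \<Rightarrow> complex) \<times> (real \<Rightarrow> complex) \<Rightarrow> real" where
  "C_norm p q = (\<lambda>(u, v). sqrt (LINT x:{0..2*pi}|lebesgue.
     p * (cmod (vector_derivative u (at x)))\<^sup>2 + average q * (cmod (u x))\<^sup>2 + (cmod (v x))\<^sup>2))"

definition grid_point :: "nat \<Rightarrow> nat \<Rightarrow> real" where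
  "grid_point N j = real j * (2 * pi / real N)"

text \<open>Matrix rows are numbered \<open>0, \<dots>, N - 1\<close>; row \<open>r\<close> belongs to the wave number
  \<open>wave_number N r\<close>, so that for even \<open>N\<close> these run through \<open>-N/2 + 1, \<dots>, N/2\<close>.\<close>

definition wave_number :: "nat \<Rightarrow> nat \<Rightarrow> int" where
  "wave_number N r = int r - int (N div 2) + 1"

lemma bij_betw_wave_number:
  assumes "even N"
  shows "bij_betw (wave_number N) {..<N} {- int (N div 2) + 1 .. int (N div 2)}"
  by (rule bij_betw_byWitness[where f' = "\<lambda>\<omega>. nat (\<omega> + int (N div 2) - 1)"])
     (use assms in \<open>auto simp: wave_number_def elim!: evenE\<close>)

definition dft :: "nat \<Rightarrow> complex mat" where
  "dft N = Matrix.mat N N (\<lambda>(r, j).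
     exp (- \<i> * of_int (wave_number N r) * of_real (grid_point N j)) / of_nat N)"

definition dft_inv :: "nat \<Rightarrow> complex mat" where
  "dft_inv N = the (mat_inverse (dft N))"

lemma dft_carrier [simp]: "dft N \<in> carrier_mat N N"
  by (simp add: dft_def)

lemma dft_inverse:
  assumes "N > 0"
  defines "E \<equiv> Matrix.mat N N (\<lambda>(j, r).
     exp (\<i> * of_int (wave_number N r) * of_real (grid_point N j)))"
  shows "dft_inv N = E" and "dft N * E = 1\<^sub>m N" and "E * dft N = 1\<^sub>m N"
proof -
  have E: "E \<in> carrier_mat N N" by (simp add: E_def)
  show *: "dft N * E = 1\<^sub>m N"
  proof (rule eq_matI)
    fix r s assume "r < dim_row (1\<^sub>m N :: complex mat)" "s < dim_col (1\<^sub>m N :: complex mat)"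
    hence rs: "r < N" "s < N" by auto
    define z where "z = exp (\<i> * of_real (2 * pi * (real s - real r) / real N))"
    have summand: "exp (- \<i> * of_int (wave_number N r) * of_real (grid_point N j)) / of_nat N *
        exp (\<i> * of_int (wave_number N s) * of_real (grid_point N j)) = z ^ j / of_nat N" for j
    proof -
      have "exp (- \<i> * of_int (wave_number N r) * of_real (grid_point N j)) *
          exp (\<i> * of_int (wave_number N s) * of_real (grid_point N j)) =
          exp (of_nat j * (\<i> * of_real (2 * pi * (real s - real r) / real N)))"
        unfolding exp_add [symmetric] using assms(1)
        by (intro arg_cong[where f = exp])
           (simp add: wave_number_def grid_point_def field_simps)
      also have "\<dots> = z ^ j" unfolding z_def by (rule exp_of_nat_mult)
      finally show ?thesis by simp
    qed
    have "(dft N * E) $$ (r, s) = (\<Sum>j<N. z ^ j / of_nat N)"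
      using rs summand by (simp add: dft_def E_def scalar_prod_def atLeast0LessThan)
    also have "\<dots> = (\<Sum>j<N. z ^ j) / of_nat N" by (simp add: sum_divide_distrib)
    also have "\<dots> = (if r = s then 1 else 0)"
    proof (cases "r = s")
      case True
      thus ?thesis using assms(1) by (simp add: z_def)
    next
      case False
      have zN: "z ^ N = 1"
      proof -
        have "z ^ N = exp (of_nat N * (\<i> * of_real (2 * pi * (real s - real r) / real N)))"
          unfolding z_def by (rule exp_of_nat_mult [symmetric])
        also have "\<dots> = exp (of_int (int s - int r) * (of_real (2 * pi) * \<i>))"
          using assms(1) by (intro arg_cong[where f = exp]) (simp add: field_simps)
        also have "\<dots> = 1"
          using exp_integer_2pi[of "of_int (int s - int r)"] by (simp add: mult_ac)
        finally show ?thesis .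
      qed
      have "z \<noteq> 1"
      proof
        assume "z = 1"
        then obtain k :: int where
          "2 * pi * (real s - real r) / real N = of_int (2 * k) * pi"
          unfolding z_def exp_eq_1 by auto
        hence "pi * (2 * (real s - real r)) = pi * (2 * (of_int k * real N))"
          using assms(1) by (simp add: field_simps)
        hence "real s - real r = of_int k * real N"
          unfolding mult_cancel_left by simp
        hence "of_int (int s - int r) = (of_int (k * int N) :: real)" by simp
        hence k: "int s - int r = k * int N" by (simp only: of_int_eq_iff)
        moreover have "\<bar>int s - int r\<bar> < int N" using rs by auto
        ultimately have "\<bar>k\<bar> * int N < 1 * int N" by (simp add: abs_mult)
        hence "k = 0" using assms(1) by (simp only: mult_less_cancel_right) auto
        with k False show False by simp
      qed
      thus ?thesis using False zN by (simp add: sum_gp_strict)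
    qed
    finally show "(dft N * E) $$ (r, s) = 1\<^sub>m N $$ (r, s)" using rs by simp
  qed (simp_all add: dft_def E_def)
  show **: "E * dft N = 1\<^sub>m N"
    by (rule mat_mult_left_right_inverse[OF dft_carrier E *])
  have "dft N \<in> Units (ring_mat TYPE(complex) N ())"
    using * ** E by (auto simp: Units_def ring_mat_def)
  then obtain B where B: "mat_inverse (dft N) = Some B"
    using mat_inverse(1)[OF dft_carrier, of N "()"] by (cases "mat_inverse (dft N)") auto
  have B': "B * dft N = 1\<^sub>m N" "B \<in> carrier_mat N N"
    using mat_inverse(2)[OF dft_carrier B] by auto
  have "B = B * (dft N * E)" using * B' by simp
  also have "\<dots> = E" using B' E by (simp flip: assoc_mult_mat[OF B'(2) dft_carrier E])
  finally show "dft_inv N = E" by (simp add: dft_inv_def B)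
qed

definition deriv_mat :: "nat \<Rightarrow> complex mat" where
  "deriv_mat N = dft_inv N * mat_diag N (\<lambda>r. \<i> * of_int (wave_number N r)) * dft N"

definition L_mat :: "real \<Rightarrow> (real \<Rightarrow> real) \<Rightarrow> nat \<Rightarrow> complex mat" where
  "L_mat p q N = (- of_real p) \<cdot>\<^sub>m (deriv_mat N * deriv_mat N)
     + mat_diag N (\<lambda>j. of_real (q (grid_point N j)))"

definition kss_f11 :: "real \<Rightarrow> real \<Rightarrow> real" where
  "kss_f11 dt l = cos (sqrt l * dt)"

definition kss_f12 :: "real \<Rightarrow> real \<Rightarrow> real" where
  "kss_f12 dt l = (if l = 0 then dt else sin (sqrt l * dt) / sqrt l)"

definition kss_f21 :: "real \<Rightarrow> real \<Rightarrow> real" where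
  "kss_f21 dt l = - l * kss_f12 dt l"

definition kss_f22 :: "real \<Rightarrow> real \<Rightarrow> real" where
  "kss_f22 dt l = cos (sqrt l * dt)"

definition node1 :: real where
  "node1 = 0"

definition node2 :: "real \<Rightarrow> (real \<Rightarrow> real) \<Rightarrow> nat \<Rightarrow> nat \<Rightarrow> real" where
  "node2 p q N r = p * (real_of_int (wave_number N r))\<^sup>2 + average q"

definition node_slope :: "real \<Rightarrow> (real \<Rightarrow> real) \<Rightarrow> nat \<Rightarrow> (real \<Rightarrow> real) \<Rightarrow> nat \<Rightarrow> real" where
  "node_slope p q N \<phi> r = (\<phi> (node2 p q N r) - \<phi> node1) / (node2 p q N r - node1)"

text \<open>The block of the solution operator that belongs to the scalar function \<open>\<phi>\<close>.  Since the
  node depends on the wave number, the matrix is given row by row on the Fourier side;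
  \<open>dft_kss_block\<close> and \<open>kss_block_unique\<close> below recover its characterization.\<close>

definition kss_block :: "real \<Rightarrow> (real \<Rightarrow> real) \<Rightarrow> nat \<Rightarrow> (real \<Rightarrow> real) \<Rightarrow> complex mat" where
  "kss_block p q N \<phi> = dft_inv N * Matrix.mat N N (\<lambda>(r, j).
     of_real (\<phi> (node2 p q N r)) * dft N $$ (r, j) +
     of_real (node_slope p q N \<phi> r) *
       (dft N * (L_mat p q N - of_real (node2 p q N r) \<cdot>\<^sub>m 1\<^sub>m N)) $$ (r, j))"

lemma L_mat_carrier [simp]:
  shows "L_mat p q N \<in> carrier_mat N N"
  by (simp add: L_mat_def mat_diag_def)

lemma dft_kss_block:
  assumes "N > 0" and w: "w \<in> carrier_vec N" and r: "r < N"
  shows "(dft N *\<^sub>v (kss_block p q N \<phi> *\<^sub>v w)) $ r =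
     of_real (\<phi> (node2 p q N r)) * (dft N *\<^sub>v w) $ r +
     of_real (node_slope p q N \<phi> r) *
       (dft N *\<^sub>v ((L_mat p q N - of_real (node2 p q N r) \<cdot>\<^sub>m 1\<^sub>m N) *\<^sub>v w)) $ r"
proof -
  let ?G = "\<lambda>r. L_mat p q N - of_real (node2 p q N r) \<cdot>\<^sub>m 1\<^sub>m N"
  define B where "B = Matrix.mat N N (\<lambda>(r, j).
     of_real (\<phi> (node2 p q N r)) * dft N $$ (r, j) +
     of_real (node_slope p q N \<phi> r) * (dft N * ?G r) $$ (r, j))"
  have B: "B \<in> carrier_mat N N" by (simp add: B_def)
  have I: "dft_inv N \<in> carrier_mat N N" using dft_inverse(1)[OF assms(1)] by simp
  have G: "?G r \<in> carrier_mat N N" by (rule minus_carrier_mat) simp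
  have DG: "dft N * ?G r \<in> carrier_mat N N" using G by (rule mult_carrier_mat[OF dft_carrier])
  have "dft N *\<^sub>v (kss_block p q N \<phi> *\<^sub>v w) = (dft N * dft_inv N * B) *\<^sub>v w"
    unfolding kss_block_def B_def [symmetric] using I B w
    by (simp add: assoc_mult_mat_vec[of _ N N _ N] assoc_mult_mat[of _ N N _ N _ N])
  also have "\<dots> = B *\<^sub>v w"
    using dft_inverse(1,2)[OF assms(1)] B by simp
  finally have "(dft N *\<^sub>v (kss_block p q N \<phi> *\<^sub>v w)) $ r = (B *\<^sub>v w) $ r" by simp
  also have "\<dots> = of_real (\<phi> (node2 p q N r)) * (\<Sum>j<N. dft N $$ (r, j) * w $ j) +
      of_real (node_slope p q N \<phi> r) * (\<Sum>j<N. (dft N * ?G r) $$ (r, j) * w $ j)"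
    using r w B
    by (simp add: B_def scalar_prod_def atLeast0LessThan distrib_right sum.distrib
        sum_distrib_left mult.assoc carrier_vecD del: index_mult_mat(1))
  also have "(\<Sum>j<N. dft N $$ (r, j) * w $ j) = (dft N *\<^sub>v w) $ r"
    using r w carrier_matD[OF dft_carrier[of N]] by (simp add: scalar_prod_def atLeast0LessThan)
  also have "(\<Sum>j<N. (dft N * ?G r) $$ (r, j) * w $ j) = ((dft N * ?G r) *\<^sub>v w) $ r"
    using r w carrier_matD[OF DG]
    by (simp add: scalar_prod_def atLeast0LessThan del: index_mult_mat)
  also have "(dft N * ?G r) *\<^sub>v w = dft N *\<^sub>v (?G r *\<^sub>v w)"
    by (rule assoc_mult_mat_vec[OF dft_carrier G w])
  finally show ?thesis .
qed

lemma kss_block_unique: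
  assumes "N > 0" and S: "S \<in> carrier_mat N N"
    and *: "\<And>w r. w \<in> carrier_vec N \<Longrightarrow> r < N \<Longrightarrow>
     (dft N *\<^sub>v (S *\<^sub>v w)) $ r =
     of_real (\<phi> (node2 p q N r)) * (dft N *\<^sub>v w) $ r +
     of_real (node_slope p q N \<phi> r) *
       (dft N *\<^sub>v ((L_mat p q N - of_real (node2 p q N r) \<cdot>\<^sub>m 1\<^sub>m N) *\<^sub>v w)) $ r"
  shows "S = kss_block p q N \<phi>"
proof -
  have I: "dft_inv N \<in> carrier_mat N N" using dft_inverse(1)[OF assms(1)] by simp
  have K: "kss_block p q N \<phi> \<in> carrier_mat N N"
    unfolding kss_block_def by (rule mult_carrier_mat[OF I]) simp
  have inv: "dft_inv N *\<^sub>v (dft N *\<^sub>v v) = v" if "v \<in> carrier_vec N" for v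
    using assoc_mult_mat_vec[OF I dft_carrier that] dft_inverse(1,3)[OF assms(1)] that by simp
  have eq: "S *\<^sub>v w = kss_block p q N \<phi> *\<^sub>v w" if w: "w \<in> carrier_vec N" for w
  proof -
    have "dft N *\<^sub>v (S *\<^sub>v w) = dft N *\<^sub>v (kss_block p q N \<phi> *\<^sub>v w)"
      by (rule eq_vecI) (use *[OF w] dft_kss_block[OF assms(1) w] in
          \<open>auto simp: dft_def simp del: index_mult_mat_vec\<close>)
    thus ?thesis
      using inv[of "S *\<^sub>v w"] inv[of "kss_block p q N \<phi> *\<^sub>v w"] S K w
      by (metis mult_mat_vec_carrier)
  qed
  show ?thesis
  proof (rule mat_col_eqI)
    fix j assume "j < dim_col (kss_block p q N \<phi>)"
    hence j: "j < N" using K by simp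
    have "A *\<^sub>v unit_vec N j = Matrix.col A j" if "A \<in> carrier_mat N N" for A :: "complex mat"
      using that j by (intro eq_vecI) (auto simp: scalar_prod_right_unit)
    thus "Matrix.col S j = Matrix.col (kss_block p q N \<phi>) j"
      using eq[of "unit_vec N j"] S K by simp
  qed (use S K in auto)
qed

definition kss_matrix :: "real \<Rightarrow> (real \<Rightarrow> real) \<Rightarrow> nat \<Rightarrow> real \<Rightarrow> complex mat" where
  "kss_matrix p q N dt = four_block_mat
     (kss_block p q N (kss_f11 dt)) (kss_block p q N (kss_f12 dt))
     (kss_block p q N (kss_f21 dt)) (kss_block p q N (kss_f22 dt))"

text \<open>A pair of \<open>N\<close>-vectors is stored as one vector of length \<open>2 N\<close>.\<close>

definition restrict_grid :: "nat \<Rightarrow> (real \<Rightarrow> complex) \<times> (real \<Rightarrow> complex) \<Rightarrow> complex vec" where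
  "restrict_grid N = (\<lambda>(h1, h2).
     Matrix.vec N (\<lambda>j. h1 (grid_point N j)) @\<^sub>v Matrix.vec N (\<lambda>j. h2 (grid_point N j)))"

definition trig_poly :: "nat \<Rightarrow> complex vec \<Rightarrow> real \<Rightarrow> complex" where
  "trig_poly N w x =
     (\<Sum>r<N. exp (\<i> * of_int (wave_number N r) * of_real x) * (dft N *\<^sub>v w) $ r)"

definition extend_grid :: "nat \<Rightarrow> complex vec \<Rightarrow> (real \<Rightarrow> complex) \<times> (real \<Rightarrow> complex)" where
  "extend_grid N w = (trig_poly N (vec_first w N), trig_poly N (vec_last w N))"

definition interpolate ::
  "nat \<Rightarrow> (real \<Rightarrow> complex) \<times> (real \<Rightarrow> complex) \<Rightarrow> (real \<Rightarrow> complex) \<times> (real \<Rightarrow> complex)" where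
  "interpolate N h = extend_grid N (restrict_grid N h)"

definition kss_step ::
  "real \<Rightarrow> (real \<Rightarrow> real) \<Rightarrow> nat \<Rightarrow> real \<Rightarrow>
   (real \<Rightarrow> complex) \<times> (real \<Rightarrow> complex) \<Rightarrow> (real \<Rightarrow> complex) \<times> (real \<Rightarrow> complex)" where
  "kss_step p q N dt h = extend_grid N (kss_matrix p q N dt *\<^sub>v restrict_grid N h)"

definition kss_approx ::
  "real \<Rightarrow> (real \<Rightarrow> real) \<Rightarrow> nat \<Rightarrow> real \<Rightarrow> (real \<Rightarrow> complex) \<times> (real \<Rightarrow> complex) \<Rightarrow>
   nat \<Rightarrow> (real \<Rightarrow> complex) \<times> (real \<Rightarrow> complex)" where
  "kss_approx p q N dt h n = (kss_step p q N dt ^^ n) (interpolate N h)"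

end

theory Submission
  imports Defs
begin

text \<open>In Fourier space every mode is an oscillator with frequency
  \<open>s\<^sub>k = sqrt (p k\<^sup>2 + average q)\<close>, forced by the other modes through the mean-free part of the
  potential.  With the prescribed nodes, one step of the method solves this oscillator exactly while
  replacing the forcing by its first-order Taylor polynomial in time; hence the error of a mode is
  again an oscillator, driven by the Taylor remainder, by aliasing and by the error already present.
  Conjugating with the rotation \<open>exp (- \<i> s\<^sub>k t)\<close> reduces all estimates to integrating the forcing.
  Errors are summed over the modes in \<open>l\<^sup>1\<close>: the potential acts boundedly there, the rate \<open>m - 1\<close>
  leaves room for this, and \<open>l\<^sup>1\<close> bounds on Fourier coefficients are sup bounds on functions, so
  Parseval's identity is never needed.\<close>

section \<open>Fourier series of periodic functions\<close>

text \<open>The obstacle is stability: a factor other than 1 + O(h) in the error bound for one step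
  would compound over T / h steps. Errors are therefore measured in the two quantities v + i s e and
  v - i s e, whose moduli the free oscillator preserves exactly; only the mean-free potential,
  bounded independently of the grid, makes them grow. This is why no condition links the time step
  to the grid spacing although the frequencies are unbounded. The local error is h * h^2, a Taylor
  remainder of size h^2 integrated over one step, so the second time derivatives of the modes must
  be summable uniformly in time. As the solution is only assumed to be classical, the decay of its
  modes has to be derived from the decay of the data. The rate m - 1 appears twice: as the sum of
  |k|^(-m) over |k| >= N / 2 in truncation and interpolation, and as N modes with an aliasing error
  N^(-m) each in the forcing. Returning from coefficients to functions requires Fourier inversion
  for summable coefficients, and hence that a continuous function with zero coefficients
  vanishes.\<close>

definition cexp :: "int \<Rightarrow> real \<Rightarrow> complex" where
  "cexp k x = exp (\<i> * of_int k * of_real x)"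

lemma cexp_add: "cexp (j + k) x = cexp j x * cexp k x"
  by (simp add: cexp_def exp_add[symmetric] algebra_simps)

lemma cexp_0 [simp]: "cexp 0 x = 1" "cexp k 0 = 1"
  by (simp_all add: cexp_def)

lemma norm_cexp [simp]: "cmod (cexp k x) = 1"
  by (simp add: cexp_def)

lemma cexp_2pi [simp]: "cexp k (2 * pi) = 1"
  using exp_integer_2pi[of "of_int k"] by (simp add: cexp_def mult_ac)

lemma continuous_on_cexp [continuous_intros]: "continuous_on A (cexp k)"
  unfolding cexp_def by (intro continuous_intros)

lemma has_vector_derivative_cexp:
  "(cexp k has_vector_derivative \<i> * of_int k * cexp k x) (at x within A)"
proof -
  have "((\<lambda>z. exp (\<i> * of_int k * z)) has_field_derivative (\<i> * of_int k) * exp (\<i> * of_int k * of_real x)) (at (of_real x))"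
    by (auto intro!: derivative_eq_intros)
  from has_vector_derivative_real_field[OF this] show ?thesis
    by (simp add: cexp_def[abs_def])
qed

lemma integral_cexp:
  "integral {0..2*pi} (cexp k) = (if k = 0 then of_real (2 * pi) else 0)"
proof (cases "k = 0")
  case True
  have "cexp 0 = (\<lambda>x. 1)" by auto
  with True show ?thesis by (simp add: scaleR_conv_of_real)
next
  case False
  have "((\<lambda>x. \<i> * of_int k * cexp k x) has_integral cexp k (2*pi) - cexp k 0) {0..2*pi}"
    by (intro fundamental_theorem_of_calculus has_vector_derivative_cexp) simp
  hence "((\<lambda>x. (1 / (\<i> * of_int k)) * (\<i> * of_int k * cexp k x)) has_integral (1 / (\<i> * of_int k)) * 0) {0..2*pi}"
    by (intro has_integral_mult_right) simp
  hence "(cexp k has_integral 0) {0..2*pi}" using False by simp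
  thus ?thesis using False by (simp add: integral_unique)
qed

text \<open>Continuity allows the Lebesgue integral of the definition to be traded for the
  Henstock-Kurzweil integral, on which the fundamental theorem of calculus and differentiation under
  the integral are used below.\<close>

lemma fourier_coeff_integral:
  assumes "continuous_on {0..2*pi} h"
  shows "fourier_coeff h k = integral {0..2*pi} (\<lambda>x. cexp (- k) x * h x) / of_real (2 * pi)"
proof -
  have "continuous_on {0..2*pi} (\<lambda>x. exp (- \<i> * of_int k * of_real x) * h x)"
    by (intro continuous_intros assms)
  from set_lebesgue_integral_eq_integral(2)[OF absolutely_integrable_continuous_real[OF this]]
  show ?thesis by (simp add: fourier_coeff_def cexp_def)
qed

lemma fourier_coeff_le:
  assumes "continuous_on {0..2*pi} h" "\<And>x. x \<in> {0..2*pi} \<Longrightarrow> cmod (h x) \<le> M"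
  shows "cmod (fourier_coeff h k) \<le> M"
proof -
  have "norm (integral {0..2*pi} (\<lambda>x. cexp (- k) x * h x)) \<le> M * (2*pi - 0)"
    by (rule integral_bound) (auto simp: norm_mult intro!: continuous_intros assms)
  thus ?thesis
    by (simp add: fourier_coeff_integral[OF assms(1)] norm_divide field_simps)
qed

lemma fourier_coeff_diff:
  assumes "continuous_on {0..2*pi} h" "continuous_on {0..2*pi} g"
  shows "fourier_coeff (\<lambda>x. h x - g x) k = fourier_coeff h k - fourier_coeff g k"
proof -
  have "integral {0..2*pi} (\<lambda>x. cexp (- k) x * h x - cexp (- k) x * g x) =
      integral {0..2*pi} (\<lambda>x. cexp (- k) x * h x) - integral {0..2*pi} (\<lambda>x. cexp (- k) x * g x)"
    by (intro Henstock_Kurzweil_Integration.integral_diff integrable_continuous_real continuous_intros assms)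
  moreover have "continuous_on {0..2*pi} (\<lambda>x. h x - g x)" by (intro continuous_intros assms)
  ultimately show ?thesis
    using assms by (simp add: fourier_coeff_integral right_diff_distrib diff_divide_distrib)
qed

lemma fourier_coeff_sum:
  assumes "finite J" "\<And>j. j \<in> J \<Longrightarrow> continuous_on {0..2*pi} (h j)"
  shows "fourier_coeff (\<lambda>x. \<Sum>j\<in>J. h j x) k = (\<Sum>j\<in>J. fourier_coeff (h j) k)"
proof -
  have "integral {0..2*pi} (\<lambda>x. \<Sum>j\<in>J. cexp (- k) x * h j x) =
      (\<Sum>j\<in>J. integral {0..2*pi} (\<lambda>x. cexp (- k) x * h j x))"
    by (intro integral_sum integrable_continuous_real continuous_intros assms)
  moreover have "continuous_on {0..2*pi} (\<lambda>x. \<Sum>j\<in>J. h j x)" by (intro continuous_intros assms)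
  ultimately show ?thesis
    using assms by (simp add: fourier_coeff_integral sum_distrib_left sum_divide_distrib)
qed

lemma fourier_coeff_modulate:
  assumes "continuous_on {0..2*pi} h"
  shows "fourier_coeff (\<lambda>x. c * cexp j x * h x) k = c * fourier_coeff h (k - j)"
proof -
  have "continuous_on {0..2*pi} (\<lambda>x. c * cexp j x * h x)" by (intro continuous_intros assms)
  moreover have "(\<lambda>x. cexp (- k) x * (c * cexp j x * h x)) = (\<lambda>x. c * (cexp (- (k - j)) x * h x))"
    using cexp_add[of "-k" j] by (simp add: fun_eq_iff mult_ac)
  ultimately show ?thesis using assms by (simp add: fourier_coeff_integral)
qed

lemma fourier_coeff_cmult:
  assumes "continuous_on {0..2*pi} h"
  shows "fourier_coeff (\<lambda>x. c * h x) k = c * fourier_coeff h k"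
  using fourier_coeff_modulate[OF assms, of c 0 k] by simp

lemma fourier_coeff_cexp: "fourier_coeff (cexp j) k = (if j = k then 1 else 0)"
proof -
  have "(\<lambda>x. cexp (- k) x * cexp j x) = cexp (j - k)"
    using cexp_add[of "-k" j] by (simp add: fun_eq_iff algebra_simps)
  thus ?thesis by (simp add: fourier_coeff_integral continuous_intros integral_cexp)
qed

text \<open>Integration by parts: the derivative of \<open>cexp (- k) x * h x\<close> integrates to
  zero over a full period, because the endpoint values agree.\<close>

lemma fourier_coeff_derivative:
  assumes "\<And>x. (h has_vector_derivative h' x) (at x)" "continuous_on UNIV h'" "periodic2pi h"
  shows "fourier_coeff h' k = \<i> * of_int k * fourier_coeff h k"
proof -
  have ch: "continuous_on A h" for A
    using assms(1) by (meson continuous_at_imp_continuous_on has_vector_derivative_continuous)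
  have ch': "continuous_on A h'" for A using assms(2) continuous_on_subset by blast
  have "((\<lambda>x. cexp (-k) x * h' x + (- \<i> * of_int k) * (cexp (-k) x * h x)) has_integral
      cexp (-k) (2*pi) * h (2*pi) - cexp (-k) 0 * h 0) {0..2*pi}"
    by (rule fundamental_theorem_of_calculus)
      (auto intro!: derivative_eq_intros has_vector_derivative_cexp has_vector_derivative_at_within[OF assms(1)])
  moreover have "h (2 * pi) = h 0" using assms(3) by (simp add: periodic2pi_def) (metis add_0)
  ultimately have "integral {0..2*pi} (\<lambda>x. cexp (-k) x * h' x + (- \<i> * of_int k) * (cexp (-k) x * h x)) = 0"
    by (simp add: integral_unique)
  moreover have "integral {0..2*pi} (\<lambda>x. cexp (-k) x * h' x + (- \<i> * of_int k) * (cexp (-k) x * h x)) =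
     integral {0..2*pi} (\<lambda>x. cexp (-k) x * h' x) + integral {0..2*pi} (\<lambda>x. (- \<i> * of_int k) * (cexp (-k) x * h x))"
    by (intro Henstock_Kurzweil_Integration.integral_add integrable_continuous_real continuous_intros ch ch')
  ultimately show ?thesis using ch ch'
    by (simp add: fourier_coeff_integral field_simps add_eq_0_iff2)
qed

section \<open>Uniqueness of Fourier coefficients, by approximation on the unit circle\<close>

lemma periodic2pi_cis_cong:
  assumes "periodic2pi h" "cis x = cis y"
  shows "h x = h y"
proof -
  have int: "h (x + 2 * pi * of_int n) = h x" for x n
  proof (induction n rule: int_induct[where k = 0])
    case (step1 i)
    have "h (x + 2 * pi * of_int i + 2 * pi) = h (x + 2 * pi * of_int i)"
      using assms(1) by (simp add: periodic2pi_def)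
    thus ?case using step1 by (simp add: algebra_simps)
  next
    case (step2 i)
    have "h (x + 2 * pi * of_int (i - 1) + 2 * pi) = h (x + 2 * pi * of_int (i - 1))"
      using assms(1) by (simp only: periodic2pi_def)
    thus ?case using step2 by (simp add: algebra_simps)
  qed simp
  from assms(2) have "exp (\<i> * of_real x) = exp (\<i> * of_real y)" by (simp add: cis_conv_exp)
  then obtain n :: int where "\<i> * of_real x = \<i> * of_real y + (of_int (2 * n) * pi) * \<i>"
    unfolding exp_eq by auto
  hence "complex_of_real x = of_real (y + 2 * pi * of_int n)"
    by (auto simp: algebra_simps complex_eq_iff)
  hence "x = y + 2 * pi * of_int n" by (simp only: of_real_eq_iff)
  thus ?thesis by (simp add: int)
qed

text \<open>\<open>Arg\<close> jumps across the negative real axis. There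
  \<open>Arg (- z) + pi\<close> is a continuous choice of the argument, and by periodicity
  \<open>h\<close> does not distinguish the two choices.\<close>

lemma continuous_on_circle_lift:
  assumes "periodic2pi h" "continuous_on UNIV h"
  shows "continuous_on (- {0}) (\<lambda>z. h (Arg z))"
proof (intro continuous_at_imp_continuous_on ballI)
  fix z :: complex assume z: "z \<in> - {0}"
  have hc: "isCont h x" for x using assms(2) by (simp add: continuous_on_eq_continuous_at)
  show "isCont (\<lambda>z. h (Arg z)) z"
  proof (cases "z \<in> \<real>\<^sub>\<le>\<^sub>0")
    case False
    from continuous_at_compose[OF continuous_at_Arg[OF this] hc] show ?thesis by (simp add: o_def)
  next
    case True
    have "- z \<notin> \<real>\<^sub>\<le>\<^sub>0" using z True by (auto simp: complex_nonpos_Reals_iff complex_eq_iff)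
    hence "isCont (\<lambda>z. Arg (- z)) z"
      using isCont_o2[of z uminus Arg] continuous_at_Arg[of "-z"] by (simp add: continuous_minus)
    hence "isCont (\<lambda>z. Arg (- z) + pi) z" by (intro continuous_intros)
    from continuous_at_compose[OF this hc] have c: "isCont (\<lambda>z. h (Arg (- z) + pi)) z"
      by (simp add: o_def)
    have eq: "h (Arg (- w) + pi) = h (Arg w)" if "w \<noteq> 0" for w
      by (rule periodic2pi_cis_cong[OF assms(1)])
         (use that in \<open>simp add: cis_mult[symmetric] cis_Arg sgn_minus\<close>)
    have "eventually (\<lambda>w. w \<in> - {0}) (nhds z)" using z by (intro eventually_nhds_in_open) auto
    hence "eventually (\<lambda>w. h (Arg (- w) + pi) = h (Arg w)) (nhds z)"
      by eventually_elim (use eq in auto)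
    from isCont_cong[OF this] c show ?thesis by simp
  qed
qed

text \<open>On the circle a real-linear function is a combination of \<open>cexp 1\<close> and
  \<open>cexp (- 1)\<close>, so multiplication by it only shifts and combines coefficients, and zero
  coefficients stay zero. Polynomials follow by induction, with \<open>h\<close> arbitrary because
  in a product one factor acts on an already multiplied function.\<close>

lemma fourier_coeff_zero_mult_polynomial:
  assumes "real_polynomial_function R" "continuous_on UNIV h" "\<And>k. fourier_coeff h k = 0"
  shows "continuous_on UNIV (\<lambda>x. of_real (R (cis x)) * h x) \<and>
    (\<forall>k. fourier_coeff (\<lambda>x. of_real (R (cis x)) * h x) k = 0)"
  using assms
proof (induction arbitrary: h)
  case (linear R)
  interpret R: bounded_linear R by fact
  \<comment> \<open>Euler's formulas for \<open>cos x * R 1 + sin x * R \<i>\<close>; the sign of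
    \<open>d\<close> makes the combination a difference, to which \<open>fourier_coeff_diff\<close>
    applies.\<close>
  define c where "c = Complex (R 1 / 2) (- R \<i> / 2)"
  define d where "d = Complex (- R 1 / 2) (- R \<i> / 2)"
  have "of_real (R (cis x)) = c * cexp 1 x - d * cexp (-1) x" for x
  proof -
    have "cis x = cos x *\<^sub>R 1 + sin x *\<^sub>R \<i>" by (simp add: complex_eq_iff)
    hence R: "R (cis x) = cos x * R 1 + sin x * R \<i>" by (simp only: R.add R.scaleR) simp
    have "cexp 1 x = cis x" "cexp (-1) x = cis (-x)" by (simp_all add: cexp_def cis_conv_exp)
    thus ?thesis unfolding R by (simp add: c_def d_def complex_eq_iff field_simps)
  qed
  hence eq: "(\<lambda>x. of_real (R (cis x)) * h x) = (\<lambda>x. c * cexp 1 x * h x - d * cexp (-1) x * h x)"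
    by (simp only: left_diff_distrib)
  have h: "continuous_on {0..2*pi} h" using linear continuous_on_subset by blast
  have c: "continuous_on {0..2*pi} (\<lambda>x. c * cexp 1 x * h x)" "continuous_on {0..2*pi} (\<lambda>x. d * cexp (-1) x * h x)"
    by (intro continuous_intros h)+
  show ?case unfolding eq fourier_coeff_diff[OF c] fourier_coeff_modulate[OF h] using linear
    by (auto intro!: continuous_intros)
next
  case (const c)
  hence "continuous_on {0..2*pi} h" using continuous_on_subset by blast
  thus ?case using const by (auto intro!: continuous_intros simp: fourier_coeff_cmult)
next
  case (add R1 R2)
  let ?a = "\<lambda>x. of_real (R1 (cis x)) * h x" and ?b = "\<lambda>x. of_real (R2 (cis x)) * h x"
  have a: "continuous_on UNIV ?a" "\<And>k. fourier_coeff ?a k = 0"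
    and b: "continuous_on UNIV ?b" "\<And>k. fourier_coeff ?b k = 0" using add by auto
  have a': "continuous_on {0..2*pi} ?a" and b': "continuous_on {0..2*pi} ?b"
    by (rule continuous_on_subset[OF a(1)] continuous_on_subset[OF b(1)]; simp)+
  note b'' = continuous_on_mult[OF continuous_on_const[of _ "-1"] b']
  have eq: "(\<lambda>x. of_real (R1 (cis x) + R2 (cis x)) * h x) = (\<lambda>x. ?a x - (-1) * ?b x)"
    by (simp add: fun_eq_iff algebra_simps)
  show ?case unfolding eq fourier_coeff_diff[OF a' b''] fourier_coeff_cmult[OF b']
    using a b continuous_on_diff[OF a(1) continuous_on_mult[OF continuous_on_const[of _ "-1"] b(1)]] by simp
next
  case (mult R1 R2)
  show ?case using mult.IH(1)[of "\<lambda>x. of_real (R2 (cis x)) * h x"] mult.IH(2)[of h] mult.prems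
    by (simp add: mult.assoc)
qed

text \<open>Approximate the conjugate of \<open>h\<close> uniformly on the circle by a polynomial
  \<open>G\<close>. Since \<open>G * h\<close> has integral zero, the integral \<open>J\<close> of
  |h|^2 equals the integral of the approximation error times \<open>h\<close>, which is arbitrarily
  small.\<close>

lemma fourier_coeff_zero_imp_zero:
  assumes "periodic2pi h" "continuous_on UNIV h" "\<And>k. fourier_coeff h k = 0"
  shows "h x = 0"
proof -
  define F where "F = (\<lambda>z. cnj (h (Arg z)))"
  have F: "F (cis x) = cnj (h x)" for x
    unfolding F_def by (intro arg_cong[where f = cnj] periodic2pi_cis_cong[OF assms(1)])
      (simp add: cis_Arg)
  have "continuous_on (sphere 0 1) F" unfolding F_def
    by (intro continuous_intros continuous_on_subset[OF continuous_on_circle_lift[OF assms(1,2)]]) auto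
  note SW = Stone_Weierstrass_polynomial_function[OF compact_sphere this]
  have hc: "continuous_on A h" for A using assms(2) continuous_on_subset by blast
  have "bounded (h ` {0..2*pi})"
    by (intro compact_imp_bounded compact_continuous_image hc) auto
  then obtain M where M: "M > 0" "\<And>x. x \<in> {0..2*pi} \<Longrightarrow> cmod (h x) \<le> M"
    by (auto simp: bounded_pos)
  define J where "J = integral {0..2*pi} (\<lambda>x. cnj (h x) * h x)"
  have small: "cmod J \<le> e * M * (2 * pi)" if e: "e > 0" for e
  proof -
    obtain G where G: "polynomial_function G" "\<And>z. z \<in> sphere 0 1 \<Longrightarrow> cmod (F z - G z) < e"
      using SW[OF e] by auto
    have Gx: "cmod (cnj (h x) - G (cis x)) < e" for x using G(2)[of "cis x"] by (simp add: F)
    have "real_polynomial_function (\<lambda>z. Re (G z))" "real_polynomial_function (\<lambda>z. Im (G z))"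
      using G(1) bounded_linear_Re bounded_linear_Im by (auto simp: polynomial_function_def o_def)
    note Z = this[THEN fourier_coeff_zero_mult_polynomial, OF assms(2,3)]
    have c: "continuous_on {0..2*pi} (\<lambda>x. of_real (Re (G (cis x))) * h x)"
      "continuous_on {0..2*pi} (\<lambda>x. of_real (Im (G (cis x))) * h x)"
      using Z continuous_on_subset by blast+
    have i0: "integral {0..2*pi} (\<lambda>x. of_real (Re (G (cis x))) * h x) = 0"
      "integral {0..2*pi} (\<lambda>x. of_real (Im (G (cis x))) * h x) = 0"
      using Z fourier_coeff_integral[OF c(1), of 0] fourier_coeff_integral[OF c(2), of 0] by auto
    have G0: "G (cis x) * h x = of_real (Re (G (cis x))) * h x + \<i> * (of_real (Im (G (cis x))) * h x)" for x
      by (subst complex_eq[of "G (cis x)"]) (simp add: algebra_simps)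
    have cG: "continuous_on {0..2*pi} (\<lambda>x. G (cis x) * h x)"
      unfolding G0 by (intro continuous_intros c)
    have "integral {0..2*pi} (\<lambda>x. G (cis x) * h x) = 0"
      unfolding G0 using c i0
      by (subst Henstock_Kurzweil_Integration.integral_add)
        (auto intro!: integrable_continuous_real continuous_intros)
    hence "J = integral {0..2*pi} (\<lambda>x. cnj (h x) * h x) - integral {0..2*pi} (\<lambda>x. G (cis x) * h x)"
      by (simp add: J_def)
    also have "\<dots> = integral {0..2*pi} (\<lambda>x. cnj (h x) * h x - G (cis x) * h x)"
      by (intro Henstock_Kurzweil_Integration.integral_diff[symmetric] integrable_continuous_real continuous_intros hc cG)
    also have "cmod \<dots> \<le> e * M * (2 * pi - 0)"
    proof (rule integral_bound)
      fix t assume "t \<in> {0..2*pi}"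
      thus "cmod (cnj (h t) * h t - G (cis t) * h t) \<le> e * M"
        unfolding left_diff_distrib[symmetric] norm_mult
        using Gx[of t] M e by (intro mult_mono) (auto intro: less_imp_le)
    qed (auto intro!: continuous_intros hc cG)
    finally show ?thesis by simp
  qed
  have "J = 0"
  proof (rule ccontr)
    assume "J \<noteq> 0"
    \<comment> \<open>For this \<open>e\<close> the bound reads
      \<open>cmod J \<le> cmod J / 2\<close>.\<close>
    with small[of "cmod J / (2 * (M * (2 * pi)))"] M(1) show False by (simp add: field_simps)
  qed
  hence "integral {0..2*pi} (\<lambda>x. complex_of_real ((cmod (h x))\<^sup>2)) = 0"
    unfolding J_def by (simp add: complex_norm_square mult.commute del: of_real_power)
  hence i0: "integral {0..2*pi} (\<lambda>x. (cmod (h x))\<^sup>2) = 0"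
  proof -
    have "((\<lambda>x. (cmod (h x))\<^sup>2) has_integral integral {0..2*pi} (\<lambda>x. (cmod (h x))\<^sup>2)) {0..2*pi}"
      by (intro integrable_integral integrable_continuous_real continuous_intros hc)
    hence "((\<lambda>x. complex_of_real ((cmod (h x))\<^sup>2)) has_integral of_real (integral {0..2*pi} (\<lambda>x. (cmod (h x))\<^sup>2))) {0..2*pi}"
      by (rule has_integral_of_real)
    from integral_unique[OF this] show ?thesis
      using \<open>integral {0..2*pi} (\<lambda>x. complex_of_real ((cmod (h x))\<^sup>2)) = 0\<close> by simp
  qed
  have pi0: "\<not> pi \<le> 0" by (simp add: not_le)
  have z: "h y = 0" if y: "y \<in> {0..2*pi}" for y
  proof -
    have "((\<lambda>x. (cmod (h x))\<^sup>2) has_integral 0) (cbox 0 (2*pi))"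
      using i0 by (auto simp: has_integral_iff intro!: integrable_continuous_real continuous_intros hc)
    hence "(cmod (h y))\<^sup>2 = 0"
      by (rule has_integral_0_cbox_imp_0[rotated 2]) (use y in \<open>auto intro!: continuous_intros hc simp: pi0\<close>)
    thus ?thesis by simp
  qed
  have "h x = h (Arg2pi (cis x))"
    by (rule periodic2pi_cis_cong[OF assms(1)]) (use Arg2pi_eq[of "cis x"] in \<open>simp add: cis_conv_exp\<close>)
  also have "\<dots> = 0" using Arg2pi[of "cis x"] by (intro z) auto
  finally show ?thesis .
qed

text \<open>Summability makes the series converge uniformly, so its sum \<open>H\<close> is
  continuous and has the same coefficients as \<open>h\<close>; uniqueness identifies the
  two.\<close>

lemma fourier_series_has_sum:
  assumes "periodic2pi h" "continuous_on UNIV h" "(\<lambda>k. cmod (fourier_coeff h k)) summable_on UNIV"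
  shows "((\<lambda>k. fourier_coeff h k * cexp k x) has_sum h x) UNIV"
proof -
  let ?S = "\<lambda>X x. \<Sum>k\<in>X. fourier_coeff h k * cexp k x"
  define H where "H = (\<lambda>x. \<Sum>\<^sub>\<infinity>k. fourier_coeff h k * cexp k x)"
  have sm: "(\<lambda>k. fourier_coeff h k * cexp k x) summable_on UNIV" for x
    by (rule abs_summable_summable) (simp add: norm_mult assms(3))
  have ul: "uniform_limit UNIV ?S H (finite_subsets_at_top UNIV)"
    unfolding H_def by (rule Weierstrass_m_test_general[OF _ assms(3)]) (simp add: norm_mult)
  have Hc: "continuous_on UNIV H"
    by (rule uniform_limit_theorem[OF _ ul])
      (auto intro!: always_eventually continuous_intros)
  have Hc': "continuous_on {0..2*pi} H" and hc: "continuous_on {0..2*pi} h"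
    using Hc assms(2) continuous_on_subset by blast+
  have Hp: "periodic2pi H" unfolding periodic2pi_def
  proof
    fix x
    have "cexp k (x + 2 * pi) = cexp k x" for k
      using cexp_2pi[of k] by (simp add: cexp_def exp_add ring_distribs)
    thus "H (x + 2 * pi) = H x" by (simp add: H_def)
  qed
  have coeff: "fourier_coeff H k = fourier_coeff h k" for k
  proof (rule ccontr)
    define e where "e = cmod (fourier_coeff H k - fourier_coeff h k) / 2"
    assume "fourier_coeff H k \<noteq> fourier_coeff h k"
    hence e: "e > 0" by (simp add: e_def)
    have "eventually (\<lambda>X. \<forall>x\<in>UNIV. dist (?S X x) (H x) < e) (finite_subsets_at_top UNIV)"
      using uniform_limitD[OF ul e] .
    then obtain X where "finite X" "\<And>Y x. finite Y \<Longrightarrow> X \<subseteq> Y \<Longrightarrow> dist (?S Y x) (H x) < e"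
      unfolding eventually_finite_subsets_at_top by auto
    \<comment> \<open>The frequency \<open>k\<close> is adjoined to the finite set, so that the
      partial sum has exactly the same \<open>k\<close>-th coefficient as \<open>h\<close>.\<close>
    from this(1) this(2)[of "insert k X"] obtain X
      where X: "\<And>x. dist (?S X x) (H x) < e" "finite X" "k \<in> X"
      by (metis finite_insert insertI1 subset_insertI)
    have Sc: "continuous_on {0..2*pi} (?S X)" by (intro continuous_intros)
    have "fourier_coeff (?S X) k = (\<Sum>j\<in>X. fourier_coeff h j * fourier_coeff (cexp j) k)"
      using X(2) by (subst fourier_coeff_sum) (auto intro!: continuous_intros sum.cong fourier_coeff_cmult)
    also have "\<dots> = fourier_coeff h k"
      using X(2,3) by (simp add: fourier_coeff_cexp if_distrib cong: if_cong)
    finally have "fourier_coeff H k - fourier_coeff h k = fourier_coeff (\<lambda>x. H x - ?S X x) k"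
      by (simp add: fourier_coeff_diff[OF Hc' Sc])
    also have "cmod \<dots> \<le> e"
      using X(1) by (intro fourier_coeff_le continuous_intros Hc') (auto simp: dist_norm norm_minus_commute less_imp_le)
    finally show False using e by (simp add: e_def)
  qed
  have "H x - h x = 0"
    by (rule fourier_coeff_zero_imp_zero)
      (use Hp assms Hc in \<open>auto simp: periodic2pi_def fourier_coeff_diff[OF Hc' hc] coeff intro!: continuous_intros\<close>)
  thus ?thesis using has_sum_infsum[OF sm, of x] by (simp add: H_def)
qed

section \<open>Oscillators\<close>

text \<open>Conjugating with the rotation \<open>exp (- \<i> s \<tau>)\<close> turns the second-order equation into a
  plain integration of the right-hand side.\<close>

lemma oscillator_bound:
  fixes y y' y'' :: "real \<Rightarrow> complex" and s \<eta> h :: real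
  assumes "0 \<le> h"
    and y: "\<And>\<tau>. \<tau> \<in> {0..h} \<Longrightarrow> (y has_vector_derivative y' \<tau>) (at \<tau> within {0..h})"
    and y': "\<And>\<tau>. \<tau> \<in> {0..h} \<Longrightarrow> (y' has_vector_derivative y'' \<tau>) (at \<tau> within {0..h})"
    and bound: "\<And>\<tau>. \<tau> \<in> {0..h} \<Longrightarrow> cmod (y'' \<tau> + of_real (s\<^sup>2) * y \<tau>) \<le> \<eta>"
  shows "cmod (y' h + \<i> * of_real s * y h) \<le> cmod (y' 0 + \<i> * of_real s * y 0) + \<eta> * h"
proof -
  define E where "E = (\<lambda>\<tau>::real. exp (- \<i> * of_real s * of_real \<tau>))"
  have E: "(E has_vector_derivative - \<i> * of_real s * E \<tau>) (at \<tau> within A)" for \<tau> A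
  proof -
    have "((\<lambda>z. exp (- \<i> * of_real s * z)) has_field_derivative (- \<i> * of_real s) * exp (- \<i> * of_real s * of_real \<tau>)) (at (of_real \<tau>))"
      by (auto intro!: derivative_eq_intros)
    from has_vector_derivative_real_field[OF this] show ?thesis by (simp add: E_def)
  qed
  have nE: "cmod (E \<tau>) = 1" for \<tau> by (simp add: E_def)
  define Z where "Z = (\<lambda>\<tau>. E \<tau> * (y' \<tau> + \<i> * of_real s * y \<tau>))"
  define Z' where "Z' = (\<lambda>\<tau>. E \<tau> * (y'' \<tau> + of_real (s\<^sup>2) * y \<tau>))"
  \<comment> \<open>With D the time derivative, D^2 + s^2 = (D - i s)(D + i s); the rotation
    \<open>E\<close> absorbs the first factor.\<close>
  have Z: "(Z has_vector_derivative Z' \<tau>) (at \<tau> within {0..h})" if "\<tau> \<in> {0..h}" for \<tau>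
    unfolding Z_def
    by (rule derivative_eq_intros E y[OF that] y'[OF that] refl)+
       (simp add: Z'_def algebra_simps power2_eq_square)
  have "norm (Z h - Z 0) \<le> \<eta> * norm (h - 0)"
  proof (rule differentiable_bound[where S = "{0..h}" and f' = "\<lambda>\<tau> x. x *\<^sub>R Z' \<tau>"])
    fix \<tau> assume \<tau>: "\<tau> \<in> {0..h}"
    show "(Z has_derivative (\<lambda>x. x *\<^sub>R Z' \<tau>)) (at \<tau> within {0..h})"
      using Z[OF \<tau>] by (simp add: has_vector_derivative_def)
    show "onorm (\<lambda>x. x *\<^sub>R Z' \<tau>) \<le> \<eta>"
      using bound[OF \<tau>] by (simp add: onorm_scaleR_left[OF bounded_linear_ident] onorm_id Z'_def norm_mult nE)
  qed (use assms(1) in auto)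
  moreover have "norm (Z h) \<le> norm (Z h - Z 0) + norm (Z 0)" using norm_triangle_ineq[of "Z h - Z 0" "Z 0"] by simp
  ultimately show ?thesis using assms(1) by (simp add: Z_def norm_mult nE)
qed

lemma real_has_vector_derivative:
  assumes "(f has_real_derivative f') (at t within A)"
  shows "((\<lambda>t. complex_of_real (f t)) has_vector_derivative of_real f') (at t within A)"
  using has_vector_derivative_of_real[OF assms] .

text \<open>One step of the method solves \<open>z'' = - s\<^sup>2 z - a - b \<tau>\<close> exactly, so the error of a mode is
  itself an oscillator driven by the residual of \<open>y\<close>.\<close>

lemma frozen_oscillator_error:
  fixes y y' y'' :: "real \<Rightarrow> complex" and s \<eta> h :: real and z0 v0 a b :: complex
  assumes "0 \<le> h" "s \<noteq> 0"
    and y: "\<And>\<tau>. \<tau> \<in> {0..h} \<Longrightarrow> (y has_vector_derivative y' \<tau>) (at \<tau> within {0..h})"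
    and y': "\<And>\<tau>. \<tau> \<in> {0..h} \<Longrightarrow> (y' has_vector_derivative y'' \<tau>) (at \<tau> within {0..h})"
    and bound: "\<And>\<tau>. \<tau> \<in> {0..h} \<Longrightarrow> cmod (y'' \<tau> + of_real (s\<^sup>2) * y \<tau> + a + of_real \<tau> * b) \<le> \<eta>"
    and z: "z = of_real (cos (s * h)) * z0 + of_real (sin (s * h) / s) * v0
      + of_real ((cos (s * h) - 1) / s\<^sup>2) * a + of_real ((sin (s * h) / s - h) / s\<^sup>2) * b"
    and v: "v = of_real (- s * sin (s * h)) * z0 + of_real (cos (s * h)) * v0
      - of_real (sin (s * h) / s) * a + of_real ((cos (s * h) - 1) / s\<^sup>2) * b"
  shows "cmod ((y' h - v) + \<i> * of_real s * (y h - z)) \<le>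
    cmod ((y' 0 - v0) + \<i> * of_real s * (y 0 - z0)) + \<eta> * h"
proof -
  \<comment> \<open>Duhamel's formula: the coefficients of \<open>a\<close> and \<open>b\<close> are
    the responses, with zero initial data, to the forcings -1 and - \<tau>.\<close>
  define Z where "Z = (\<lambda>\<tau>. of_real (cos (s * \<tau>)) * z0 + of_real (sin (s * \<tau>) / s) * v0
      + of_real ((cos (s * \<tau>) - 1) / s\<^sup>2) * a + of_real ((sin (s * \<tau>) / s - \<tau>) / s\<^sup>2) * b)"
  define Z' where "Z' = (\<lambda>\<tau>. of_real (- s * sin (s * \<tau>)) * z0 + of_real (cos (s * \<tau>)) * v0
      + of_real (- sin (s * \<tau>) / s) * a + of_real ((cos (s * \<tau>) - 1) / s\<^sup>2) * b)"
  define Z'' where "Z'' = (\<lambda>\<tau>. of_real (- s\<^sup>2 * cos (s * \<tau>)) * z0 + of_real (- s * sin (s * \<tau>)) * v0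
      + of_real (- cos (s * \<tau>)) * a + of_real (- sin (s * \<tau>) / s) * b)"
  have c: "((\<lambda>\<tau>. cos (s * \<tau>)) has_real_derivative - s * sin (s * \<tau>)) (at \<tau> within A)"
    and c1: "((\<lambda>\<tau>. (cos (s * \<tau>) - 1) / s\<^sup>2) has_real_derivative - sin (s * \<tau>) / s) (at \<tau> within A)"
    and sn: "((\<lambda>\<tau>. sin (s * \<tau>) / s) has_real_derivative cos (s * \<tau>)) (at \<tau> within A)"
    and sn1: "((\<lambda>\<tau>. - s * sin (s * \<tau>)) has_real_derivative - s\<^sup>2 * cos (s * \<tau>)) (at \<tau> within A)"
    and sn2: "((\<lambda>\<tau>. - sin (s * \<tau>) / s) has_real_derivative - cos (s * \<tau>)) (at \<tau> within A)"
    for \<tau> A using \<open>s \<noteq> 0\<close>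
    by (auto intro!: derivative_eq_intros simp: power2_eq_square)
  have d: "((\<lambda>\<tau>. (sin (s * \<tau>) / s - \<tau>) / s\<^sup>2) has_real_derivative (cos (s * \<tau>) - 1) / s\<^sup>2) (at \<tau> within A)"
    for \<tau> A by (intro DERIV_cdivide DERIV_diff sn DERIV_ident)
  have Z: "(Z has_vector_derivative Z' \<tau>) (at \<tau> within A)" for \<tau> A
    unfolding Z_def Z'_def
    by (intro has_vector_derivative_add has_vector_derivative_mult_left real_has_vector_derivative
        c c1 sn d)
  have Z': "(Z' has_vector_derivative Z'' \<tau>) (at \<tau> within A)" for \<tau> A
    unfolding Z''_def Z'_def
    by (intro has_vector_derivative_add has_vector_derivative_mult_left real_has_vector_derivative
        c c1 sn1 sn2)
  have ode: "Z'' \<tau> + of_real (s\<^sup>2) * Z \<tau> = - a - of_real \<tau> * b" for \<tau>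
  proof -
    have s: "complex_of_real s * of_real s * (x / (of_real s * of_real s)) = x"
      "complex_of_real s * of_real s * (x / of_real s) = of_real s * x" for x
      using \<open>s \<noteq> 0\<close> by (simp_all add: field_simps)
    show ?thesis using \<open>s \<noteq> 0\<close>
      by (simp add: Z_def Z''_def power2_eq_square ring_distribs) (simp add: field_simps)
  qed
  have "cmod ((y' h - Z' h) + \<i> * of_real s * (y h - Z h)) \<le>
    cmod ((y' 0 - Z' 0) + \<i> * of_real s * (y 0 - Z 0)) + \<eta> * h"
  proof (rule oscillator_bound[where y'' = "\<lambda>\<tau>. y'' \<tau> - Z'' \<tau>"])
    fix \<tau> assume \<tau>: "\<tau> \<in> {0..h}"
    have "y'' \<tau> - Z'' \<tau> + of_real (s\<^sup>2) * (y \<tau> - Z \<tau>) =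
      y'' \<tau> + of_real (s\<^sup>2) * y \<tau> - (Z'' \<tau> + of_real (s\<^sup>2) * Z \<tau>)"
      by (simp add: algebra_simps)
    thus "cmod (y'' \<tau> - Z'' \<tau> + of_real (s\<^sup>2) * (y \<tau> - Z \<tau>)) \<le> \<eta>"
      using bound[OF \<tau>] by (simp only: ode) (simp add: algebra_simps)
  qed (auto intro!: has_vector_derivative_diff Z Z' y y' assms(1))
  moreover have "Z h = z" "Z 0 = z0" "Z' h = v" "Z' 0 = v0" using \<open>s \<noteq> 0\<close> by (simp_all add: Z_def Z'_def z v)
  ultimately show ?thesis by simp
qed

text \<open>Half the sum of the two characteristic quantities is \<open>v\<close>, half their
  difference is \<open>\<i> * s * e\<close>. Both signs are needed because \<open>e\<close> and
  \<open>v\<close> are complex: one of the quantities may vanish although \<open>e\<close> and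
  \<open>v\<close> do not.\<close>

lemma norm_le_characteristic:
  fixes e v :: complex
  shows "cmod v \<le> cmod (v + \<i> * of_real s * e) + cmod (v + \<i> * of_real (- s) * e)"
    and "\<bar>s\<bar> * cmod e \<le> cmod (v + \<i> * of_real s * e) + cmod (v + \<i> * of_real (- s) * e)"
proof -
  let ?a = "v + \<i> * of_real s * e" and ?b = "v + \<i> * of_real (- s) * e"
  have "?a + ?b = 2 * v" by (simp add: algebra_simps)
  hence "cmod (?a + ?b) = 2 * cmod v" by (simp only: norm_mult) simp
  with norm_triangle_ineq[of ?a ?b] norm_ge_zero[of ?a] norm_ge_zero[of ?b]
  show "cmod v \<le> cmod ?a + cmod ?b" by linarith
  have "?a - ?b = 2 * (\<i> * of_real s * e)" by (simp add: algebra_simps)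
  hence "cmod (?a - ?b) = 2 * (\<bar>s\<bar> * cmod e)" by (simp only: norm_mult) simp
  with norm_triangle_ineq4[of ?a ?b] norm_ge_zero[of ?a] norm_ge_zero[of ?b]
  show "\<bar>s\<bar> * cmod e \<le> cmod ?a + cmod ?b" by linarith
qed

section \<open>Decaying sequences on the integers\<close>

text \<open>Comparable to sqrt (1 + k^2) and positive at \<open>k = 0\<close>, so that decay can be
  stated as a quotient for all modes at once.\<close>

definition bracket :: "int \<Rightarrow> real" where
  "bracket k = 1 + \<bar>of_int k\<bar>"

lemma bracket_ge_1: "bracket k \<ge> 1" by (simp add: bracket_def)

lemma bracket_pos [simp]: "bracket k > 0" "bracket k \<noteq> 0" "bracket k \<ge> 0" using bracket_ge_1[of k] by auto

text \<open>Peetre's inequality: a shift by at most \<open>W\<close> costs only a factor, since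
  \<open>bracket\<close> is at least 1. This is why a banded potential preserves polynomial
  decay.\<close>

lemma bracket_shift:
  assumes "\<bar>j\<bar> \<le> W"
  shows "bracket k \<le> (1 + of_int W) * bracket (k - j)"
proof -
  have "\<bar>of_int k\<bar> \<le> \<bar>of_int (k - j)\<bar> + \<bar>real_of_int j\<bar>" by simp
  moreover have j: "\<bar>real_of_int j\<bar> \<le> of_int W" using assms by linarith
  moreover have "of_int W * 1 \<le> of_int W * bracket (k - j)"
    using j by (intro mult_left_mono bracket_ge_1) linarith
  moreover have "(1 + of_int W) * bracket (k - j) = of_int W * bracket (k - j) + 1 + \<bar>real_of_int (k - j)\<bar>"
    by (simp add: bracket_def algebra_simps)
  ultimately show ?thesis unfolding bracket_def[of k] by linarith
qed

lemma bracket_power_shift: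
  assumes "\<bar>j\<bar> \<le> W"
  shows "1 / bracket (k - j) ^ n \<le> (1 + of_int W) ^ n / bracket k ^ n"
proof -
  have "bracket k ^ n \<le> ((1 + of_int W) * bracket (k - j)) ^ n"
    by (intro power_mono bracket_shift assms) (simp add: bracket_def)
  thus ?thesis unfolding power_mult_distrib by (simp add: divide_le_eq le_divide_eq mult_ac)
qed

text \<open>Telescoping with 1 / (1 + k)^2 <= 1 / k - 1 / (k + 1).\<close>

lemma sum_inverse_square_tail:
  fixes K L :: nat
  assumes "K \<ge> 1"
  shows "(\<Sum>k=K..L. 1 / (1 + real k) ^ 2) \<le> 1 / real K"
proof (cases "K \<le> L")
  case False
  thus ?thesis by simp
next
  case True
  have "(\<Sum>k=K..L. 1 / (1 + real k) ^ 2) \<le> 1 / real K - 1 / (real L + 1)"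
    using True
  proof (induction L rule: dec_induct)
    case base
    have "1 / (1 + real K) ^ 2 \<le> 1 / (real K * (real K + 1))"
      using assms by (intro divide_left_mono) (auto simp: power2_eq_square intro!: mult_mono)
    also have "\<dots> = 1 / real K - 1 / (real K + 1)" using assms by (simp add: field_simps)
    finally show ?case by simp
  next
    case (step L)
    have "1 / (2 + real L) ^ 2 \<le> 1 / ((real L + 1) * (real L + 2))"
      by (intro divide_left_mono) (auto simp: power2_eq_square intro!: mult_mono)
    also have "\<dots> = 1 / (real L + 1) - 1 / (real L + 2)" by (simp add: field_simps)
    finally have "1 / (2 + real L) ^ 2 \<le> 1 / (real L + 1) - 1 / (real L + 2)" .
    thus ?case using step by (simp add: add_ac)
  qed
  also have "\<dots> \<le> 1 / real K" by simp
  finally show ?thesis .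
qed

text \<open>On each of the two half-lines the absolute value is injective, which reduces each part
  to a tail over the naturals.\<close>

lemma sum_bracket_square_tail:
  assumes "finite X" "K \<ge> 1" "\<And>k. k \<in> X \<Longrightarrow> int K \<le> \<bar>k\<bar>"
  shows "(\<Sum>k\<in>X. 1 / bracket k ^ 2) \<le> 2 / real K"
proof -
  have part: "(\<Sum>k\<in>Y. 1 / bracket k ^ 2) \<le> 1 / real K"
    if Y: "finite Y" "inj_on (\<lambda>k. nat \<bar>k\<bar>) Y" "\<And>k. k \<in> Y \<Longrightarrow> int K \<le> \<bar>k\<bar>" for Y
  proof -
    let ?g = "\<lambda>k::int. nat \<bar>k\<bar>"
    obtain L where L: "\<And>k. k \<in> ?g ` Y \<Longrightarrow> k \<le> L"
      using finite_nat_set_iff_bounded_le[of "?g ` Y"] Y(1) by auto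
    have "(\<Sum>k\<in>Y. 1 / bracket k ^ 2) = (\<Sum>k\<in>?g ` Y. 1 / (1 + real k) ^ 2)"
      using Y(2) by (simp add: sum.reindex bracket_def)
    also have "\<dots> \<le> (\<Sum>k=K..L. 1 / (1 + real k) ^ 2)"
      using Y(3) L by (intro sum_mono2) (auto, force)
    finally show ?thesis using sum_inverse_square_tail[OF assms(2), of L] by simp
  qed
  have "(\<Sum>k\<in>X. 1 / bracket k ^ 2) = (\<Sum>k\<in>X \<inter> {0..}. 1 / bracket k ^ 2) + (\<Sum>k\<in>X - {0..}. 1 / bracket k ^ 2)"
    using assms(1) by (subst sum.Int_Diff) auto
  also have "\<dots> \<le> 1 / real K + 1 / real K"
    by (intro add_mono part) (use assms in \<open>force simp: inj_on_def\<close>)+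
  finally show ?thesis by simp
qed

lemma sum_bracket_square:
  assumes "finite X"
  shows "(\<Sum>k\<in>X. 1 / bracket k ^ 2) \<le> 3"
proof -
  have "(\<Sum>k\<in>X. 1 / bracket k ^ 2) = (\<Sum>k\<in>X \<inter> {0}. 1 / bracket k ^ 2) + (\<Sum>k\<in>X - {0}. 1 / bracket k ^ 2)"
    using assms by (subst sum.Int_Diff) auto
  also have "(\<Sum>k\<in>X \<inter> {0}. 1 / bracket k ^ 2) \<le> (\<Sum>k\<in>{0}. 1 / bracket k ^ 2)"
    by (intro sum_mono2) auto
  also have "(\<Sum>k\<in>X - {0}. 1 / bracket k ^ 2) \<le> 2 / real 1"
    by (rule sum_bracket_square_tail) (use assms in auto)
  finally show ?thesis by (simp add: bracket_def)
qed

text \<open>With \<open>K = N div 2\<close>, all but two of the \<open>m\<close> factors are at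
  least \<open>K\<close>, and the remaining tail of inverse squares contributes one more factor 1 /
  K. This is the origin of the exponent \<open>m - 1\<close>.\<close>

lemma sum_bracket_power_tail:
  assumes "finite X" "N \<ge> 2" "m \<ge> 2" "\<And>k. k \<in> X \<Longrightarrow> int N \<le> 2 * \<bar>k\<bar>" "even N"
  shows "(\<Sum>k\<in>X. 1 / bracket k ^ m) \<le> 2 * (2 / real N) ^ (m - 1)"
proof -
  define K where "K = N div 2"
  have K: "K \<ge> 1" "2 / real N = 1 / real K" "\<And>k. k \<in> X \<Longrightarrow> int K \<le> \<bar>k\<bar>"
    using assms by (auto simp: K_def elim!: evenE)
  have "1 / bracket k ^ m \<le> 1 / real K ^ (m - 2) * (1 / bracket k ^ 2)" if "k \<in> X" for k
  proof -
    have "real K ^ (m - 2) \<le> bracket k ^ (m - 2)"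
      using K(3)[OF that] by (intro power_mono) (auto simp: bracket_def)
    moreover have "bracket k ^ m = bracket k ^ (m - 2) * bracket k ^ 2"
      using assms(3) by (metis le_add_diff_inverse2 power_add)
    ultimately show ?thesis using K(1) by (simp add: field_simps)
  qed
  hence "(\<Sum>k\<in>X. 1 / bracket k ^ m) \<le> (\<Sum>k\<in>X. 1 / real K ^ (m - 2) * (1 / bracket k ^ 2))"
    by (rule sum_mono)
  also have "\<dots> \<le> 1 / real K ^ (m - 2) * (2 / real K)"
    unfolding sum_distrib_left[symmetric]
    by (intro mult_left_mono sum_bracket_square_tail K assms(1)) auto
  also have "\<dots> = 2 / real K ^ Suc (m - 2)" by simp
  also have "Suc (m - 2) = m - 1" using assms(3) by simp
  finally show ?thesis by (simp add: K(2) power_divide)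
qed

section \<open>Decay of the Fourier modes\<close>

definition freq :: "real \<Rightarrow> real \<Rightarrow> int \<Rightarrow> real" where
  "freq p c k = sqrt (p * (of_int k)\<^sup>2 + c)"

text \<open>The comparison with \<open>bracket\<close> lets division by the frequency count as one
  order of decay; the 2 in the lower bound comes from (1 + |k|)^2 <= 2 (1 + k^2). The last two
  bounds turn frequency-weighted errors into errors of the space derivative and of the function
  itself.\<close>

lemma freq_props:
  assumes "p > 0" "c > 0"
  shows "freq p c k > 0" "(freq p c k)\<^sup>2 = p * (of_int k)\<^sup>2 + c"
    "sqrt (min p c / 2) * bracket k \<le> freq p c k" "freq p c k \<le> sqrt (max p c) * bracket k"
    "sqrt p * \<bar>of_int k\<bar> \<le> freq p c k" "sqrt c \<le> freq p c k"
proof -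
  have pos: "p * (of_int k)\<^sup>2 + c > 0" using assms by (intro add_nonneg_pos) auto
  thus "freq p c k > 0" "(freq p c k)\<^sup>2 = p * (of_int k)\<^sup>2 + c" by (auto simp: freq_def)
  have "min p c / 2 * (bracket k)\<^sup>2 \<le> min p c / 2 * (2 * (1 + (of_int k)\<^sup>2))"
    using assms sum_squares_bound[of 1 "\<bar>real_of_int k\<bar>"]
    by (intro mult_left_mono) (auto simp: bracket_def power2_sum)
  also have "\<dots> = min p c * (of_int k)\<^sup>2 + min p c" by (simp add: algebra_simps)
  also have "\<dots> \<le> p * (of_int k)\<^sup>2 + c" by (intro add_mono mult_right_mono) auto
  finally show "sqrt (min p c / 2) * bracket k \<le> freq p c k"
    unfolding freq_def by (intro real_le_rsqrt) (use assms in \<open>auto simp: power_mult_distrib\<close>)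
  have "p * (of_int k)\<^sup>2 + c \<le> max p c * (of_int k)\<^sup>2 + max p c" by (intro add_mono mult_right_mono) auto
  also have "\<dots> = max p c * ((of_int k)\<^sup>2 + 1)" by (simp add: algebra_simps)
  also have "\<dots> \<le> max p c * (bracket k)\<^sup>2" using assms
    by (intro mult_left_mono) (auto simp: bracket_def power2_sum)
  finally show "freq p c k \<le> sqrt (max p c) * bracket k"
    unfolding freq_def by (intro real_le_lsqrt) (use assms bracket_ge_1[of k] in \<open>auto simp: power_mult_distrib\<close>)
  show "sqrt p * \<bar>of_int k\<bar> \<le> freq p c k"
    unfolding freq_def by (intro real_le_rsqrt) (use assms in \<open>auto simp: power_mult_distrib\<close>)
  show "sqrt c \<le> freq p c k" unfolding freq_def using assms by simp
qed

lemma banded_sum_decay: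
  fixes b :: "int \<Rightarrow> complex"
  assumes "\<And>k. cmod (x k) \<le> M / bracket k ^ n" "W \<ge> 0"
  shows "cmod (\<Sum>j\<in>{-W..W}. b j * x (k - j)) \<le> (\<Sum>j\<in>{-W..W}. cmod (b j)) * (1 + of_int W) ^ n * M / bracket k ^ n"
proof -
  \<comment> \<open>The bound at index 0, where \<open>bracket\<close> is 1, already forces
    \<open>M\<close> to be nonnegative.\<close>
  have M: "M \<ge> 0" using order_trans[OF norm_ge_zero assms(1)[of 0]] by (simp add: bracket_def)
  have "cmod (\<Sum>j\<in>{-W..W}. b j * x (k - j)) \<le> (\<Sum>j\<in>{-W..W}. cmod (b j) * ((1 + of_int W) ^ n * M / bracket k ^ n))"
  proof (rule sum_norm_le)
    fix j assume "j \<in> {-W..W}"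
    hence "M * (1 / bracket (k - j) ^ n) \<le> M * ((1 + of_int W) ^ n / bracket k ^ n)"
      using M by (intro mult_left_mono bracket_power_shift) auto
    hence "cmod (x (k - j)) \<le> (1 + of_int W) ^ n * M / bracket k ^ n"
      using assms(1)[of "k - j"] by (simp add: mult.commute)
    thus "cmod (b j * x (k - j)) \<le> cmod (b j) * ((1 + of_int W) ^ n * M / bracket k ^ n)"
      unfolding norm_mult by (intro mult_left_mono) auto
  qed
  also have "\<dots> = (\<Sum>j\<in>{-W..W}. cmod (b j)) * ((1 + of_int W) ^ n * M / bracket k ^ n)"
    by (rule sum_distrib_right[symmetric])
  finally show ?thesis by (simp add: mult_ac)
qed

text \<open>The potential is bounded on sequences of decay \<open>r\<close>, and dividing the oscillator estimate by the
  frequency gains one order; iterating from mere boundedness reaches the decay of the data.\<close>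

lemma fourier_decay_bootstrap:
  fixes U V A :: "int \<Rightarrow> real \<Rightarrow> complex" and b :: "int \<Rightarrow> complex" and W :: int and p c T :: real
  assumes "T \<ge> 0" "p > 0" "c > 0" "W \<ge> 0"
    and U: "\<And>k t. t \<in> {0..T} \<Longrightarrow> (U k has_vector_derivative V k t) (at t within {0..T})"
    and V: "\<And>k t. t \<in> {0..T} \<Longrightarrow> (V k has_vector_derivative A k t) (at t within {0..T})"
    and ode: "\<And>k t. t \<in> {0..T} \<Longrightarrow>
      A k t = - of_real ((freq p c k)\<^sup>2) * U k t - (\<Sum>j\<in>{-W..W}. b j * U (k - j) t)"
    and U0: "\<And>k t. t \<in> {0..T} \<Longrightarrow> cmod (U k t) \<le> M0"
    and init: "\<And>k. cmod (U k 0) \<le> M1 / bracket k ^ (n + 1)" "\<And>k. cmod (V k 0) \<le> M1 / bracket k ^ n"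
  shows "\<exists>M\<ge>0. \<forall>k. \<forall>t\<in>{0..T}. cmod (U k t) \<le> M / bracket k ^ (n + 1) \<and> cmod (V k t) \<le> M / bracket k ^ n"
proof -
  define C where "C = (\<Sum>j\<in>{-W..W}. cmod (b j))"
  define c0 where "c0 = sqrt (min p c / 2)"
  define c1 where "c1 = sqrt (max p c)"
  have c: "c0 > 0" "c1 > 0" using assms(2,3) by (auto simp: c0_def c1_def)
  have C: "C \<ge> 0" by (simp add: C_def sum_nonneg)
  have M1: "M1 \<ge> 0" using order_trans[OF norm_ge_zero init(2)[of 0]] by (simp add: bracket_def)
  have step: "\<exists>M'\<ge>0. \<forall>k. \<forall>t\<in>{0..T}. cmod (U k t) \<le> M' / bracket k ^ (r + 1) \<and> cmod (V k t) \<le> M' / bracket k ^ r"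
    if r: "r \<le> n" and M: "M \<ge> 0" and dec: "\<And>k t. t \<in> {0..T} \<Longrightarrow> cmod (U k t) \<le> M / bracket k ^ r" for r M
  proof -
    define \<eta> where "\<eta> = C * (1 + of_int W) ^ r * M"
    have \<eta>: "\<eta> \<ge> 0" using C M assms(4) by (auto simp: \<eta>_def)
    define K where "K = M1 * (1 + c1) + \<eta> * T"
    have K: "K \<ge> 0" using c M1 \<eta> assms(1) by (simp add: K_def)
    have char: "cmod (V k t + \<i> * of_real s * U k t) \<le> K / bracket k ^ r"
      if t: "t \<in> {0..T}" and s: "\<bar>s\<bar> = freq p c k" for k t s
    proof -
      have s2: "s\<^sup>2 = (freq p c k)\<^sup>2" using s by (metis power2_abs)
      have "cmod (V k t + \<i> * of_real s * U k t) \<le> cmod (V k 0 + \<i> * of_real s * U k 0) + (\<eta> / bracket k ^ r) * t"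
      proof (rule oscillator_bound[where y'' = "A k"])
        fix \<tau> assume "\<tau> \<in> {0..t}"
        hence \<tau>: "\<tau> \<in> {0..T}" using t by auto
        have "A k \<tau> + of_real (s\<^sup>2) * U k \<tau> = - (\<Sum>j\<in>{-W..W}. b j * U (k - j) \<tau>)"
          by (simp add: ode[OF \<tau>] s2 del: of_real_power)
        thus "cmod (A k \<tau> + of_real (s\<^sup>2) * U k \<tau>) \<le> \<eta> / bracket k ^ r"
          using banded_sum_decay[where x = "\<lambda>k. U k \<tau>", OF dec[OF \<tau>] assms(4), of b k]
          by (simp add: C_def \<eta>_def)
        show "(U k has_vector_derivative V k \<tau>) (at \<tau> within {0..t})"
          by (rule has_vector_derivative_within_subset[OF U[OF \<tau>]]) (use t in auto)
        show "(V k has_vector_derivative A k \<tau>) (at \<tau> within {0..t})"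
          by (rule has_vector_derivative_within_subset[OF V[OF \<tau>]]) (use t in auto)
      qed (use t in auto)
      \<comment> \<open>The frequency uses up the extra order of decay of \<open>U k 0\<close>, so
        both initial terms are of order \<open>n\<close>.\<close>
      also have "cmod (V k 0 + \<i> * of_real s * U k 0) \<le> M1 / bracket k ^ n + (c1 * bracket k) * (M1 / bracket k ^ (n + 1))"
      proof -
        have "cmod (\<i> * of_real s * U k 0) \<le> (c1 * bracket k) * (M1 / bracket k ^ (n + 1))"
          unfolding norm_mult using s freq_props(4)[OF assms(2,3), of k, folded c1_def] c bracket_ge_1[of k]
          by (intro mult_mono[OF _ init(1)]) auto
        thus ?thesis using init(2)[of k] norm_triangle_ineq by (smt (verit))
      qed
      also have "\<dots> = (M1 * (1 + c1)) / bracket k ^ n" by (simp add: field_simps)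
      also have "\<dots> \<le> (M1 * (1 + c1)) / bracket k ^ r"
        using r M1 c bracket_ge_1[of k] by (intro divide_left_mono power_increasing) auto
      also have "(\<eta> / bracket k ^ r) * t \<le> (\<eta> / bracket k ^ r) * T"
        using t \<eta> bracket_ge_1[of k] by (intro mult_left_mono) auto
      finally show ?thesis by (simp add: K_def add_divide_distrib)
    qed
    have "cmod (U k t) \<le> (2 * K / c0 + 2 * K) / bracket k ^ (r + 1) \<and> cmod (V k t) \<le> (2 * K / c0 + 2 * K) / bracket k ^ r"
      if t: "t \<in> {0..T}" for k t
    proof
      define s where "s = freq p c k"
      have s: "s > 0" "c0 * bracket k \<le> s" using freq_props[OF assms(2,3), of k] by (auto simp: s_def c0_def)
      have sum: "cmod (V k t + \<i> * of_real s * U k t) + cmod (V k t + \<i> * of_real (- s) * U k t) \<le> 2 * K / bracket k ^ r"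
        using char[OF t, of s k] char[OF t, of "-s" k] s(1) by (simp add: s_def)
      have "2 * K / bracket k ^ r \<le> (2 * K / c0 + 2 * K) / bracket k ^ r"
        using K c by (intro divide_right_mono) auto
      thus "cmod (V k t) \<le> (2 * K / c0 + 2 * K) / bracket k ^ r"
        using norm_le_characteristic(1)[of "V k t" s "U k t"] sum by linarith
      have "c0 * bracket k * cmod (U k t) \<le> \<bar>s\<bar> * cmod (U k t)"
        using s by (intro mult_right_mono) auto
      also have "\<dots> \<le> 2 * K / bracket k ^ r"
        using norm_le_characteristic(2)[of s "U k t" "V k t"] sum by linarith
      finally have "cmod (U k t) \<le> 2 * K / c0 / bracket k ^ (r + 1)"
        using c by (simp add: field_simps)
      also have "\<dots> \<le> (2 * K / c0 + 2 * K) / bracket k ^ (r + 1)"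
        using K c by (intro divide_right_mono) auto
      finally show "cmod (U k t) \<le> (2 * K / c0 + 2 * K) / bracket k ^ (r + 1)" .
    qed
    moreover have "2 * K / c0 + 2 * K \<ge> 0" using K c by simp
    ultimately show ?thesis by blast
  qed
  have "\<exists>M\<ge>0. \<forall>k. \<forall>t\<in>{0..T}. cmod (U k t) \<le> M / bracket k ^ r" if "r \<le> n" for r
    using that
  proof (induction r)
    case 0
    have "M0 \<ge> 0" using order_trans[OF norm_ge_zero U0[of 0 0]] assms(1) by simp
    thus ?case using U0 by (intro exI[of _ M0]) auto
  next
    case (Suc r)
    then obtain M where "M \<ge> 0" "\<And>k t. t \<in> {0..T} \<Longrightarrow> cmod (U k t) \<le> M / bracket k ^ r" by auto
    from step[OF _ this] Suc.prems show ?case by (metis Suc_leD Suc_eq_plus1)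
  qed
  from this[of n] obtain M where "M \<ge> 0" "\<And>k t. t \<in> {0..T} \<Longrightarrow> cmod (U k t) \<le> M / bracket k ^ n" by auto
  \<comment> \<open>At \<open>r = n\<close> the division by the frequency yields the last order for
    \<open>U\<close>, together with order \<open>n\<close> for \<open>V\<close>.\<close>
  from step[OF _ this] show ?thesis by simp
qed

section \<open>The method in Fourier space\<close>

definition grid_waves :: "nat \<Rightarrow> int set" where
  "grid_waves N = {- int (N div 2) + 1 .. int (N div 2)}"

text \<open>Defined for all integers and not only for those in \<open>grid_waves\<close>: the
  convolution with the potential leaves the grid, and the periodicity \<open>dcoef_periodic\<close>
  then accounts for aliasing.\<close>

definition dcoef :: "nat \<Rightarrow> complex vec \<Rightarrow> int \<Rightarrow> complex" where
  "dcoef N w k = (\<Sum>j<N. cexp (- k) (grid_point N j) * w $ j) / of_nat N"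

text \<open>The Fourier coefficients of the potential minus its mean; the mean itself is absorbed
  into the frequency.\<close>

definition deviation_coeff :: "(int \<Rightarrow> complex) \<Rightarrow> int \<Rightarrow> complex" where
  "deviation_coeff c j = (if j = 0 then 0 else c j)"

lemma sum_deviation_coeff:
  assumes "W \<ge> 0"
  shows "(\<Sum>j\<in>{-W..W}. c j * x (k - j)) = c 0 * x k + (\<Sum>j\<in>{-W..W}. deviation_coeff c j * x (k - j))"
proof -
  have "(\<Sum>j\<in>{-W..W}. c j * x (k - j)) = c 0 * x k + (\<Sum>j\<in>{-W..W} - {0}. c j * x (k - j))"
    using assms by (subst sum.remove[of _ 0]) auto
  also have "(\<Sum>j\<in>{-W..W} - {0}. c j * x (k - j)) = (\<Sum>j\<in>{-W..W} - {0}. deviation_coeff c j * x (k - j))"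
    by (intro sum.cong) (auto simp: deviation_coeff_def)
  also have "\<dots> = (\<Sum>j\<in>{-W..W}. deviation_coeff c j * x (k - j))"
    using assms by (subst (2) sum.remove[of _ 0]) (auto simp: deviation_coeff_def)
  finally show ?thesis .
qed

lemma finite_grid_waves [simp]: "finite (grid_waves N)"
  by (simp add: grid_waves_def)

lemma grid_wavesE:
  assumes "even N" "k \<in> grid_waves N"
  obtains r where "r < N" "k = wave_number N r"
proof -
  have "k \<in> wave_number N ` {..<N}"
    unfolding bij_betw_imp_surj_on[OF bij_betw_wave_number[OF assms(1)]]
    using assms(2) by (simp add: grid_waves_def)
  thus thesis using that by auto
qed

lemma cexp_multiple_grid:
  assumes "N > 0"
  shows "cexp (int N * i) (grid_point N j) = 1"
proof -
  have "cexp (int N * i) (grid_point N j) = exp (of_int (i * int j) * (of_real (2 * pi) * \<i>))"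
    using assms by (simp add: cexp_def grid_point_def mult_ac)
  also have "\<dots> = 1" using exp_integer_2pi[of "of_int (i * int j)"] by (simp add: mult_ac)
  finally show ?thesis .
qed

lemma dcoef_periodic:
  assumes "N > 0"
  shows "dcoef N w (k + int N * i) = dcoef N w k"
proof -
  have "cexp (- (k + int N * i)) (grid_point N j) = cexp (- k) (grid_point N j)" for j
    using cexp_add[of "-k" "int N * (- i)"] cexp_multiple_grid[OF assms, of "-i"] by simp
  thus ?thesis by (simp add: dcoef_def)
qed

lemma dft_mult_vec:
  assumes "w \<in> carrier_vec N" "r < N"
  shows "(dft N *\<^sub>v w) $ r = dcoef N w (wave_number N r)"
  using assms carrier_matD[OF dft_carrier[of N]]
  by (simp add: scalar_prod_def atLeast0LessThan dcoef_def dft_def cexp_def sum_divide_distrib)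

lemma trig_poly_dcoef:
  assumes "even N" "w \<in> carrier_vec N"
  shows "trig_poly N w x = (\<Sum>k\<in>grid_waves N. dcoef N w k * cexp k x)"
proof -
  have "trig_poly N w x = (\<Sum>r<N. dcoef N w (wave_number N r) * cexp (wave_number N r) x)"
    unfolding trig_poly_def by (intro sum.cong) (simp_all add: dft_mult_vec[OF assms(2)] cexp_def)
  also have "\<dots> = (\<Sum>k\<in>grid_waves N. dcoef N w k * cexp k x)"
    using bij_betw_wave_number[OF assms(1)] unfolding grid_waves_def
    by (rule sum.reindex_bij_betw)
  finally show ?thesis .
qed

lemma trig_poly_grid_point:
  assumes "N > 0" "w \<in> carrier_vec N" "j < N"
  shows "trig_poly N w (grid_point N j) = w $ j"
proof -
  note I = dft_inverse[OF assms(1)]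
  have Ic: "dft_inv N \<in> carrier_mat N N" by (simp add: I(1))
  have "w = (dft_inv N * dft N) *\<^sub>v w" using I(1,3) assms(2) by simp
  also have "\<dots> = dft_inv N *\<^sub>v (dft N *\<^sub>v w)" by (rule assoc_mult_mat_vec[OF Ic dft_carrier assms(2)])
  finally have "w $ j = (dft_inv N *\<^sub>v (dft N *\<^sub>v w)) $ j" by simp
  also have "\<dots> = trig_poly N w (grid_point N j)"
    using assms(3) carrier_matD[OF dft_carrier[of N]]
    by (simp add: I(1) trig_poly_def scalar_prod_def atLeast0LessThan)
  finally show ?thesis by simp
qed

lemma mat_diag_mult_vec:
  assumes "(z :: 'a :: semiring_1 vec) \<in> carrier_vec N" "r < N"
  shows "(mat_diag N d *\<^sub>v z) $ r = d r * z $ r"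
  using assms by (simp add: mat_diag_def scalar_prod_def if_distrib if_distribR cong: if_cong)

lemma dft_deriv_mat:
  assumes "N > 0" "w \<in> carrier_vec N" "r < N"
  shows "(dft N *\<^sub>v (deriv_mat N *\<^sub>v w)) $ r = \<i> * of_int (wave_number N r) * (dft N *\<^sub>v w) $ r"
proof -
  let ?D = "mat_diag N (\<lambda>r. \<i> * of_int (wave_number N r)) :: complex mat"
  note I = dft_inverse[OF assms(1)]
  have Ic: "dft_inv N \<in> carrier_mat N N" by (simp add: I(1))
  have Dc: "?D \<in> carrier_mat N N" by (rule mat_diag_dim)
  have z: "dft N *\<^sub>v w \<in> carrier_vec N" by (rule mult_mat_vec_carrier[OF dft_carrier assms(2)])
  have z2: "?D *\<^sub>v (dft N *\<^sub>v w) \<in> carrier_vec N" by (rule mult_mat_vec_carrier[OF Dc z])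
  have "deriv_mat N *\<^sub>v w = dft_inv N *\<^sub>v (?D *\<^sub>v (dft N *\<^sub>v w))"
    unfolding deriv_mat_def
    by (simp only: assoc_mult_mat_vec[OF mult_carrier_mat[OF Ic Dc] dft_carrier assms(2)]
        assoc_mult_mat_vec[OF Ic Dc z])
  hence "dft N *\<^sub>v (deriv_mat N *\<^sub>v w) = (dft N * dft_inv N) *\<^sub>v (?D *\<^sub>v (dft N *\<^sub>v w))"
    by (simp only: assoc_mult_mat_vec[OF dft_carrier Ic z2])
  also have "\<dots> = ?D *\<^sub>v (dft N *\<^sub>v w)" using I(1,2) z2 by simp
  finally show ?thesis using mat_diag_mult_vec[OF z assms(3)] by simp
qed

text \<open>Multiplying grid values by \<open>cexp j\<close> shifts the discrete transform by
  \<open>j\<close>. The identity is exact, aliasing included, because \<open>dcoef\<close> is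
  evaluated at the shifted index even when that leaves the grid.\<close>

lemma dft_potential:
  assumes "w \<in> carrier_vec N" "r < N"
    and q: "\<And>x. complex_of_real (q x) = (\<Sum>j\<in>{-W..W}. c j * cexp j x)"
  shows "(dft N *\<^sub>v (mat_diag N (\<lambda>j. of_real (q (grid_point N j))) *\<^sub>v w)) $ r =
    (\<Sum>j\<in>{-W..W}. c j * dcoef N w (wave_number N r - j))"
proof -
  let ?Q = "mat_diag N (\<lambda>j. of_real (q (grid_point N j))) :: complex mat"
  let ?k = "wave_number N r"
  have Qw: "?Q *\<^sub>v w \<in> carrier_vec N" by (rule mult_mat_vec_carrier[OF mat_diag_dim assms(1)])
  have "(dft N *\<^sub>v (?Q *\<^sub>v w)) $ r = (\<Sum>l<N. cexp (- ?k) (grid_point N l) * (?Q *\<^sub>v w) $ l) / of_nat N"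
    using dft_mult_vec[OF Qw assms(2)] by (simp add: dcoef_def)
  also have "(\<Sum>l<N. cexp (- ?k) (grid_point N l) * (?Q *\<^sub>v w) $ l) =
    (\<Sum>l<N. \<Sum>j\<in>{-W..W}. c j * (cexp (- (?k - j)) (grid_point N l) * w $ l))"
  proof (rule sum.cong, rule refl)
    fix l assume "l \<in> {..<N}"
    hence "(?Q *\<^sub>v w) $ l = (\<Sum>j\<in>{-W..W}. c j * cexp j (grid_point N l)) * w $ l"
      using mat_diag_mult_vec[OF assms(1)] by (simp add: q)
    thus "cexp (- ?k) (grid_point N l) * (?Q *\<^sub>v w) $ l =
      (\<Sum>j\<in>{-W..W}. c j * (cexp (- (?k - j)) (grid_point N l) * w $ l))"
      using cexp_add[of "- ?k"] by (simp add: sum_distrib_left sum_distrib_right mult_ac)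
  qed
  also have "\<dots> = (\<Sum>j\<in>{-W..W}. \<Sum>l<N. c j * (cexp (- (?k - j)) (grid_point N l) * w $ l))"
    by (rule sum.swap)
  finally show ?thesis by (simp add: dcoef_def sum_distrib_left sum_divide_distrib)
qed

text \<open>The node \<open>node2\<close> is the symbol p k^2 of the second-derivative part plus the
  mean of \<open>q\<close>, so subtracting it leaves only the mean-free potential.\<close>

lemma dft_L_mat:
  assumes "N > 0" "w \<in> carrier_vec N" "r < N" "W \<ge> 0"
    and q: "\<And>x. complex_of_real (q x) = (\<Sum>j\<in>{-W..W}. c j * cexp j x)"
    and c0: "c 0 = of_real (average q)"
  shows "(dft N *\<^sub>v ((L_mat p q N - of_real (node2 p q N r) \<cdot>\<^sub>m 1\<^sub>m N) *\<^sub>v w)) $ r =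
    (\<Sum>j\<in>{-W..W}. deviation_coeff c j * dcoef N w (wave_number N r - j))"
proof -
  let ?k = "wave_number N r" and ?l = "complex_of_real (node2 p q N r)" and ?F = "dft N" and ?D = "deriv_mat N"
  let ?Q = "mat_diag N (\<lambda>j. of_real (q (grid_point N j))) :: complex mat"
  have Ic: "dft_inv N \<in> carrier_mat N N" by (simp add: dft_inverse(1)[OF assms(1)])
  have Dc: "?D \<in> carrier_mat N N" unfolding deriv_mat_def
    by (intro mult_carrier_mat[OF mult_carrier_mat[OF Ic mat_diag_dim] dft_carrier])
  have DDc: "?D * ?D \<in> carrier_mat N N" by (rule mult_carrier_mat[OF Dc Dc])
  have Qc: "?Q \<in> carrier_mat N N" by (rule mat_diag_dim)
  have Dw: "?D *\<^sub>v w \<in> carrier_vec N" by (rule mult_mat_vec_carrier[OF Dc assms(2)])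
  have DDw: "?D *\<^sub>v (?D *\<^sub>v w) \<in> carrier_vec N" by (rule mult_mat_vec_carrier[OF Dc Dw])
  have Qw: "?Q *\<^sub>v w \<in> carrier_vec N" by (rule mult_mat_vec_carrier[OF Qc assms(2)])
  have sm: "(a \<cdot>\<^sub>m M) *\<^sub>v w = a \<cdot>\<^sub>v (M *\<^sub>v w)" if "M \<in> carrier_mat N N" for a :: complex and M
    using that assms(2) by (intro eq_vecI) (auto simp: scalar_prod_def sum_distrib_left mult.assoc)
  have "(L_mat p q N - ?l \<cdot>\<^sub>m 1\<^sub>m N) *\<^sub>v w = L_mat p q N *\<^sub>v w - ?l \<cdot>\<^sub>v w"
    using assms(2) by (subst minus_mult_distrib_mat_vec[of _ N N]) (simp_all add: sm)
  also have "L_mat p q N *\<^sub>v w = (- of_real p) \<cdot>\<^sub>v (?D *\<^sub>v (?D *\<^sub>v w)) + ?Q *\<^sub>v w"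
    unfolding L_mat_def using assms(2) DDc Qc
    by (subst add_mult_distrib_mat_vec[of _ N N]) (simp_all add: sm assoc_mult_mat_vec[OF Dc Dc assms(2)])
  finally have "?F *\<^sub>v ((L_mat p q N - ?l \<cdot>\<^sub>m 1\<^sub>m N) *\<^sub>v w) =
    (- of_real p) \<cdot>\<^sub>v (?F *\<^sub>v (?D *\<^sub>v (?D *\<^sub>v w))) + ?F *\<^sub>v (?Q *\<^sub>v w) - ?l \<cdot>\<^sub>v (?F *\<^sub>v w)"
    using DDw Qw assms(2)
    by (simp add: mult_minus_distrib_mat_vec[OF dft_carrier] mult_add_distrib_mat_vec[OF dft_carrier]
        mult_mat_vec[OF dft_carrier])
  hence "(?F *\<^sub>v ((L_mat p q N - ?l \<cdot>\<^sub>m 1\<^sub>m N) *\<^sub>v w)) $ r =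
    - of_real p * (?F *\<^sub>v (?D *\<^sub>v (?D *\<^sub>v w))) $ r + (?F *\<^sub>v (?Q *\<^sub>v w)) $ r - ?l * (?F *\<^sub>v w) $ r"
    using assms(3) carrier_matD[OF dft_carrier[of N]] by (simp del: index_mult_mat_vec)
  also have "\<dots> = (\<Sum>j\<in>{-W..W}. c j * dcoef N w (?k - j)) - of_real (average q) * dcoef N w ?k"
    unfolding dft_deriv_mat[OF assms(1) Dw assms(3)] dft_deriv_mat[OF assms(1,2,3)]
      dft_potential[OF assms(2,3) q] dft_mult_vec[OF assms(2,3)] node2_def
    by (simp add: algebra_simps power2_eq_square)
  also have "(\<Sum>j\<in>{-W..W}. c j * dcoef N w (?k - j)) =
    c 0 * dcoef N w ?k + (\<Sum>j\<in>{-W..W}. deviation_coeff c j * dcoef N w (?k - j))"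
    by (rule sum_deviation_coeff[OF assms(4)])
  finally show ?thesis by (simp add: c0)
qed

lemma dcoef_add:
  assumes "v \<in> carrier_vec N" "w \<in> carrier_vec N"
  shows "dcoef N (v + w) k = dcoef N v k + dcoef N w k"
  using assms by (simp add: dcoef_def ring_distribs sum.distrib add_divide_distrib)

lemma dcoef_kss_block:
  assumes "even N" "N > 0" "w \<in> carrier_vec N" "k \<in> grid_waves N" "W \<ge> 0" "p > 0" "average q > 0"
    and q: "\<And>x. complex_of_real (q x) = (\<Sum>j\<in>{-W..W}. c j * cexp j x)"
    and c0: "c 0 = of_real (average q)"
  shows "dcoef N (kss_block p q N \<phi> *\<^sub>v w) k =
    of_real (\<phi> ((freq p (average q) k)\<^sup>2)) * dcoef N w k +
    of_real ((\<phi> ((freq p (average q) k)\<^sup>2) - \<phi> 0) / (freq p (average q) k)\<^sup>2) *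
      (\<Sum>j\<in>{-W..W}. deviation_coeff c j * dcoef N w (k - j))"
proof -
  from grid_wavesE[OF assms(1,4)] obtain r where r: "r < N" "k = wave_number N r" .
  have Ic: "dft_inv N \<in> carrier_mat N N" by (simp add: dft_inverse(1)[OF assms(2)])
  have "kss_block p q N \<phi> \<in> carrier_mat N N"
    unfolding kss_block_def by (rule mult_carrier_mat[OF Ic]) simp
  from mult_mat_vec_carrier[OF this assms(3)] have S: "kss_block p q N \<phi> *\<^sub>v w \<in> carrier_vec N" .
  have l: "node2 p q N r = (freq p (average q) k)\<^sup>2"
    using freq_props(2)[OF assms(6,7)] r(2) by (simp add: node2_def)
  show ?thesis
    using dft_kss_block[OF assms(2,3) r(1), of p q \<phi>]
    unfolding dft_L_mat[OF assms(2,3) r(1) assms(5) q c0]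
    unfolding dft_mult_vec[OF S r(1)] dft_mult_vec[OF assms(3) r(1)] node_slope_def l node1_def
    by (simp add: r(2))
qed

section \<open>From the block matrix to a recursion for the Fourier modes\<close>

lemma dim_restrict_grid: "restrict_grid N h \<in> carrier_vec (N + N)"
  by (cases h) (simp add: restrict_grid_def)

text \<open>Restriction undoes interpolation, so the iterated \<open>kss_step\<close> amounts to
  powers of one matrix between a single restriction and a single interpolation.\<close>

lemma restrict_extend_grid:
  assumes "N > 0" "w \<in> carrier_vec (N + N)"
  shows "restrict_grid N (extend_grid N w) = w"
proof -
  have "Matrix.vec N (\<lambda>j. trig_poly N v (grid_point N j)) = v" if "v \<in> carrier_vec N" for v
    using that trig_poly_grid_point[OF assms(1) that] by (intro eq_vecI) auto
  thus ?thesis using assms(2) by (simp add: restrict_grid_def extend_grid_def)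
qed

text \<open>With first node 0 the slopes of the four blocks are (cos (s dt) - 1) / s^2, occurring
  twice, (sin (s dt) / s - dt) / s^2 and - sin (s dt) / s, where the subtracted \<open>dt\<close> is
  the value of \<open>kss_f12\<close> at 0. These are the Duhamel coefficients of
  \<open>frozen_oscillator_error\<close>, and the recursion has the shape which that lemma takes as
  input.\<close>

lemma kss_approx_coeffs:
  fixes f g :: "real \<Rightarrow> complex"
  assumes "even N" "N > 0" "W \<ge> 0" "p > 0" "average q > 0"
    and q: "\<And>x. complex_of_real (q x) = (\<Sum>j\<in>{-W..W}. c j * cexp j x)"
    and c0: "c 0 = of_real (average q)"
  obtains \<alpha> \<beta> :: "nat \<Rightarrow> int \<Rightarrow> complex" where
    "\<And>n. kss_approx p q N dt (f, g) n =
      (\<lambda>x. \<Sum>k\<in>grid_waves N. \<alpha> n k * cexp k x, \<lambda>x. \<Sum>k\<in>grid_waves N. \<beta> n k * cexp k x)"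
    "\<And>n k i. \<alpha> n (k + int N * i) = \<alpha> n k" "\<And>n k i. \<beta> n (k + int N * i) = \<beta> n k"
    "\<And>k. \<alpha> 0 k = (\<Sum>j<N. cexp (- k) (grid_point N j) * f (grid_point N j)) / of_nat N"
    "\<And>k. \<beta> 0 k = (\<Sum>j<N. cexp (- k) (grid_point N j) * g (grid_point N j)) / of_nat N"
    "\<And>n k s. k \<in> grid_waves N \<Longrightarrow> s = freq p (average q) k \<Longrightarrow> \<alpha> (Suc n) k =
       of_real (cos (s * dt)) * \<alpha> n k + of_real (sin (s * dt) / s) * \<beta> n k
       + of_real ((cos (s * dt) - 1) / s\<^sup>2) * (\<Sum>j\<in>{-W..W}. deviation_coeff c j * \<alpha> n (k - j))
       + of_real ((sin (s * dt) / s - dt) / s\<^sup>2) * (\<Sum>j\<in>{-W..W}. deviation_coeff c j * \<beta> n (k - j))"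
    "\<And>n k s. k \<in> grid_waves N \<Longrightarrow> s = freq p (average q) k \<Longrightarrow> \<beta> (Suc n) k =
       of_real (- s * sin (s * dt)) * \<alpha> n k + of_real (cos (s * dt)) * \<beta> n k
       - of_real (sin (s * dt) / s) * (\<Sum>j\<in>{-W..W}. deviation_coeff c j * \<alpha> n (k - j))
       + of_real ((cos (s * dt) - 1) / s\<^sup>2) * (\<Sum>j\<in>{-W..W}. deviation_coeff c j * \<beta> n (k - j))"
proof -
  define M where "M = kss_matrix p q N dt"
  have Ic: "dft_inv N \<in> carrier_mat N N" by (simp add: dft_inverse(1)[OF assms(2)])
  have S: "kss_block p q N \<phi> \<in> carrier_mat N N" for \<phi>
    unfolding kss_block_def by (rule mult_carrier_mat[OF Ic]) simp
  have Sw: "kss_block p q N \<phi> *\<^sub>v w \<in> carrier_vec N" if "w \<in> carrier_vec N" for \<phi> w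
    by (rule mult_mat_vec_carrier[OF S that])
  have Mc: "M \<in> carrier_mat (N + N) (N + N)" unfolding M_def kss_matrix_def
    by (rule four_block_carrier_mat[OF S S])
  define st where "st n = ((\<lambda>w. M *\<^sub>v w) ^^ n) (restrict_grid N (f, g))" for n
  have st: "st n \<in> carrier_vec (N + N)" for n
    unfolding st_def by (induction n) (simp_all add: dim_restrict_grid mult_mat_vec_carrier[OF Mc])
  have approx: "kss_approx p q N dt (f, g) n = extend_grid N (st n)" for n
  proof (induction n)
    case 0
    thus ?case by (simp add: kss_approx_def interpolate_def st_def)
  next
    case (Suc n)
    have "kss_approx p q N dt (f, g) (Suc n) = kss_step p q N dt (extend_grid N (st n))"
      using Suc by (simp add: kss_approx_def)
    also have "\<dots> = extend_grid N (M *\<^sub>v st n)"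
      by (simp add: kss_step_def M_def restrict_extend_grid[OF assms(2) st])
    finally show ?case by (simp add: st_def)
  qed
  define a where "a n = vec_first (st n) N" for n
  define b where "b n = vec_last (st n) N" for n
  have ab: "st n = a n @\<^sub>v b n" "a n \<in> carrier_vec N" "b n \<in> carrier_vec N" for n
    using st[of n] by (simp_all add: a_def b_def)
  have step: "a (Suc n) = kss_block p q N (kss_f11 dt) *\<^sub>v a n + kss_block p q N (kss_f12 dt) *\<^sub>v b n"
    "b (Suc n) = kss_block p q N (kss_f21 dt) *\<^sub>v a n + kss_block p q N (kss_f22 dt) *\<^sub>v b n" for n
  proof -
    have "a (Suc n) @\<^sub>v b (Suc n) = M *\<^sub>v (a n @\<^sub>v b n)"
      using ab(1)[of "Suc n"] ab(1)[of n] by (simp add: st_def)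
    also have "\<dots> = (kss_block p q N (kss_f11 dt) *\<^sub>v a n + kss_block p q N (kss_f12 dt) *\<^sub>v b n) @\<^sub>v
      (kss_block p q N (kss_f21 dt) *\<^sub>v a n + kss_block p q N (kss_f22 dt) *\<^sub>v b n)"
      unfolding M_def kss_matrix_def by (rule four_block_mat_mult_vec[OF S S S S ab(2,3)])
    finally show "a (Suc n) = kss_block p q N (kss_f11 dt) *\<^sub>v a n + kss_block p q N (kss_f12 dt) *\<^sub>v b n"
      "b (Suc n) = kss_block p q N (kss_f21 dt) *\<^sub>v a n + kss_block p q N (kss_f22 dt) *\<^sub>v b n"
      using append_vec_eq[OF ab(2)[of "Suc n"]] Sw ab by (metis add_carrier_vec)+
  qed
  have "a 0 @\<^sub>v b 0 = restrict_grid N (f, g)" using ab(1)[of 0] by (simp add: st_def)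
  hence init: "a 0 = Matrix.vec N (\<lambda>j. f (grid_point N j))" "b 0 = Matrix.vec N (\<lambda>j. g (grid_point N j))"
    using append_vec_eq[OF ab(2)[of 0]] by (auto simp: restrict_grid_def)
  note block = dcoef_kss_block[OF assms(1,2) _ _ assms(3-5) q c0]
  note fr = freq_props(1)[OF assms(4,5)]
  show thesis
  proof (rule that[of "\<lambda>n. dcoef N (a n)" "\<lambda>n. dcoef N (b n)"])
    show "kss_approx p q N dt (f, g) n =
      (\<lambda>x. \<Sum>k\<in>grid_waves N. dcoef N (a n) k * cexp k x, \<lambda>x. \<Sum>k\<in>grid_waves N. dcoef N (b n) k * cexp k x)" for n
      unfolding approx extend_grid_def a_def[symmetric] b_def[symmetric]
      using ab(2,3)[of n] by (simp add: fun_eq_iff trig_poly_dcoef[OF assms(1)])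
  next
    fix n k s assume k: "k \<in> grid_waves N" and s: "s = freq p (average q) k"
    have s0: "s > 0" using fr s by simp
    note [simp] = block[OF ab(2) k, folded s] block[OF ab(3) k, folded s]
    show "dcoef N (a (Suc n)) k =
       of_real (cos (s * dt)) * dcoef N (a n) k + of_real (sin (s * dt) / s) * dcoef N (b n) k
       + of_real ((cos (s * dt) - 1) / s\<^sup>2) * (\<Sum>j\<in>{-W..W}. deviation_coeff c j * dcoef N (a n) (k - j))
       + of_real ((sin (s * dt) / s - dt) / s\<^sup>2) * (\<Sum>j\<in>{-W..W}. deviation_coeff c j * dcoef N (b n) (k - j))"
      using s0 Sw ab by (simp add: step dcoef_add kss_f11_def kss_f12_def)
    have "kss_f12 dt (s\<^sup>2) = sin (s * dt) / s" using s0 by (simp add: kss_f12_def)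
    thus "dcoef N (b (Suc n)) k =
       of_real (- s * sin (s * dt)) * dcoef N (a n) k + of_real (cos (s * dt)) * dcoef N (b n) k
       - of_real (sin (s * dt) / s) * (\<Sum>j\<in>{-W..W}. deviation_coeff c j * dcoef N (a n) (k - j))
       + of_real ((cos (s * dt) - 1) / s\<^sup>2) * (\<Sum>j\<in>{-W..W}. deviation_coeff c j * dcoef N (b n) (k - j))"
      using s0 Sw ab by (simp add: step dcoef_add kss_f21_def kss_f22_def power2_eq_square)
  qed (simp_all add: dcoef_periodic[OF assms(2)] init, simp_all add: dcoef_def)
qed

section \<open>Aliasing and interpolation\<close>

text \<open>The alias of \<open>k\<close> on the grid. The shift by \<open>N div 2 - 1\<close> moves
  the remainders 0, ..., N - 1 to the asymmetric window, which contains N / 2 but not - N /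
  2.\<close>

definition wrap :: "nat \<Rightarrow> int \<Rightarrow> int" where
  "wrap N k = (k + int (N div 2) - 1) mod int N - int (N div 2) + 1"

lemma wrap_in_grid_waves:
  assumes "even N" "N > 0"
  shows "wrap N k \<in> grid_waves N"
proof -
  have "0 \<le> (k + int (N div 2) - 1) mod int N" "(k + int (N div 2) - 1) mod int N < int N"
    using assms(2) by simp_all
  moreover have "int N = 2 * int (N div 2)" using assms(1) by auto
  ultimately show ?thesis unfolding wrap_def grid_waves_def by simp
qed

lemma wrap_eq:
  obtains i where "wrap N k = k + int N * i"
proof
  show "wrap N k = k + int N * (- ((k + int (N div 2) - 1) div int N))"
    unfolding wrap_def minus_mult_div_eq_mod[symmetric] by (simp add: algebra_simps)
qed

lemma wrap_add [simp]: "wrap N (k + int N * i) = wrap N k"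
proof -
  have "k + int N * i + int (N div 2) - 1 = k + int (N div 2) - 1 + int N * i" by simp
  thus ?thesis unfolding wrap_def by (simp only: mod_mult_self2)
qed

lemma wrap_id:
  assumes "even N" "k \<in> grid_waves N"
  shows "wrap N k = k"
proof -
  have "(k + int (N div 2) - 1) mod int N = k + int (N div 2) - 1"
    using assms by (intro mod_pos_pos_trivial) (auto simp: grid_waves_def elim!: evenE)
  thus ?thesis by (simp add: wrap_def)
qed

lemma wrap_distance:
  assumes "wrap N k \<noteq> k"
  shows "int N \<le> \<bar>wrap N k\<bar> + \<bar>k\<bar>"
proof -
  obtain i where i: "wrap N k = k + int N * i" by (rule wrap_eq)
  with assms have "\<bar>i\<bar> \<ge> 1" by auto
  hence "int N * 1 \<le> int N * \<bar>i\<bar>" by (intro mult_left_mono) auto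
  also have "\<dots> = \<bar>wrap N k - k\<bar>" using i by (simp add: abs_mult)
  finally show ?thesis by linarith
qed

lemma periodic_wrap:
  assumes "\<And>k i. h (k + int N * i) = h k"
  shows "h (wrap N k) = h k"
  using wrap_eq[of N k] assms by metis

text \<open>A shift permutes the residue classes modulo \<open>N\<close>, of which the grid waves
  are representatives. Hence the discrete convolution with the potential is bounded in l^1 by the
  l^1 norm of its coefficients, without boundary terms.\<close>

lemma sum_grid_waves_shift:
  fixes h :: "int \<Rightarrow> 'a :: comm_monoid_add"
  assumes "even N" "N > 0" and per: "\<And>k i. h (k + int N * i) = h k"
  shows "(\<Sum>k\<in>grid_waves N. h (k - j)) = (\<Sum>k\<in>grid_waves N. h k)"
proof -
  have inv: "wrap N (wrap N (k + j) - j) = k" "wrap N (wrap N (k - j) + j) = k" if "k \<in> grid_waves N" for k j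
  proof -
    obtain i where "wrap N (k + j) = k + j + int N * i" by (rule wrap_eq)
    thus "wrap N (wrap N (k + j) - j) = k" using wrap_add[of N k i] wrap_id[OF assms(1) that] by (simp add: algebra_simps)
    obtain i where "wrap N (k - j) = k - j + int N * i" by (rule wrap_eq)
    thus "wrap N (wrap N (k - j) + j) = k" using wrap_add[of N k i] wrap_id[OF assms(1) that] by (simp add: algebra_simps)
  qed
  have "bij_betw (\<lambda>k. wrap N (k - j)) (grid_waves N) (grid_waves N)"
    by (rule bij_betw_byWitness[where f' = "\<lambda>k. wrap N (k + j)"])
      (use inv wrap_in_grid_waves[OF assms(1,2)] in auto)
  hence "(\<Sum>k\<in>grid_waves N. h (wrap N (k - j))) = (\<Sum>k\<in>grid_waves N. h k)"
    by (rule sum.reindex_bij_betw)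
  thus ?thesis by (simp add: periodic_wrap[OF per])
qed

lemma not_in_grid_waves: "even N \<Longrightarrow> k \<notin> grid_waves N \<Longrightarrow> int N \<le> 2 * \<bar>k\<bar>"
  by (auto simp: grid_waves_def elim!: evenE)

lemma bracket_wrap_le:
  assumes "even N" "N > 0"
  shows "bracket (wrap N k) \<le> bracket k"
proof (cases "k \<in> grid_waves N")
  case True
  thus ?thesis using wrap_id[OF assms(1)] by simp
next
  case False
  have "2 * \<bar>wrap N k\<bar> \<le> int N"
    using wrap_in_grid_waves[OF assms, of k] assms(1) by (auto simp: grid_waves_def elim!: evenE)
  with not_in_grid_waves[OF assms(1) False] have "\<bar>wrap N k\<bar> \<le> \<bar>k\<bar>" by linarith
  thus ?thesis unfolding bracket_def by linarith
qed

lemma discrete_orthogonality: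
  assumes "even N" "N > 0" "k \<in> grid_waves N"
  shows "(\<Sum>j<N. cexp (- k) (grid_point N j) * cexp l (grid_point N j)) / of_nat N = (if wrap N l = k then 1 else 0)"
proof -
  obtain i where i: "wrap N l = l + int N * i" by (rule wrap_eq)
  have l: "cexp l (grid_point N j) = cexp (wrap N l) (grid_point N j)" for j
    unfolding i cexp_add cexp_multiple_grid[OF assms(2)] by simp
  obtain r where r: "r < N" "k = wave_number N r" using grid_wavesE[OF assms(1,3)] .
  obtain s where s: "s < N" "wrap N l = wave_number N s" using grid_wavesE[OF assms(1) wrap_in_grid_waves[OF assms(1,2)]] .
  have rs: "wave_number N s = wave_number N r \<longleftrightarrow> s = r" by (auto simp: wave_number_def)
  define E where "E = Matrix.mat N N (\<lambda>(j, r). exp (\<i> * of_int (wave_number N r) * of_real (grid_point N j)))"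
  have "dft N * E = 1\<^sub>m N" unfolding E_def by (rule dft_inverse(2)[OF assms(2)])
  hence "(dft N * E) $$ (r, s) = (if r = s then 1 else 0)" using r(1) s(1) by simp
  moreover have "(dft N * E) $$ (r, s) = (\<Sum>j<N. cexp (- k) (grid_point N j) * cexp (wrap N l) (grid_point N j)) / of_nat N"
    using r s carrier_matD[OF dft_carrier[of N]]
    by (simp add: scalar_prod_def atLeast0LessThan E_def dft_def cexp_def sum_divide_distrib)
  ultimately show ?thesis using r(2) s(2) rs by (simp add: l)
qed

text \<open>A uniform bound on the finite sums that avoid \<open>I\<close> survives the limit, so
  tails can be estimated through finite sums only.\<close>

lemma has_sum_tail_bound:
  fixes F :: "'a \<Rightarrow> 'b :: real_normed_vector"
  assumes "(F has_sum S) UNIV" "finite I" "\<And>X. finite X \<Longrightarrow> X \<inter> I = {} \<Longrightarrow> norm (sum F X) \<le> B"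
  shows "norm (S - sum F I) \<le> B"
proof -
  have lim: "(sum F \<longlongrightarrow> S) (finite_subsets_at_top UNIV)" using assms(1) by (simp add: has_sum_def)
  have ev: "eventually (\<lambda>X. norm (sum F X - sum F I) \<le> B) (finite_subsets_at_top UNIV)"
    unfolding eventually_finite_subsets_at_top
  proof (intro exI[of _ I] conjI allI impI)
    fix Y assume "finite Y \<and> I \<subseteq> Y \<and> Y \<subseteq> UNIV"
    hence "sum F Y - sum F I = sum F (Y - I)" by (simp add: sum_diff)
    thus "norm (sum F Y - sum F I) \<le> B"
      using assms(3)[of "Y - I"] \<open>finite Y \<and> _\<close> by auto
  qed (use assms(2) in auto)
  show ?thesis
    by (rule tendsto_upperbound[OF tendsto_norm[OF tendsto_diff[OF lim tendsto_const]] ev]) simp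
qed

lemma fourier_tail_bound:
  assumes "even N" "N > 0" "m \<ge> 2"
    and sum: "((\<lambda>k. c k * cexp k x) has_sum S) UNIV"
    and dec: "\<And>k. cmod (c k) \<le> M / bracket k ^ m"
  shows "cmod (S - (\<Sum>k\<in>grid_waves N. c k * cexp k x)) \<le> 2 * M * (2 / real N) ^ (m - 1)"
proof (rule has_sum_tail_bound[OF sum])
  have M: "M \<ge> 0" using order_trans[OF norm_ge_zero dec[of 0]] by (simp add: bracket_def)
  fix X assume X: "finite X" "X \<inter> grid_waves N = {}"
  have "cmod (\<Sum>k\<in>X. c k * cexp k x) \<le> (\<Sum>k\<in>X. M * (1 / bracket k ^ m))"
    by (rule sum_norm_le) (use dec in \<open>simp add: norm_mult\<close>)
  also have "\<dots> = M * (\<Sum>k\<in>X. 1 / bracket k ^ m)" by (rule sum_distrib_left[symmetric])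
  also have "\<dots> \<le> M * (2 * (2 / real N) ^ (m - 1))"
    using X not_in_grid_waves[OF assms(1)] assms M
    by (intro mult_left_mono sum_bracket_power_tail) (auto elim!: evenE)
  finally show "cmod (\<Sum>k\<in>X. c k * cexp k x) \<le> 2 * M * (2 / real N) ^ (m - 1)" by simp
qed simp

text \<open>Aliasing folds the mode \<open>l\<close> onto \<open>wrap N l\<close>, which never exceeds \<open>l\<close> in absolute value; so the
  weighted interpolation error is no larger than a Fourier tail.\<close>

lemma interpolation_coeff_error:
  assumes "even N" "N > 0" "m \<ge> 2"
    and sum: "\<And>x. ((\<lambda>k. c k * cexp k x) has_sum h x) UNIV"
    and dec: "\<And>k. cmod (c k) \<le> M / bracket k ^ (m + e)"
  shows "(\<Sum>k\<in>grid_waves N. bracket k ^ e *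
      cmod ((\<Sum>j<N. cexp (- k) (grid_point N j) * h (grid_point N j)) / of_nat N - c k))
    \<le> 2 * M * (2 / real N) ^ (m - 1)"
proof -
  let ?I = "grid_waves N"
  have M: "M \<ge> 0" using order_trans[OF norm_ge_zero dec[of 0]] by (simp add: bracket_def)
  \<comment> \<open>The discrete coefficients of a partial sum of the series. The estimate is made
    for finite \<open>X\<close> containing the grid, with a bound independent of \<open>X\<close>,
    and passes to the limit at the end.\<close>
  define D where "D X k = (\<Sum>j<N. cexp (- k) (grid_point N j) * (\<Sum>l\<in>X. c l * cexp l (grid_point N j))) / of_nat N" for X k
  have D: "D X k = (\<Sum>l\<in>X. c l * (if wrap N l = k then 1 else 0))" if k: "k \<in> ?I" for X k
  proof -
    have "D X k = (\<Sum>l\<in>X. c l * ((\<Sum>j<N. cexp (- k) (grid_point N j) * cexp l (grid_point N j)) / of_nat N))"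
      unfolding D_def sum_distrib_left sum_divide_distrib
      by (subst sum.swap) (simp add: mult_ac)
    thus ?thesis by (simp only: discrete_orthogonality[OF assms(1,2) k])
  qed
  have bound: "(\<Sum>k\<in>?I. bracket k ^ e * cmod (D X k - c k)) \<le> 2 * M * (2 / real N) ^ (m - 1)"
    if X: "finite X" "?I \<subseteq> X" for X
  proof -
    have "cmod (D X k - c k) \<le> (\<Sum>l\<in>X - ?I. if wrap N l = k then cmod (c l) else 0)" if k: "k \<in> ?I" for k
    proof -
      \<comment> \<open>Modes inside the grid are reproduced exactly, so only modes outside it
        contribute to the error.\<close>
      have "D X k = (\<Sum>l\<in>?I. c l * (if wrap N l = k then 1 else 0)) + (\<Sum>l\<in>X - ?I. c l * (if wrap N l = k then 1 else 0))"
        unfolding D[OF k] using X by (simp add: sum.subset_diff add.commute)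
      also have "(\<Sum>l\<in>?I. c l * (if wrap N l = k then 1 else 0)) = (\<Sum>l\<in>?I. if l = k then c l else 0)"
        by (intro sum.cong) (auto simp: wrap_id[OF assms(1)])
      also have "\<dots> = c k" using k by simp
      finally have "D X k - c k = (\<Sum>l\<in>X - ?I. c l * (if wrap N l = k then 1 else 0))" by simp
      thus ?thesis by (auto intro!: sum_norm_le)
    qed
    hence "(\<Sum>k\<in>?I. bracket k ^ e * cmod (D X k - c k)) \<le>
       (\<Sum>k\<in>?I. bracket k ^ e * (\<Sum>l\<in>X - ?I. if wrap N l = k then cmod (c l) else 0))"
      by (intro sum_mono mult_left_mono) auto
    also have "\<dots> = (\<Sum>l\<in>X - ?I. \<Sum>k\<in>?I. if k = wrap N l then bracket k ^ e * cmod (c l) else 0)"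
      unfolding sum_distrib_left by (subst sum.swap) (auto intro!: sum.cong)
    also have "\<dots> = (\<Sum>l\<in>X - ?I. bracket (wrap N l) ^ e * cmod (c l))"
      using wrap_in_grid_waves[OF assms(1,2)] by simp
    also have "\<dots> \<le> (\<Sum>l\<in>X - ?I. M * (1 / bracket l ^ m))"
    proof (rule sum_mono)
      fix l
      have "bracket (wrap N l) ^ e * cmod (c l) \<le> bracket l ^ e * (M / bracket l ^ (m + e))"
        by (intro mult_mono power_mono bracket_wrap_le assms dec) auto
      also have "\<dots> = M * (1 / bracket l ^ m)" by (simp add: power_add field_simps)
      finally show "bracket (wrap N l) ^ e * cmod (c l) \<le> M * (1 / bracket l ^ m)" .
    qed
    also have "\<dots> = M * (\<Sum>l\<in>X - ?I. 1 / bracket l ^ m)" by (rule sum_distrib_left[symmetric])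
    also have "\<dots> \<le> M * (2 * (2 / real N) ^ (m - 1))"
      using X not_in_grid_waves[OF assms(1)] assms M
      by (intro mult_left_mono sum_bracket_power_tail) (auto elim!: evenE)
    finally show ?thesis by simp
  qed
  have lim: "((\<lambda>X. D X k) \<longlongrightarrow> (\<Sum>j<N. cexp (- k) (grid_point N j) * h (grid_point N j)) / of_nat N)
    (finite_subsets_at_top UNIV)" for k
    unfolding D_def
    by (intro tendsto_divide tendsto_sum tendsto_mult tendsto_const sum[unfolded has_sum_def])
      (use assms(2) in simp)
  show ?thesis
  proof (rule tendsto_upperbound)
    show "((\<lambda>X. \<Sum>k\<in>?I. bracket k ^ e * cmod (D X k - c k)) \<longlongrightarrow> (\<Sum>k\<in>?I. bracket k ^ e *
      cmod ((\<Sum>j<N. cexp (- k) (grid_point N j) * h (grid_point N j)) / of_nat N - c k))) (finite_subsets_at_top UNIV)"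
      by (intro tendsto_sum tendsto_mult tendsto_const tendsto_norm tendsto_diff lim)
    show "eventually (\<lambda>X. (\<Sum>k\<in>?I. bracket k ^ e * cmod (D X k - c k)) \<le> 2 * M * (2 / real N) ^ (m - 1))
      (finite_subsets_at_top UNIV)"
      unfolding eventually_finite_subsets_at_top
      by (intro exI[of _ ?I] conjI allI impI bound) simp_all
  qed simp
qed

section \<open>Taylor remainder and discrete Gronwall inequality\<close>

lemma taylor_remainder_bound:
  fixes y y' y'' :: "real \<Rightarrow> complex"
  assumes "0 \<le> h"
    and y: "\<And>\<tau>. \<tau> \<in> {0..h} \<Longrightarrow> (y has_vector_derivative y' \<tau>) (at \<tau> within {0..h})"
    and y': "\<And>\<tau>. \<tau> \<in> {0..h} \<Longrightarrow> (y' has_vector_derivative y'' \<tau>) (at \<tau> within {0..h})"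
    and bound: "\<And>\<tau>. \<tau> \<in> {0..h} \<Longrightarrow> cmod (y'' \<tau>) \<le> B" and \<tau>: "\<tau> \<in> {0..h}"
  shows "cmod (y \<tau> - y 0 - of_real \<tau> * y' 0) \<le> B * h\<^sup>2"
proof -
  have B: "B \<ge> 0" using order_trans[OF norm_ge_zero bound[OF \<tau>]] .
  \<comment> \<open>The mean value inequality is used for the derivative here and for the
    linearization below, which gives h * h in place of the sharp h^2 / 2.\<close>
  have d: "cmod (y' \<sigma> - y' 0) \<le> B * h" if \<sigma>: "\<sigma> \<in> {0..h}" for \<sigma>
  proof -
    have "cmod (y' \<sigma> - y' 0) \<le> B * norm (\<sigma> - 0)"
    proof (rule differentiable_bound[where S = "{0..h}" and f' = "\<lambda>\<tau> x. x *\<^sub>R y'' \<tau>"])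
      fix x assume x: "x \<in> {0..h}"
      show "(y' has_derivative (\<lambda>t. t *\<^sub>R y'' x)) (at x within {0..h})"
        using y'[OF x] by (simp add: has_vector_derivative_def)
      show "onorm (\<lambda>t. t *\<^sub>R y'' x) \<le> B"
        using bound[OF x] by (simp add: onorm_scaleR_left[OF bounded_linear_ident] onorm_id)
    qed (use \<sigma> assms(1) in auto)
    also have "\<dots> \<le> B * h" using B \<sigma> by (intro mult_left_mono) auto
    finally show ?thesis .
  qed
  have "cmod (y \<tau> - y 0 - (\<tau> - 0) *\<^sub>R y' 0) \<le> norm (\<tau> - 0) * (B * h)"
    by (rule vector_differentiable_bound_linearization[where S = "{0..h}"])
      (use y d \<tau> assms(1) in \<open>auto simp: closed_segment_eq_real_ivl\<close>)
  also have "\<dots> \<le> h * (B * h)" using B \<tau> by (intro mult_right_mono) auto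
  finally show ?thesis by (simp add: scaleR_conv_of_real power2_eq_square mult_ac)
qed

text \<open>Rests on 1 + a <= exp a. The recursion is assumed only below \<open>n\<close>, since the
  error estimate for one step is available only while the time stays within the horizon.\<close>

lemma discrete_gronwall:
  fixes x :: "nat \<Rightarrow> real"
  assumes "a \<ge> 0" "b \<ge> 0" "x 0 \<ge> 0" "\<And>i. i < n \<Longrightarrow> x (Suc i) \<le> (1 + a) * x i + b"
  shows "x n \<le> exp (real n * a) * (x 0 + real n * b)"
  using assms(4)
proof (induction n)
  case 0
  thus ?case by simp
next
  case (Suc n)
  have "x (Suc n) \<le> (1 + a) * x n + b" using Suc.prems by simp
  also have "\<dots> \<le> exp a * (exp (real n * a) * (x 0 + real n * b)) + exp (real (Suc n) * a) * b"
  proof (intro add_mono)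
    have "(1 + a) * x n \<le> (1 + a) * (exp (real n * a) * (x 0 + real n * b))"
      using Suc assms(1) by (intro mult_left_mono Suc.IH) auto
    also have "\<dots> \<le> exp a * (exp (real n * a) * (x 0 + real n * b))"
      using assms by (intro mult_right_mono exp_ge_add_one_self) auto
    finally show "(1 + a) * x n \<le> exp a * (exp (real n * a) * (x 0 + real n * b))" .
    have "1 * b \<le> exp (real (Suc n) * a) * b"
      using assms by (intro mult_right_mono) auto
    thus "b \<le> exp (real (Suc n) * a) * b" by simp
  qed
  also have "\<dots> = exp (real (Suc n) * a) * (x 0 + real (Suc n) * b)"
    by (simp add: algebra_simps exp_add)
  finally show ?case .
qed

section \<open>Propagation of the error\<close>

text \<open>Restarts the clock at the beginning of a time step.\<close>

lemma has_vector_derivative_shift_within: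
  fixes y :: "real \<Rightarrow> 'a :: real_normed_vector"
  assumes "(y has_vector_derivative y') (at (t + \<tau>) within {0..T})" "0 \<le> t" "t + h \<le> T"
  shows "((\<lambda>\<tau>. y (t + \<tau>)) has_vector_derivative y') (at \<tau> within {0..h})"
proof -
  have 1: "((\<lambda>\<tau>. t + \<tau>) has_vector_derivative 1) (at \<tau> within {0..h})"
    by (auto intro!: derivative_eq_intros)
  have 2: "(y has_vector_derivative y') (at (t + \<tau>) within (\<lambda>\<tau>. t + \<tau>) ` {0..h})"
    by (rule has_vector_derivative_within_subset[OF assms(1)]) (use assms in auto)
  from vector_diff_chain_within[OF 1 2] show ?thesis by (simp add: o_def)
qed

text \<open>If \<open>k - j\<close> wraps, it has left the grid by at most \<open>W\<close>, and its
  alias lies equally close to the opposite end. Both indices \<open>l\<close> then satisfy N <= 2 (1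
  + W) (1 + |l|), so the decay of \<open>x\<close> makes both terms O(N^(-m)).\<close>

lemma wrap_error:
  assumes "even N" "N > 0" "W \<ge> 0" "k \<in> grid_waves N" "\<bar>j\<bar> \<le> W"
    and dec: "\<And>k. cmod (x k) \<le> M / bracket k ^ m"
  shows "cmod (x (k - j) - x (wrap N (k - j))) \<le> 2 * M * (2 * (1 + of_int W)) ^ m / real N ^ m"
proof (cases "wrap N (k - j) = k - j")
  case True
  moreover have "M \<ge> 0" using order_trans[OF norm_ge_zero dec[of 0]] by (simp add: bracket_def)
  ultimately show ?thesis using assms(3) by simp
next
  case False
  have M: "M \<ge> 0" using order_trans[OF norm_ge_zero dec[of 0]] by (simp add: bracket_def)
  have N: "real N > 0" using assms(2) by simp
  have d: "int N \<le> \<bar>wrap N (k - j)\<bar> + \<bar>k - j\<bar>" by (rule wrap_distance[OF False])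
  have k: "2 * \<bar>k\<bar> \<le> int N" "2 * \<bar>wrap N (k - j)\<bar> \<le> int N"
    using wrap_in_grid_waves[OF assms(1,2), of "k - j"] assms(1,4) by (auto simp: grid_waves_def elim!: evenE)
  have "cmod (x l) \<le> M * (2 * (1 + of_int W)) ^ m / real N ^ m" if l: "int N \<le> 2 * \<bar>l\<bar> + 2 * W" for l
  proof -
    have "of_int W * 1 \<le> of_int W * bracket l" using assms(3) by (intro mult_left_mono bracket_ge_1) auto
    moreover have "real N \<le> 2 * \<bar>of_int l\<bar> + 2 * of_int W" using l by linarith
    ultimately have "real N \<le> 2 * (1 + of_int W) * bracket l" by (simp add: bracket_def algebra_simps)
    hence "real N ^ m \<le> (2 * (1 + of_int W)) ^ m * bracket l ^ m"
      unfolding power_mult_distrib[symmetric] by (intro power_mono) auto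
    hence "M * real N ^ m \<le> M * ((2 * (1 + of_int W)) ^ m * bracket l ^ m)"
      using M by (intro mult_left_mono) auto
    hence "M / bracket l ^ m \<le> M * (2 * (1 + of_int W)) ^ m / real N ^ m"
      using N by (simp add: divide_le_eq le_divide_eq mult_ac)
    with dec[of l] show ?thesis by linarith
  qed
  moreover have "n \<le> 2 * b + 2 * w" if "n \<le> a + b" "2 * a \<le> n" "0 \<le> w" for a b n w :: int
    using that by linarith
  from this[OF d k(2) assms(3)] have "int N \<le> 2 * \<bar>k - j\<bar> + 2 * W" .
  moreover have "n \<le> 2 * a + 2 * w" if "n \<le> a + b" "2 * i \<le> n" "b \<le> i + l" "l \<le> w" for a b i l n w :: int
    using that by linarith
  from this[OF d k(1) abs_triangle_ineq4 assms(5)] have "int N \<le> 2 * \<bar>wrap N (k - j)\<bar> + 2 * W" .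
  ultimately have "cmod (x (k - j)) \<le> M * (2 * (1 + of_int W)) ^ m / real N ^ m"
    "cmod (x (wrap N (k - j))) \<le> M * (2 * (1 + of_int W)) ^ m / real N ^ m" by blast+
  thus ?thesis using norm_triangle_ineq4[of "x (k - j)" "x (wrap N (k - j))"] by simp
qed

text \<open>An l^1 energy built from both characteristic quantities. Since the free flow preserves
  each modulus, the estimate for one step starts with the factor 1; with |v| + s |e| in its place,
  the constants of \<open>mode_error_bounds\<close> would be paid in every step and not only at the
  beginning and the end.\<close>

definition mode_error :: "nat \<Rightarrow> (int \<Rightarrow> real) \<Rightarrow> (int \<Rightarrow> complex) \<Rightarrow> (int \<Rightarrow> complex) \<Rightarrow> real" where
  "mode_error N s e v = (\<Sum>k\<in>grid_waves N.
     cmod (v k + \<i> * of_real (s k) * e k) + cmod (v k + \<i> * of_real (- s k) * e k))"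

lemma mode_error_bounds:
  assumes "\<And>k. 0 \<le> s k"
  shows "(\<Sum>k\<in>grid_waves N. cmod (v k)) \<le> mode_error N s e v"
    and "(\<Sum>k\<in>grid_waves N. s k * cmod (e k)) \<le> mode_error N s e v"
    and "mode_error N s e v \<le> 2 * (\<Sum>k\<in>grid_waves N. cmod (v k)) + 2 * (\<Sum>k\<in>grid_waves N. s k * cmod (e k))"
proof -
  show "(\<Sum>k\<in>grid_waves N. cmod (v k)) \<le> mode_error N s e v"
    unfolding mode_error_def by (intro sum_mono norm_le_characteristic)
  show "(\<Sum>k\<in>grid_waves N. s k * cmod (e k)) \<le> mode_error N s e v"
    unfolding mode_error_def using norm_le_characteristic(2) assms by (intro sum_mono) (metis abs_of_nonneg)
  have "cmod (v k + \<i> * of_real (s k) * e k) + cmod (v k + \<i> * of_real (- s k) * e k) \<le> 2 * cmod (v k) + 2 * (s k * cmod (e k))" for k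
    using norm_triangle_ineq[of "v k" "\<i> * of_real (s k) * e k"] norm_triangle_ineq[of "v k" "\<i> * of_real (- s k) * e k"]
      assms[of k] by (simp add: norm_mult)
  hence "mode_error N s e v \<le> (\<Sum>k\<in>grid_waves N. 2 * cmod (v k) + 2 * (s k * cmod (e k)))"
    unfolding mode_error_def by (rule sum_mono)
  thus "mode_error N s e v \<le> 2 * (\<Sum>k\<in>grid_waves N. cmod (v k)) + 2 * (\<Sum>k\<in>grid_waves N. s k * cmod (e k))"
    by (simp add: sum.distrib sum_distrib_left)
qed

lemma kss_error_step:
  fixes U V A :: "int \<Rightarrow> real \<Rightarrow> complex" and b \<alpha> \<beta> \<alpha>' \<beta>' :: "int \<Rightarrow> complex" and W :: int and p c T M :: real
  assumes N: "even N" "N > 0" and "p > 0" "c > 0" and W: "W \<ge> 0" and "m \<ge> 1"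
    and U: "\<And>k t. t \<in> {0..T} \<Longrightarrow> (U k has_vector_derivative V k t) (at t within {0..T})"
    and V: "\<And>k t. t \<in> {0..T} \<Longrightarrow> (V k has_vector_derivative A k t) (at t within {0..T})"
    and ode: "\<And>k t. t \<in> {0..T} \<Longrightarrow>
      A k t = - of_real ((freq p c k)\<^sup>2) * U k t - (\<Sum>j\<in>{-W..W}. b j * U (k - j) t)"
    and dec: "\<And>k t. t \<in> {0..T} \<Longrightarrow> cmod (U k t) \<le> M / bracket k ^ m"
      "\<And>k t. t \<in> {0..T} \<Longrightarrow> cmod (V k t) \<le> M / bracket k ^ m"
      "\<And>k t. t \<in> {0..T} \<Longrightarrow> cmod (A k t) \<le> M / bracket k ^ 2"
    and per: "\<And>k i. \<alpha> (k + int N * i) = \<alpha> k" "\<And>k i. \<beta> (k + int N * i) = \<beta> k"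
    and \<alpha>': "\<And>k s. k \<in> grid_waves N \<Longrightarrow> s = freq p c k \<Longrightarrow> \<alpha>' k =
       of_real (cos (s * h)) * \<alpha> k + of_real (sin (s * h) / s) * \<beta> k
       + of_real ((cos (s * h) - 1) / s\<^sup>2) * (\<Sum>j\<in>{-W..W}. b j * \<alpha> (k - j))
       + of_real ((sin (s * h) / s - h) / s\<^sup>2) * (\<Sum>j\<in>{-W..W}. b j * \<beta> (k - j))"
    and \<beta>': "\<And>k s. k \<in> grid_waves N \<Longrightarrow> s = freq p c k \<Longrightarrow> \<beta>' k =
       of_real (- s * sin (s * h)) * \<alpha> k + of_real (cos (s * h)) * \<beta> k
       - of_real (sin (s * h) / s) * (\<Sum>j\<in>{-W..W}. b j * \<alpha> (k - j))
       + of_real ((cos (s * h) - 1) / s\<^sup>2) * (\<Sum>j\<in>{-W..W}. b j * \<beta> (k - j))"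
    and t: "0 \<le> t" "0 \<le> h" "t + h \<le> T"
  defines "C \<equiv> \<Sum>j\<in>{-W..W}. cmod (b j)"
  shows "mode_error N (freq p c) (\<lambda>k. U k (t + h) - \<alpha>' k) (\<lambda>k. V k (t + h) - \<beta>' k) \<le>
    (1 + h * (2 * C * (1 / sqrt c + T))) * mode_error N (freq p c) (\<lambda>k. U k t - \<alpha> k) (\<lambda>k. V k t - \<beta> k)
    + h * (6 * C * M * (1 + of_int W)\<^sup>2 * h\<^sup>2 + 4 * C * (1 + T) * M * (2 * (1 + of_int W)) ^ m * (2 / real N) ^ (m - 1))"
    (is "?lhs \<le> (1 + h * ?K) * ?G + h * (?R2 * h\<^sup>2 + ?R1 * _)")
proof -
  let ?I = "grid_waves N" and ?J = "{-W..W}"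
  \<comment> \<open>The exact modes are extended periodically from the grid, as
    \<open>\<alpha>\<close> and \<open>\<beta>\<close> are, so that
    \<open>sum_grid_waves_shift\<close> applies; on the grid this is the true error.\<close>
  define e where "e k = U (wrap N k) t - \<alpha> k" for k
  define \<epsilon> where "\<epsilon> k = V (wrap N k) t - \<beta> k" for k
  define L where "L = 2 * M * (2 * (1 + of_int W)) ^ m / real N ^ m"
  define \<eta> where "\<eta> k = (\<Sum>j\<in>?J. cmod (b j) * (M * (1 + of_int W)\<^sup>2 * h\<^sup>2 * (1 / bracket k ^ 2) + (1 + T) * L
    + cmod (e (k - j)) + T * cmod (\<epsilon> (k - j))))" for k
  have tT: "t \<in> {0..T}" and T: "T \<ge> 0" "h \<le> T" using t by auto
  have M: "M \<ge> 0" using order_trans[OF norm_ge_zero dec(1)[OF tT, of 0]] by (simp add: bracket_def)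
  have C: "C \<ge> 0" by (simp add: C_def sum_nonneg)
  have L: "L \<ge> 0" using M W by (simp add: L_def)
  note fr = freq_props[OF assms(3,4)]
  have eI: "e k = U k t - \<alpha> k" "\<epsilon> k = V k t - \<beta> k" if "k \<in> ?I" for k
    using wrap_id[OF N(1) that] by (simp_all add: e_def \<epsilon>_def)
  have mode: "cmod ((V k (t + h) - \<beta>' k) + \<i> * of_real s * (U k (t + h) - \<alpha>' k)) \<le>
      cmod ((V k t - \<beta> k) + \<i> * of_real s * (U k t - \<alpha> k)) + \<eta> k * h"
    if k: "k \<in> ?I" and s: "s = freq p c k \<or> s = - freq p c k" for k s
  proof -
    let ?a = "\<Sum>j\<in>?J. b j * \<alpha> (k - j)" and ?b = "\<Sum>j\<in>?J. b j * \<beta> (k - j)"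
    have s2: "s\<^sup>2 = (freq p c k)\<^sup>2" using s by auto
    have res: "cmod (A k (t + \<tau>) + of_real (s\<^sup>2) * U k (t + \<tau>) + ?a + of_real \<tau> * ?b) \<le> \<eta> k"
      if \<tau>: "\<tau> \<in> {0..h}" for \<tau>
    proof -
      have t\<tau>: "t + \<tau> \<in> {0..T}" using \<tau> t by auto
      have "A k (t + \<tau>) + of_real (s\<^sup>2) * U k (t + \<tau>) + ?a + of_real \<tau> * ?b =
        ?a + of_real \<tau> * ?b - (\<Sum>j\<in>?J. b j * U (k - j) (t + \<tau>))"
        unfolding ode[OF t\<tau>] s2 by (simp del: of_real_power)
      also have "\<dots> = (\<Sum>j\<in>?J. b j * (\<alpha> (k - j) + of_real \<tau> * \<beta> (k - j) - U (k - j) (t + \<tau>)))"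
        by (simp add: sum_distrib_left algebra_simps sum.distrib sum_subtractf)
      also have "cmod \<dots> \<le> \<eta> k"
        unfolding \<eta>_def
      proof (rule sum_norm_le)
        fix j assume j: "j \<in> ?J"
        let ?l = "k - j"
        have "cmod (U ?l (t + \<tau>) - U ?l (t + 0) - of_real \<tau> * V ?l (t + 0)) \<le> M / bracket ?l ^ 2 * h\<^sup>2"
          by (rule taylor_remainder_bound[where y'' = "\<lambda>\<tau>. A ?l (t + \<tau>)"])
            (use t \<tau> in \<open>auto intro!: has_vector_derivative_shift_within U V dec(3)\<close>)
        also have "\<dots> \<le> M * (1 + of_int W)\<^sup>2 * h\<^sup>2 * (1 / bracket k ^ 2)"
          using mult_left_mono[OF bracket_power_shift[of j W k 2], of "M * h\<^sup>2"] M j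
          by (simp add: mult_ac abs_le_iff)
        finally have 1: "cmod (U ?l (t + \<tau>) - U ?l t - of_real \<tau> * V ?l t) \<le> M * (1 + of_int W)\<^sup>2 * h\<^sup>2 * (1 / bracket k ^ 2)"
          by simp
        have j': "\<bar>j\<bar> \<le> W" using j by auto
        have 2: "cmod (U ?l t - U (wrap N ?l) t) \<le> L"
          unfolding L_def by (rule wrap_error[OF N W k j' dec(1)[OF tT]])
        have V2: "cmod (V ?l t - V (wrap N ?l) t) \<le> L"
          unfolding L_def by (rule wrap_error[OF N W k j' dec(2)[OF tT]])
        have 3: "cmod (of_real \<tau> * (V ?l t - V (wrap N ?l) t)) \<le> T * L"
          unfolding norm_mult using \<tau> T by (intro mult_mono V2) auto
        have 4: "cmod (of_real \<tau> * \<epsilon> ?l) \<le> T * cmod (\<epsilon> ?l)"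
          unfolding norm_mult using \<tau> T by (intro mult_mono) auto
        \<comment> \<open>Inserting the exact mode at the start of the step, first at
          \<open>k - j\<close> and then at its alias, separates the three sources of error.\<close>
        have "\<alpha> ?l + of_real \<tau> * \<beta> ?l - U ?l (t + \<tau>) =
          - ((U ?l (t + \<tau>) - U ?l t - of_real \<tau> * V ?l t) + (U ?l t - U (wrap N ?l) t)
            + of_real \<tau> * (V ?l t - V (wrap N ?l) t) + e ?l + of_real \<tau> * \<epsilon> ?l)"
          by (simp add: e_def \<epsilon>_def algebra_simps)
        hence "cmod (\<alpha> ?l + of_real \<tau> * \<beta> ?l - U ?l (t + \<tau>)) \<le>
          cmod (U ?l (t + \<tau>) - U ?l t - of_real \<tau> * V ?l t) + cmod (U ?l t - U (wrap N ?l) t)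
            + cmod (of_real \<tau> * (V ?l t - V (wrap N ?l) t)) + cmod (e ?l) + cmod (of_real \<tau> * \<epsilon> ?l)"
          by (simp only: norm_minus_cancel) (intro order_trans[OF norm_triangle_ineq] add_mono order_refl)
        also have "\<dots> \<le> M * (1 + of_int W)\<^sup>2 * h\<^sup>2 * (1 / bracket k ^ 2) + (1 + T) * L + cmod (e ?l) + T * cmod (\<epsilon> ?l)"
          using 1 2 3 4 by (simp add: distrib_right)
        finally show "cmod (b j * (\<alpha> ?l + of_real \<tau> * \<beta> ?l - U ?l (t + \<tau>))) \<le>
          cmod (b j) * (M * (1 + of_int W)\<^sup>2 * h\<^sup>2 * (1 / bracket k ^ 2) + (1 + T) * L + cmod (e ?l) + T * cmod (\<epsilon> ?l))"
          unfolding norm_mult by (intro mult_left_mono) auto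
      qed
      finally show ?thesis .
    qed
    have "cmod ((V k (t + h) - \<beta>' k) + \<i> * of_real s * (U k (t + h) - \<alpha>' k)) \<le>
      cmod ((V k (t + 0) - \<beta> k) + \<i> * of_real s * (U k (t + 0) - \<alpha> k)) + \<eta> k * h"
    proof (rule frozen_oscillator_error[where y'' = "\<lambda>\<tau>. A k (t + \<tau>)" and a = ?a and b = ?b])
      show "s \<noteq> 0" using s fr(1)[of k] by auto
      show "\<alpha>' k = of_real (cos (s * h)) * \<alpha> k + of_real (sin (s * h) / s) * \<beta> k
       + of_real ((cos (s * h) - 1) / s\<^sup>2) * ?a + of_real ((sin (s * h) / s - h) / s\<^sup>2) * ?b"
        using \<alpha>'[OF k refl] s by auto
      show "\<beta>' k = of_real (- s * sin (s * h)) * \<alpha> k + of_real (cos (s * h)) * \<beta> k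
       - of_real (sin (s * h) / s) * ?a + of_real ((cos (s * h) - 1) / s\<^sup>2) * ?b"
        using \<beta>'[OF k refl] s by auto
    qed (use t res in \<open>auto intro!: has_vector_derivative_shift_within U V\<close>)
    thus ?thesis by simp
  qed
  have "?lhs \<le> ?G + 2 * (\<Sum>k\<in>?I. \<eta> k * h)"
  proof -
    have "?lhs \<le> (\<Sum>k\<in>?I. (cmod ((V k t - \<beta> k) + \<i> * of_real (freq p c k) * (U k t - \<alpha> k)) + \<eta> k * h) +
        (cmod ((V k t - \<beta> k) + \<i> * of_real (- freq p c k) * (U k t - \<alpha> k)) + \<eta> k * h))"
      unfolding mode_error_def by (intro sum_mono add_mono mode) auto
    thus ?thesis unfolding mode_error_def sum.distrib by linarith
  qed
  also have "(\<Sum>k\<in>?I. \<eta> k * h) = h * (\<Sum>k\<in>?I. \<eta> k)" by (simp add: sum_distrib_left mult.commute)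
  also have "?G + 2 * (h * (\<Sum>k\<in>?I. \<eta> k)) \<le> ?G + 2 * (h * (C * (3 * (M * (1 + of_int W)\<^sup>2 * h\<^sup>2) + real N * ((1 + T) * L) + (1 / sqrt c + T) * ?G)))"
  proof (intro add_mono order_refl mult_left_mono)
    have se: "(\<Sum>k\<in>?I. cmod (e (k - j))) \<le> 1 / sqrt c * ?G" for j
    proof -
      have "(\<Sum>k\<in>?I. cmod (e (k - j))) = (\<Sum>k\<in>?I. cmod (e k))"
        by (rule sum_grid_waves_shift[OF N]) (simp add: e_def per)
      also have "\<dots> = (\<Sum>k\<in>?I. cmod (U k t - \<alpha> k))" by (simp add: eI)
      also have "\<dots> \<le> (\<Sum>k\<in>?I. 1 / sqrt c * (freq p c k * cmod (U k t - \<alpha> k)))"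
      proof (rule sum_mono)
        fix k
        have "sqrt c * cmod (U k t - \<alpha> k) \<le> freq p c k * cmod (U k t - \<alpha> k)"
          by (intro mult_right_mono fr) simp
        thus "cmod (U k t - \<alpha> k) \<le> 1 / sqrt c * (freq p c k * cmod (U k t - \<alpha> k))"
          using \<open>c > 0\<close> by (simp add: field_simps)
      qed
      also have "\<dots> \<le> 1 / sqrt c * ?G"
        unfolding sum_distrib_left[symmetric] using \<open>c > 0\<close>
        by (intro mult_left_mono mode_error_bounds(2)) (auto intro: less_imp_le fr(1))
      finally show ?thesis .
    qed
    have sv: "(\<Sum>k\<in>?I. cmod (\<epsilon> (k - j))) \<le> ?G" for j
    proof -
      have "(\<Sum>k\<in>?I. cmod (\<epsilon> (k - j))) = (\<Sum>k\<in>?I. cmod (\<epsilon> k))"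
        by (rule sum_grid_waves_shift[OF N]) (simp add: \<epsilon>_def per)
      also have "\<dots> = (\<Sum>k\<in>?I. cmod (V k t - \<beta> k))" by (simp add: eI)
      also have "\<dots> \<le> ?G" by (rule mode_error_bounds(1)) (auto intro: less_imp_le fr(1))
      finally show ?thesis .
    qed
    have card: "card ?I = N" using N by (auto simp: grid_waves_def elim!: evenE)
    have "(\<Sum>k\<in>?I. \<eta> k) = (\<Sum>j\<in>?J. cmod (b j) * ((M * (1 + of_int W)\<^sup>2 * h\<^sup>2) * (\<Sum>k\<in>?I. 1 / bracket k ^ 2) + real N * ((1 + T) * L)
      + (\<Sum>k\<in>?I. cmod (e (k - j))) + T * (\<Sum>k\<in>?I. cmod (\<epsilon> (k - j)))))"
      unfolding \<eta>_def by (subst sum.swap) (simp only: sum_distrib_left[symmetric] sum.distrib card sum_constant of_nat_mult mult.assoc, simp add: mult_ac)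
    also have "\<dots> \<le> (\<Sum>j\<in>?J. cmod (b j) * ((M * (1 + of_int W)\<^sup>2 * h\<^sup>2) * 3 + real N * ((1 + T) * L)
      + 1 / sqrt c * ?G + T * ?G))"
      using M T by (intro sum_mono mult_left_mono add_mono se sv sum_bracket_square order_refl) auto
    also have "\<dots> = C * (3 * (M * (1 + of_int W)\<^sup>2 * h\<^sup>2) + real N * ((1 + T) * L) + (1 / sqrt c + T) * ?G)"
      unfolding C_def sum_distrib_right by (simp add: algebra_simps)
    finally show "(\<Sum>k\<in>?I. \<eta> k) \<le> C * (3 * (M * (1 + of_int W)\<^sup>2 * h\<^sup>2) + real N * ((1 + T) * L) + (1 / sqrt c + T) * ?G)" .
  qed (use t in auto)
  also have "\<dots> = (1 + h * ?K) * ?G + h * (?R2 * h\<^sup>2 + 2 * C * (1 + T) * (real N * L))"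
    by (simp add: algebra_simps)
  also have "\<dots> \<le> (1 + h * ?K) * ?G + h * (?R2 * h\<^sup>2 + 2 * C * (1 + T) * (2 * M * (2 * (1 + of_int W)) ^ m * (2 / real N) ^ (m - 1)))"
  proof (intro add_mono order_refl mult_left_mono)
    \<comment> \<open>Summing the aliasing bound N^(-m) over \<open>N\<close> modes costs one
      order.\<close>
    have "real N * L = 2 * M * (2 * (1 + of_int W)) ^ m * (real N / real N ^ m)" by (simp add: L_def)
    also have "real N / real N ^ m = (1 / real N) ^ (m - 1)"
      using \<open>m \<ge> 1\<close> N(2) by (cases m) (auto simp: power_divide)
    \<comment> \<open>Weakened to 2 / N to match the form of the interpolation error.\<close>
    also have "2 * M * (2 * (1 + of_int W)) ^ m * (1 / real N) ^ (m - 1) \<le> 2 * M * (2 * (1 + of_int W)) ^ m * (2 / real N) ^ (m - 1)"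
      using M W by (intro mult_left_mono power_mono divide_right_mono) auto
    finally show "real N * L \<le> 2 * M * (2 * (1 + of_int W)) ^ m * (2 / real N) ^ (m - 1)" .
  qed (use t C T in auto)
  also have "\<dots> = (1 + h * ?K) * ?G + h * (?R2 * h\<^sup>2 + ?R1 * (2 / real N) ^ (m - 1))" by (simp add: mult_ac)
  finally show ?thesis .
qed

section \<open>Fourier modes of the solution\<close>

lemma summable_on_bracket_decay:
  fixes c :: "int \<Rightarrow> complex"
  assumes "\<And>k. cmod (c k) \<le> M / bracket k ^ m" "m \<ge> 2"
  shows "(\<lambda>k. cmod (c k)) summable_on UNIV"
proof (rule nonneg_bounded_partial_sums_imp_summable_on)
  have M: "M \<ge> 0" using order_trans[OF norm_ge_zero assms(1)[of 0]] by (simp add: bracket_def)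
  show "eventually (\<lambda>X. sum (\<lambda>k. cmod (c k)) X \<le> M * 3) (finite_subsets_at_top UNIV)"
  proof (rule eventually_finite_subsets_at_top_weakI)
    fix X :: "int set" assume X: "finite X"
    have "cmod (c k) \<le> M * (1 / bracket k ^ 2)" for k
    proof -
      have "M / bracket k ^ m \<le> M / bracket k ^ 2"
        using M assms(2) bracket_ge_1[of k] by (intro divide_left_mono power_increasing) auto
      thus ?thesis using assms(1)[of k] by simp
    qed
    hence "sum (\<lambda>k. cmod (c k)) X \<le> (\<Sum>k\<in>X. M * (1 / bracket k ^ 2))" by (rule sum_mono)
    also have "\<dots> \<le> M * 3"
      unfolding sum_distrib_left[symmetric] by (intro mult_left_mono sum_bracket_square X M)
    finally show "sum (\<lambda>k. cmod (c k)) X \<le> M * 3" .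
  qed
qed simp

text \<open>A single term of a convergent series of nonnegative terms is at most its sum. This
  pointwise decay is the form in which the Sobolev regularity of the data enters.\<close>

lemma periodic_sobolev_decay:
  assumes "h \<in> periodic_sobolev (real m)"
  obtains M where "\<And>k. cmod (fourier_coeff h k) \<le> M / bracket k ^ m"
proof -
  let ?F = "\<lambda>\<omega>::int. (1 + (real_of_int \<omega>)\<^sup>2) powr real m * (cmod (fourier_coeff h \<omega>))\<^sup>2"
  have sm: "?F summable_on UNIV" using assms by (simp add: periodic_sobolev_def)
  define S where "S = (\<Sum>\<^sub>\<infinity>\<omega>. ?F \<omega>)"
  have F: "(1 + (real_of_int k)\<^sup>2) ^ m * (cmod (fourier_coeff h k))\<^sup>2 \<le> S" for k
  proof -
    have "sum ?F {k} \<le> S" unfolding S_def by (rule finite_sum_le_infsum[OF sm]) auto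
    moreover have "1 + (real_of_int k)\<^sup>2 > 0" by (simp add: add_pos_nonneg)
    ultimately show ?thesis by (simp add: powr_realpow)
  qed
  have "cmod (fourier_coeff h k) \<le> sqrt (2 ^ m * S) / bracket k ^ m" for k
  proof -
    have "(bracket k)\<^sup>2 \<le> 2 * (1 + (real_of_int k)\<^sup>2)"
      using sum_squares_bound[of 1 "\<bar>real_of_int k\<bar>"] by (simp add: bracket_def power2_sum)
    hence "((bracket k)\<^sup>2) ^ m \<le> (2 * (1 + (real_of_int k)\<^sup>2)) ^ m" by (intro power_mono) auto
    hence "((bracket k)\<^sup>2) ^ m * (cmod (fourier_coeff h k))\<^sup>2 \<le> (2 * (1 + (real_of_int k)\<^sup>2)) ^ m * (cmod (fourier_coeff h k))\<^sup>2"
      by (intro mult_right_mono) auto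
    also have "\<dots> \<le> 2 ^ m * S"
      unfolding power_mult_distrib mult.assoc by (intro mult_left_mono F) auto
    also have "((bracket k)\<^sup>2) ^ m = (bracket k ^ m)\<^sup>2" by (simp add: power_mult[symmetric] mult.commute)
    finally have "(bracket k ^ m * cmod (fourier_coeff h k))\<^sup>2 \<le> 2 ^ m * S"
      by (simp add: power_mult_distrib)
    hence "bracket k ^ m * cmod (fourier_coeff h k) \<le> sqrt (2 ^ m * S)" by (rule real_le_rsqrt)
    thus ?thesis by (simp add: field_simps)
  qed
  thus thesis by (rule that)
qed

text \<open>Finitely many nonzero coefficients are summable, so Fourier inversion applies;
  continuity makes the representation valid at every point, in particular at the grid
  points.\<close>

lemma bandlimited_trig_poly:
  fixes q :: "real \<Rightarrow> real"
  assumes "periodic2pi q" "continuous_on UNIV q" "bandlimited (\<lambda>x. complex_of_real (q x))"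
  obtains W :: int and c where "W \<ge> 0" "\<And>x. complex_of_real (q x) = (\<Sum>j\<in>{-W..W}. c j * cexp j x)"
    "c 0 = of_real (average q)"
proof -
  let ?h = "\<lambda>x. complex_of_real (q x)"
  obtain W' where W': "\<And>k. \<bar>k\<bar> > W' \<Longrightarrow> fourier_coeff ?h k = 0"
    using assms(3) by (auto simp: bandlimited_def)
  \<comment> \<open>The bound in \<open>bandlimited\<close> may be negative, hence the
    maximum.\<close>
  define W where "W = max W' 0"
  have z: "fourier_coeff ?h k = 0" if "k \<notin> {-W..W}" for k
    using that by (intro W') (auto simp: W_def)
  have "(\<lambda>k. cmod (fourier_coeff ?h k)) summable_on UNIV \<longleftrightarrow> (\<lambda>k. cmod (fourier_coeff ?h k)) summable_on {-W..W}"
    by (rule summable_on_cong_neutral) (use z in auto)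
  hence "(\<lambda>k. cmod (fourier_coeff ?h k)) summable_on UNIV" by simp
  moreover have "periodic2pi ?h" "continuous_on UNIV ?h"
    using assms by (auto simp: periodic2pi_def intro!: continuous_intros)
  ultimately have hs: "((\<lambda>k. fourier_coeff ?h k * cexp k x) has_sum ?h x) UNIV" for x
    by (intro fourier_series_has_sum)
  have "complex_of_real (q x) = (\<Sum>j\<in>{-W..W}. fourier_coeff ?h j * cexp j x)" for x
  proof -
    have "((\<lambda>k. fourier_coeff ?h k * cexp k x) has_sum ?h x) {-W..W}"
      using hs[of x] by (subst has_sum_cong_neutral[where T = UNIV]) (use z in auto)
    thus ?thesis using has_sum_unique has_sum_finite by (metis finite_atLeastAtMost_int)
  qed
  moreover have "fourier_coeff ?h 0 = of_real (average q)"
    by (simp add: fourier_coeff_def average_def set_integral_complex_of_real)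
  moreover have "W \<ge> 0" by (simp add: W_def)
  ultimately show thesis by (intro that[of W "fourier_coeff ?h"])
qed

text \<open>Over one period, sup bounds control the energy integral. This is the passage from l^1
  bounds on coefficients to the energy norm.\<close>

lemma C_norm_le:
  assumes "p > 0" "average q > 0" and \<phi>: "\<And>x. (\<phi> has_vector_derivative \<phi>' x) (at x)"
    and c: "continuous_on UNIV \<phi>'" "continuous_on UNIV \<psi>"
    and b: "\<And>x. cmod (\<phi> x) \<le> X" "\<And>x. cmod (\<phi>' x) \<le> X" "\<And>x. cmod (\<psi> x) \<le> X"
  shows "C_norm p q (\<phi>, \<psi>) \<le> sqrt (2 * pi * (p + average q + 1)) * X"
proof -
  let ?F = "\<lambda>x. p * (cmod (\<phi>' x))\<^sup>2 + average q * (cmod (\<phi> x))\<^sup>2 + (cmod (\<psi> x))\<^sup>2"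
  have X: "X \<ge> 0" using b(1)[of 0] norm_ge_zero order_trans by blast
  have cont: "continuous_on A \<phi>" "continuous_on A \<phi>'" "continuous_on A \<psi>" for A
    using \<phi> c by (auto intro: continuous_on_subset continuous_at_imp_continuous_on has_vector_derivative_continuous)
  have cF: "continuous_on {0..2*pi} ?F" by (intro continuous_intros cont)
  have vd: "vector_derivative \<phi> (at x) = \<phi>' x" for x using \<phi> by (rule vector_derivative_at)
  have "(LINT x:{0..2*pi}|lebesgue. ?F x) = integral {0..2*pi} ?F"
    by (rule set_lebesgue_integral_eq_integral(2)[OF absolutely_integrable_continuous_real[OF cF]])
  also have "\<dots> \<le> integral {0..2*pi} (\<lambda>x. (p + average q + 1) * X\<^sup>2)"
  proof (rule integral_le[OF integrable_continuous_real[OF cF]])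
    fix x
    have "?F x \<le> p * X\<^sup>2 + average q * X\<^sup>2 + X\<^sup>2"
      using assms(1,2) b by (intro add_mono mult_left_mono power_mono) auto
    thus "?F x \<le> (p + average q + 1) * X\<^sup>2" by (simp add: algebra_simps)
  qed (intro integrable_continuous_real continuous_intros)
  also have "\<dots> = 2 * pi * (p + average q + 1) * X\<^sup>2" by simp
  finally have "C_norm p q (\<phi>, \<psi>) \<le> sqrt (2 * pi * (p + average q + 1) * X\<^sup>2)"
    by (simp add: C_norm_def vd)
  also have "\<dots> = sqrt (2 * pi * (p + average q + 1)) * X" using X by (simp add: real_sqrt_mult)
  finally show ?thesis .
qed

lemma continuous_on_slice:
  assumes "continuous_on (UNIV \<times> I) (\<lambda>(x, t). w x t)" "t \<in> I"
  shows "continuous_on A (\<lambda>x. w x t)"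
proof -
  have "continuous_on A (\<lambda>x. (x, t))" by (intro continuous_intros)
  from continuous_on_compose2[OF assms(1) this] assms(2) show ?thesis by auto
qed

lemma fourier_coeff_has_vector_derivative:
  fixes w w' :: "real \<Rightarrow> real \<Rightarrow> complex"
  assumes c: "continuous_on (UNIV \<times> {0..T}) (\<lambda>(x, t). w x t)" "continuous_on (UNIV \<times> {0..T}) (\<lambda>(x, t). w' x t)"
    and d: "\<And>x t. t \<in> {0..T} \<Longrightarrow> ((\<lambda>\<tau>. w x \<tau>) has_vector_derivative w' x t) (at t within {0..T})"
    and t: "t \<in> {0..T}"
  shows "((\<lambda>t. fourier_coeff (\<lambda>x. w x t) k) has_vector_derivative fourier_coeff (\<lambda>x. w' x t) k) (at t within {0..T})"
proof -
  have "((\<lambda>t. integral (cbox 0 (2*pi)) (\<lambda>x. cexp (- k) x * w x t)) has_vector_derivative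
      integral (cbox 0 (2*pi)) (\<lambda>x. cexp (- k) x * w' x t)) (at t within {0..T})"
  proof (rule leibniz_rule_vector_derivative[OF _ _ _ t])
    have "continuous_on ({0..T} \<times> cbox 0 (2 * pi)) (\<lambda>z. (\<lambda>(x, t). w' x t) (snd z, fst z))"
      by (rule continuous_on_compose2[OF c(2)]) (auto intro!: continuous_intros)
    hence "continuous_on ({0..T} \<times> cbox 0 (2 * pi)) (\<lambda>z. cexp (- k) (snd z) * w' (snd z) (fst z))"
      by (intro continuous_intros continuous_on_compose2[OF continuous_on_cexp[of UNIV]]) auto
    thus "continuous_on ({0..T} \<times> cbox 0 (2 * pi)) (\<lambda>(t, x). cexp (- k) x * w' x t)"
      by (simp add: case_prod_beta)
  next
    fix t assume "t \<in> {0..T}"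
    thus "(\<lambda>x. cexp (- k) x * w x t) integrable_on cbox 0 (2 * pi)"
      by (intro integrable_continuous continuous_intros continuous_on_slice[OF c(1)]) auto
  qed (auto intro!: has_vector_derivative_mult_right d)
  hence D: "((\<lambda>t. integral {0..2*pi} (\<lambda>x. cexp (- k) x * w x t) / of_real (2 * pi)) has_vector_derivative
      integral {0..2*pi} (\<lambda>x. cexp (- k) x * w' x t) / of_real (2 * pi)) (at t within {0..T})"
    unfolding cbox_interval by (rule has_vector_derivative_divide)
  show ?thesis
    unfolding fourier_coeff_integral[OF continuous_on_slice[OF c(2) t]]
    by (rule has_vector_derivative_transform[OF t _ D])
      (simp add: fourier_coeff_integral[OF continuous_on_slice[OF c(1)]])
qed

lemma wave_solution_modes:
  fixes u ut :: "real \<Rightarrow> real \<Rightarrow> complex"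
  assumes sol: "wave_solution p q T f g u ut" and "T > 0" "p > 0" "average q > 0" "continuous_on UNIV q" "W \<ge> 0"
    and q: "\<And>x. complex_of_real (q x) = (\<Sum>j\<in>{-W..W}. c j * cexp j x)"
    and c0: "c 0 = of_real (average q)"
    and U_def: "U = (\<lambda>k t. fourier_coeff (\<lambda>x. u x t) k)" and V_def: "V = (\<lambda>k t. fourier_coeff (\<lambda>x. ut x t) k)"
  obtains ux A M0 where
    "\<And>k t. t \<in> {0..T} \<Longrightarrow> (U k has_vector_derivative V k t) (at t within {0..T})"
    "\<And>k t. t \<in> {0..T} \<Longrightarrow> (V k has_vector_derivative A k t) (at t within {0..T})"
    "\<And>k t. t \<in> {0..T} \<Longrightarrow> A k t = - of_real ((freq p (average q) k)\<^sup>2) * U k t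
       - (\<Sum>j\<in>{-W..W}. deviation_coeff c j * U (k - j) t)"
    "\<And>k t. t \<in> {0..T} \<Longrightarrow> cmod (U k t) \<le> M0"
    "\<And>x t. t \<in> {0..T} \<Longrightarrow> ((\<lambda>x. u x t) has_vector_derivative ux x t) (at x)"
    "\<And>t. t \<in> {0..T} \<Longrightarrow> continuous_on UNIV (\<lambda>x. u x t)"
    "\<And>t. t \<in> {0..T} \<Longrightarrow> continuous_on UNIV (\<lambda>x. ux x t)"
    "\<And>t. t \<in> {0..T} \<Longrightarrow> continuous_on UNIV (\<lambda>x. ut x t)"
    "\<And>t. t \<in> {0..T} \<Longrightarrow> periodic2pi (\<lambda>x. u x t)"
    "\<And>t. t \<in> {0..T} \<Longrightarrow> periodic2pi (\<lambda>x. ux x t)"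
    "\<And>t. t \<in> {0..T} \<Longrightarrow> periodic2pi (\<lambda>x. ut x t)"
proof -
  have per: "\<And>t. t \<in> {0..T} \<Longrightarrow> periodic2pi (\<lambda>x. u x t)" using sol by (simp add: wave_solution_def)
  obtain ux uxx utt where
    cont: "\<And>w. w \<in> {u, ux, uxx, ut, utt} \<Longrightarrow> continuous_on (UNIV \<times> {0..T}) (\<lambda>(x, t). w x t)"
    and dux: "\<And>x t. t \<in> {0..T} \<Longrightarrow> ((\<lambda>x. u x t) has_vector_derivative ux x t) (at x)"
    and duxx: "\<And>x t. t \<in> {0..T} \<Longrightarrow> ((\<lambda>x. ux x t) has_vector_derivative uxx x t) (at x)"
    and dut: "\<And>x t. t \<in> {0..T} \<Longrightarrow> ((\<lambda>\<tau>. u x \<tau>) has_vector_derivative ut x t) (at t within {0..T})"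
    and dutt: "\<And>x t. t \<in> {0..T} \<Longrightarrow> ((\<lambda>\<tau>. ut x \<tau>) has_vector_derivative utt x t) (at t within {0..T})"
    and eq: "\<And>x t. x \<in> {0<..<2*pi} \<Longrightarrow> t \<in> {0<..<T} \<Longrightarrow>
           utt x t + (- of_real p * uxx x t + of_real (q x) * u x t) = 0"
    using sol unfolding wave_solution_def by blast
  have slice: "continuous_on B (\<lambda>x. w x t)" if "w \<in> {u, ux, uxx, ut, utt}" "t \<in> {0..T}" for w t B
    using continuous_on_slice[OF cont[OF that(1)] that(2)] .
  have per_ux: "periodic2pi (\<lambda>x. ux x t)" if t: "t \<in> {0..T}" for t
    unfolding periodic2pi_def
  proof
    fix x
    have "((\<lambda>x. u (x + 2 * pi) t) has_vector_derivative ux (x + 2 * pi) t) (at x)"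
    proof -
      have 1: "((\<lambda>x. x + 2 * pi) has_vector_derivative 1) (at x)" by (auto intro!: derivative_eq_intros)
      from vector_diff_chain_at[OF this dux[OF t]] show ?thesis by (simp add: o_def)
    qed
    moreover have "(\<lambda>x. u (x + 2 * pi) t) = (\<lambda>x. u x t)" using per[OF t] by (simp add: periodic2pi_def)
    ultimately show "ux (x + 2 * pi) t = ux x t"
      using vector_derivative_unique_at[OF _ dux[OF t]] by metis
  qed
  have per_ut: "periodic2pi (\<lambda>x. ut x t)" if t: "t \<in> {0..T}" for t
    unfolding periodic2pi_def
  proof
    fix x
    have "((\<lambda>\<tau>. u x \<tau>) has_vector_derivative ut (x + 2 * pi) t) (at t within {0..T})"
      by (rule has_vector_derivative_transform[OF t _ dut[OF t]]) (use per in \<open>simp add: periodic2pi_def\<close>)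
    \<comment> \<open>One-sided derivatives are unique on a nondegenerate interval; here
      \<open>T > 0\<close> enters.\<close>
    thus "ut (x + 2 * pi) t = ut x t"
      using vector_derivative_unique_within_closed_interval[of 0 T t "\<lambda>\<tau>. u x \<tau>"] dut[OF t, of x] t \<open>T > 0\<close>
      by (metis box_real(2))
  qed
  \<comment> \<open>The differential equation is assumed only in the open rectangle. Continuity
    carries it to the closed one, so that the coefficient integrals can use it at every time,
    including \<open>t = 0\<close> and \<open>t = T\<close>.\<close>
  have eq': "utt x t = of_real p * uxx x t - of_real (q x) * u x t" if x: "x \<in> {0..2*pi}" and t: "t \<in> {0..T}" for x t
  proof -
    let ?S = "{0<..<2*pi} \<times> {0<..<T}"
    have cl: "closure ?S = {0..2*pi} \<times> {0..T}" using \<open>T > 0\<close> by (simp add: closure_Times)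
    have sub: "{0..2*pi} \<times> {0..T} \<subseteq> UNIV \<times> {0..T}" by auto
    have c: "continuous_on ({0..2*pi} \<times> {0..T}) (\<lambda>z. w (fst z) (snd z))" if "w \<in> {u, ux, uxx, ut, utt}" for w
      using continuous_on_subset[OF cont[OF that] sub] by (simp add: case_prod_beta)
    have "continuous_on (closure ?S) (\<lambda>z. utt (fst z) (snd z) + (- of_real p * uxx (fst z) (snd z) + of_real (q (fst z)) * u (fst z) (snd z)))"
      unfolding cl by (intro continuous_intros c continuous_on_compose2[OF assms(5)]) auto
    from continuous_constant_on_closure[OF this, of 0 "(x, t)"] eq x t cl
    have "utt x t + (- of_real p * uxx x t + of_real (q x) * u x t) = 0" by auto
    thus ?thesis by (simp add: algebra_simps add_eq_0_iff)
  qed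
  define A where "A = (\<lambda>k t. fourier_coeff (\<lambda>x. utt x t) k)"
  have ode: "A k t = - of_real ((freq p (average q) k)\<^sup>2) * U k t
       - (\<Sum>j\<in>{-W..W}. deviation_coeff c j * U (k - j) t)" if t: "t \<in> {0..T}" for k t
  proof -
    have uc: "continuous_on {0..2*pi} (\<lambda>x. u x t)" and uxxc: "continuous_on {0..2*pi} (\<lambda>x. uxx x t)"
      and uttc: "continuous_on {0..2*pi} (\<lambda>x. utt x t)" using slice[OF _ t] by auto
    have quc: "continuous_on {0..2*pi} (\<lambda>x. \<Sum>j\<in>{-W..W}. c j * cexp j x * u x t)"
      by (intro continuous_intros uc)
    have puc: "continuous_on {0..2*pi} (\<lambda>x. of_real p * uxx x t)" by (intro continuous_intros uxxc)
    have "A k t = fourier_coeff (\<lambda>x. of_real p * uxx x t - (\<Sum>j\<in>{-W..W}. c j * cexp j x * u x t)) k"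
      unfolding A_def fourier_coeff_integral[OF uttc] fourier_coeff_integral[OF continuous_on_diff[OF puc quc]]
      using eq'[OF _ t] by (intro arg_cong2[where f = "(/)"] Henstock_Kurzweil_Integration.integral_cong)
        (auto simp: q sum_distrib_right)
    also have "\<dots> = of_real p * fourier_coeff (\<lambda>x. uxx x t) k - (\<Sum>j\<in>{-W..W}. c j * U (k - j) t)"
      unfolding fourier_coeff_diff[OF puc quc] fourier_coeff_cmult[OF uxxc] U_def
      by (subst fourier_coeff_sum) (auto intro!: continuous_intros uc simp: fourier_coeff_modulate[OF uc])
    also have "fourier_coeff (\<lambda>x. uxx x t) k = \<i> * of_int k * (\<i> * of_int k * U k t)"
      unfolding U_def
      using fourier_coeff_derivative[where h = "\<lambda>x. ux x t" and h' = "\<lambda>x. uxx x t", OF duxx[OF t] slice[of uxx, OF _ t] per_ux[OF t]]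
        fourier_coeff_derivative[where h = "\<lambda>x. u x t" and h' = "\<lambda>x. ux x t", OF dux[OF t] slice[of ux, OF _ t] per[OF t]]
      by simp
    also have "(\<Sum>j\<in>{-W..W}. c j * U (k - j) t) = of_real (average q) * U k t + (\<Sum>j\<in>{-W..W}. deviation_coeff c j * U (k - j) t)"
      using sum_deviation_coeff[OF assms(6), of c "\<lambda>k. U k t" k] by (simp add: c0)
    also have "of_real p * (\<i> * of_int k * (\<i> * of_int k * U k t)) -
        (of_real (average q) * U k t + (\<Sum>j\<in>{-W..W}. deviation_coeff c j * U (k - j) t)) =
      - of_real ((freq p (average q) k)\<^sup>2) * U k t - (\<Sum>j\<in>{-W..W}. deviation_coeff c j * U (k - j) t)"
      unfolding freq_props(2)[OF assms(3,4)] by (simp add: algebra_simps power2_eq_square)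
    finally show ?thesis .
  qed
  have "compact ({0..2*pi} \<times> {0..T})" by (intro compact_Times) auto
  hence "bounded ((\<lambda>(x, t). u x t) ` ({0..2*pi} \<times> {0..T}))"
    by (intro compact_imp_bounded compact_continuous_image continuous_on_subset[OF cont]) auto
  then obtain M0 where M0: "\<And>x t. x \<in> {0..2*pi} \<Longrightarrow> t \<in> {0..T} \<Longrightarrow> cmod (u x t) \<le> M0"
    unfolding bounded_iff by fastforce
  show thesis
  proof (rule that[of A M0 ux])
    show "(U k has_vector_derivative V k t) (at t within {0..T})" if "t \<in> {0..T}" for k t
      unfolding U_def V_def by (rule fourier_coeff_has_vector_derivative) (use cont dut that in auto)
    show "(V k has_vector_derivative A k t) (at t within {0..T})" if "t \<in> {0..T}" for k t
      unfolding A_def V_def by (rule fourier_coeff_has_vector_derivative) (use cont dutt that in auto)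
    show "cmod (U k t) \<le> M0" if "t \<in> {0..T}" for k t
      unfolding U_def using that M0 slice by (intro fourier_coeff_le) auto
  qed (use ode dux slice per per_ux per_ut in auto)
qed

section \<open>Convergence\<close>

text \<open>The squared frequency costs two orders, leaving n - 1 of the n + 1 orders of
  \<open>U\<close>; with n >= 3 this is at least the order 2 at which the Taylor remainders are
  summable over all modes.\<close>

lemma second_order_mode_decay:
  fixes U :: "int \<Rightarrow> complex"
  assumes "p > 0" "c > 0" "W \<ge> 0" "n \<ge> 3" "M \<ge> 0"
    and A: "\<And>k. A k = - of_real ((freq p c k)\<^sup>2) * U k - (\<Sum>j\<in>{-W..W}. b j * U (k - j))"
    and U: "\<And>k. cmod (U k) \<le> M / bracket k ^ (n + 1)"
  shows "cmod (A k) \<le> (max p c + (\<Sum>j\<in>{-W..W}. cmod (b j)) * (1 + of_int W) ^ (n + 1)) * M / bracket k ^ 2"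
proof -
  define C where "C = (\<Sum>j\<in>{-W..W}. cmod (b j)) * (1 + of_int W) ^ (n + 1)"
  have C: "C \<ge> 0" using assms(3) by (simp add: C_def sum_nonneg)
  have "(freq p c k)\<^sup>2 \<le> (sqrt (max p c) * bracket k)\<^sup>2"
    using freq_props[OF assms(1,2), of k] by (intro power_mono) auto
  also have "\<dots> = max p c * (bracket k)\<^sup>2" using assms by (simp add: power_mult_distrib)
  finally have f: "(freq p c k)\<^sup>2 \<le> max p c * (bracket k)\<^sup>2" .
  have "cmod (A k) \<le> (freq p c k)\<^sup>2 * cmod (U k) + cmod (\<Sum>j\<in>{-W..W}. b j * U (k - j))"
    unfolding A using norm_triangle_ineq4[of "- of_real ((freq p c k)\<^sup>2) * U k"]
    by (simp add: norm_mult norm_power)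
  also have "\<dots> \<le> max p c * (bracket k)\<^sup>2 * (M / bracket k ^ (n + 1)) + C * M / bracket k ^ (n + 1)"
    unfolding C_def using assms(1)
    by (intro add_mono mult_mono U f banded_sum_decay[of U, OF U assms(3)]) auto
  also have "\<dots> \<le> max p c * (M / bracket k ^ 2) + C * (M / bracket k ^ 2)"
  proof (intro add_mono)
    have "(bracket k)\<^sup>2 * (M / bracket k ^ (n + 1)) = M / bracket k ^ (n - 1)"
      using assms(4) by (simp add: power_diff field_simps power2_eq_square)
    also have "\<dots> \<le> M / bracket k ^ 2"
      using assms(4,5) bracket_ge_1[of k] by (intro divide_left_mono power_increasing) auto
    finally show "max p c * (bracket k)\<^sup>2 * (M / bracket k ^ (n + 1)) \<le> max p c * (M / bracket k ^ 2)"
      unfolding mult.assoc using assms(1) by (intro mult_left_mono) auto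
    have "M / bracket k ^ (n + 1) \<le> M / bracket k ^ 2"
      using assms(4,5) bracket_ge_1[of k] by (intro divide_left_mono power_increasing) auto
    thus "C * M / bracket k ^ (n + 1) \<le> C * (M / bracket k ^ 2)"
      using C mult_left_mono by (simp add: times_divide_eq_right[symmetric] del: times_divide_eq_right)
  qed
  finally show ?thesis by (simp add: C_def algebra_simps add_divide_distrib)
qed

theorem theorem3p6:
  fixes T p :: real and q :: "real \<Rightarrow> real" and m :: nat
    and f g :: "real \<Rightarrow> complex" and u ut :: "real \<Rightarrow> real \<Rightarrow> complex"
  assumes "T > 0" and "p > 0"
    and "periodic2pi q" and "continuous_on UNIV q"
    and "\<And>x. q x \<ge> 0" and "average q > 0"
    and "bandlimited (\<lambda>x. complex_of_real (q x))"
    and "m \<ge> 4"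
    and "f \<in> periodic_sobolev (real m + 1)" and "continuous_on UNIV f"
    and "g \<in> periodic_sobolev (real m)" and "continuous_on UNIV g"
    and "wave_solution p q T f g u ut"
  shows "\<exists>Ct Cx :: real. \<forall>(N::nat) (dt::real) (n::nat).
      even N \<and> N > 0 \<and> 0 < dt \<and> dt \<le> T \<and> real n * dt \<le> T \<longrightarrow>
      C_norm p q ((\<lambda>x. u x (real n * dt), \<lambda>x. ut x (real n * dt)) - kss_approx p q N dt (f, g) n)
        \<le> Ct * dt ^ 2 + Cx * (2 * pi / real N) ^ (m - 1)"
proof -
  define c where "c = average q"
  note pc = \<open>p > 0\<close> \<open>average q > 0\<close>[folded c_def]
  note fr = freq_props[OF pc]
  obtain W :: int and qc where W: "W \<ge> 0" and q: "\<And>x. complex_of_real (q x) = (\<Sum>j\<in>{-W..W}. qc j * cexp j x)"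
    and qc0: "qc 0 = of_real (average q)"
    proof (rule bandlimited_trig_poly[OF assms(3,4,7)], goal_cases)
      case 1
      show ?case by (rule 1(1)[OF 1(2-)])
    qed
  let ?b = "deviation_coeff qc"
  define U where "U = (\<lambda>k t. fourier_coeff (\<lambda>x. u x t) k)"
  define V where "V = (\<lambda>k t. fourier_coeff (\<lambda>x. ut x t) k)"
  obtain ux A M0 where
    dU: "\<And>k t. t \<in> {0..T} \<Longrightarrow> (U k has_vector_derivative V k t) (at t within {0..T})" and
    dV: "\<And>k t. t \<in> {0..T} \<Longrightarrow> (V k has_vector_derivative A k t) (at t within {0..T})" and
    ode: "\<And>k t. t \<in> {0..T} \<Longrightarrow> A k t = - of_real ((freq p c k)\<^sup>2) * U k t
       - (\<Sum>j\<in>{-W..W}. ?b j * U (k - j) t)" and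
    U0: "\<And>k t. t \<in> {0..T} \<Longrightarrow> cmod (U k t) \<le> M0" and
    dux: "\<And>x t. t \<in> {0..T} \<Longrightarrow> ((\<lambda>x. u x t) has_vector_derivative ux x t) (at x)" and
    cont: "\<And>t. t \<in> {0..T} \<Longrightarrow> continuous_on UNIV (\<lambda>x. u x t)"
      "\<And>t. t \<in> {0..T} \<Longrightarrow> continuous_on UNIV (\<lambda>x. ux x t)"
      "\<And>t. t \<in> {0..T} \<Longrightarrow> continuous_on UNIV (\<lambda>x. ut x t)" and
    per: "\<And>t. t \<in> {0..T} \<Longrightarrow> periodic2pi (\<lambda>x. u x t)"
      "\<And>t. t \<in> {0..T} \<Longrightarrow> periodic2pi (\<lambda>x. ux x t)"
      "\<And>t. t \<in> {0..T} \<Longrightarrow> periodic2pi (\<lambda>x. ut x t)"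
    proof (rule wave_solution_modes[OF assms(13,1,2,6,4) W q qc0 U_def V_def, folded c_def], goal_cases)
      case 1
      show ?case by (rule 1(1)[OF 1(2-)])
    qed
  have init: "u x 0 = f x" "ut x 0 = g x" for x using assms(13) by (auto simp: wave_solution_def)
  obtain Mf where Mf: "\<And>k. cmod (fourier_coeff f k) \<le> Mf / bracket k ^ (m + 1)"
    using periodic_sobolev_decay[of f "m + 1"] assms(9) by (auto simp: add.commute)
  obtain Mg where Mg: "\<And>k. cmod (fourier_coeff g k) \<le> Mg / bracket k ^ m"
    using periodic_sobolev_decay[of g m] assms(11) by auto
  have iU: "cmod (U k 0) \<le> max Mf Mg / bracket k ^ (m + 1)" for k
    unfolding U_def init by (rule order_trans[OF Mf]) (intro divide_right_mono, auto)
  have iV: "cmod (V k 0) \<le> max Mf Mg / bracket k ^ m" for k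
    unfolding V_def init by (rule order_trans[OF Mg]) (intro divide_right_mono, auto)
  obtain M1 where M1: "M1 \<ge> 0" "\<And>k t. t \<in> {0..T} \<Longrightarrow> cmod (U k t) \<le> M1 / bracket k ^ (m + 1)"
    "\<And>k t. t \<in> {0..T} \<Longrightarrow> cmod (V k t) \<le> M1 / bracket k ^ m"
    using fourier_decay_bootstrap[OF less_imp_le[OF \<open>T > 0\<close>] pc W dU dV ode U0 iU iV] by blast
  \<comment> \<open>One constant for all decay bounds; the summands besides 1 provide for the second
    time derivative.\<close>
  define M where "M = (1 + max p c + (\<Sum>j\<in>{-W..W}. cmod (?b j)) * (1 + of_int W) ^ (m + 1)) * M1"
  define C where "C = (\<Sum>j\<in>{-W..W}. cmod (?b j))"
  have C: "C \<ge> 0" by (simp add: C_def sum_nonneg)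
  have M_ge: "M1 \<le> M" "(max p c + C * (1 + of_int W) ^ (m + 1)) * M1 \<le> M"
  proof -
    have "0 \<le> (max p c + C * (1 + of_int W) ^ (m + 1)) * M1"
      using pc C W M1(1) by (intro mult_nonneg_nonneg add_nonneg_nonneg) auto
    thus "M1 \<le> M" "(max p c + C * (1 + of_int W) ^ (m + 1)) * M1 \<le> M"
      using M1(1) by (simp_all add: M_def C_def[symmetric] algebra_simps)
  qed
  have M: "M \<ge> 0" using M1(1) M_ge(1) by linarith
  have decU': "cmod (U k t) \<le> M / bracket k ^ (m + 1)" and decV: "cmod (V k t) \<le> M / bracket k ^ m"
    if "t \<in> {0..T}" for k t
    using M1(2,3)[OF that, of k] divide_right_mono[OF M_ge(1), of "bracket k ^ (m + 1)"]
      divide_right_mono[OF M_ge(1), of "bracket k ^ m"] by simp_all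
  have decU: "cmod (U k t) \<le> M / bracket k ^ m" if "t \<in> {0..T}" for k t
    using decU'[OF that, of k] divide_left_mono[of "bracket k ^ m" "bracket k ^ (m + 1)" M] M bracket_ge_1[of k] by simp
  have decA: "cmod (A k t) \<le> M / bracket k ^ 2" if "t \<in> {0..T}" for k t
  proof (rule order_trans)
    show "cmod (A k t) \<le> (max p c + C * (1 + of_int W) ^ (m + 1)) * M1 / bracket k ^ 2"
      unfolding C_def
      by (rule second_order_mode_decay[where U = "\<lambda>k. U k t" and A = "\<lambda>k. A k t"])
        (use pc W M1 assms(8) ode that in auto)
    show "(max p c + C * (1 + of_int W) ^ (m + 1)) * M1 / bracket k ^ 2 \<le> M / bracket k ^ 2"
      by (rule divide_right_mono[OF M_ge(2)]) simp
  qed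
  have series: "((\<lambda>k. U k t * cexp k x) has_sum u x t) UNIV"
    "((\<lambda>k. (\<i> * of_int k * U k t) * cexp k x) has_sum ux x t) UNIV"
    "((\<lambda>k. V k t * cexp k x) has_sum ut x t) UNIV"
    and decUx: "cmod (\<i> * of_int k * U k t) \<le> M / bracket k ^ m" if t: "t \<in> {0..T}" for t x k
  proof -
    have m: "m \<ge> 2" using assms(8) by simp
    \<comment> \<open>The energy norm involves the space derivative, whose modes lose one order; the
      order \<open>m + 1\<close> of the modes of \<open>u\<close> pays for it.\<close>
    have decUx: "cmod (\<i> * of_int k * U k t) \<le> M / bracket k ^ m" for k
    proof -
      have "cmod (\<i> * of_int k * U k t) \<le> bracket k * (M / bracket k ^ (m + 1))"
        unfolding norm_mult using decU'[OF t, of k] by (intro mult_mono) (auto simp: bracket_def)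
      thus ?thesis by simp
    qed
    thus "cmod (\<i> * of_int k * U k t) \<le> M / bracket k ^ m" .
    have Ux: "fourier_coeff (\<lambda>x. ux x t) k = \<i> * of_int k * U k t" for k
      unfolding U_def by (rule fourier_coeff_derivative[OF dux[OF t] cont(2)[OF t] per(1)[OF t]])
    show "((\<lambda>k. U k t * cexp k x) has_sum u x t) UNIV"
      unfolding U_def using summable_on_bracket_decay[of "\<lambda>k. U k t", OF decU[OF t] m]
      by (intro fourier_series_has_sum cont per t) (simp add: U_def)
    show "((\<lambda>k. (\<i> * of_int k * U k t) * cexp k x) has_sum ux x t) UNIV"
      unfolding Ux[symmetric] using summable_on_bracket_decay[of "\<lambda>k. \<i> * of_int k * U k t", OF decUx m]
      by (intro fourier_series_has_sum cont per t) (simp add: Ux)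
    show "((\<lambda>k. V k t * cexp k x) has_sum ut x t) UNIV"
      unfolding V_def using summable_on_bracket_decay[of "\<lambda>k. V k t", OF decV[OF t] m]
      by (intro fourier_series_has_sum cont per t) (simp add: V_def)
  qed
  define K where "K = 2 * C * (1 / sqrt c + T)"
  define R2 where "R2 = 6 * C * M * (1 + of_int W)\<^sup>2"
  define R1 where "R1 = 4 * C * (1 + T) * M * (2 * (1 + of_int W)) ^ m"
  \<comment> \<open>The interpolation bound 2 M, doubled for the two characteristic quantities: once
    for the velocity, and once for the displacement with its weight at most
    \<open>sqrt (max p c) * bracket k\<close>.\<close>
  define G0 where "G0 = 4 * M + 4 * sqrt (max p c) * M"
  define S where "S = sqrt (2 * pi * (p + c + 1))"
  \<comment> \<open>The three summands recover \<open>ut\<close>, \<open>u\<close> and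
    \<open>ux\<close>, in this order, from \<open>mode_error\<close>.\<close>
  define \<kappa> where "\<kappa> = 1 + 1 / sqrt c + 1 / sqrt p"
  have nonneg: "K \<ge> 0" "R2 \<ge> 0" "R1 \<ge> 0" "G0 \<ge> 0" "S \<ge> 0" "\<kappa> \<ge> 0"
    using C M W pc \<open>T > 0\<close> by (simp_all add: K_def R1_def R2_def G0_def S_def \<kappa>_def)
  \<comment> \<open>Only the Taylor remainders, accumulated over time, enter \<open>Ct\<close>. In
    \<open>Cx\<close>, the term \<open>2 * M\<close> is the truncation of the Fourier series,
    \<open>G0\<close> the initial interpolation and \<open>T * R1\<close> the aliasing of the
    forcing.\<close>
  define Ct where "Ct = S * (\<kappa> * (exp (T * K) * (T * R2)))"
  define Cx where "Cx = S * (2 * M + \<kappa> * (exp (T * K) * (G0 + T * R1)))"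
  have "C_norm p q ((\<lambda>x. u x (real n * h), \<lambda>x. ut x (real n * h)) - kss_approx p q N h (f, g) n)
        \<le> Ct * h ^ 2 + Cx * (2 * pi / real N) ^ (m - 1)"
    if N: "even N" "N > 0" and h: "0 < h" "real n * h \<le> T" for N n h
  proof -
    define \<delta> where "\<delta> = (2 / real N) ^ (m - 1)"
    let ?I = "grid_waves N" and ?s = "freq p c"
    have \<delta>: "\<delta> \<ge> 0" by (simp add: \<delta>_def)
    obtain \<alpha> \<beta> :: "nat \<Rightarrow> int \<Rightarrow> complex" where
      approx: "\<And>n. kss_approx p q N h (f, g) n =
        (\<lambda>x. \<Sum>k\<in>?I. \<alpha> n k * cexp k x, \<lambda>x. \<Sum>k\<in>?I. \<beta> n k * cexp k x)" and
      per': "\<And>n k i. \<alpha> n (k + int N * i) = \<alpha> n k" "\<And>n k i. \<beta> n (k + int N * i) = \<beta> n k" and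
      \<alpha>0: "\<And>k. \<alpha> 0 k = (\<Sum>j<N. cexp (- k) (grid_point N j) * f (grid_point N j)) / of_nat N" and
      \<beta>0: "\<And>k. \<beta> 0 k = (\<Sum>j<N. cexp (- k) (grid_point N j) * g (grid_point N j)) / of_nat N" and
      \<alpha>S: "\<And>n k s. k \<in> ?I \<Longrightarrow> s = ?s k \<Longrightarrow> \<alpha> (Suc n) k =
         of_real (cos (s * h)) * \<alpha> n k + of_real (sin (s * h) / s) * \<beta> n k
         + of_real ((cos (s * h) - 1) / s\<^sup>2) * (\<Sum>j\<in>{-W..W}. ?b j * \<alpha> n (k - j))
         + of_real ((sin (s * h) / s - h) / s\<^sup>2) * (\<Sum>j\<in>{-W..W}. ?b j * \<beta> n (k - j))" and
      \<beta>S: "\<And>n k s. k \<in> ?I \<Longrightarrow> s = ?s k \<Longrightarrow> \<beta> (Suc n) k =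
         of_real (- s * sin (s * h)) * \<alpha> n k + of_real (cos (s * h)) * \<beta> n k
         - of_real (sin (s * h) / s) * (\<Sum>j\<in>{-W..W}. ?b j * \<alpha> n (k - j))
         + of_real ((cos (s * h) - 1) / s\<^sup>2) * (\<Sum>j\<in>{-W..W}. ?b j * \<beta> n (k - j))"
      proof (rule kss_approx_coeffs[OF N W assms(2,6) q qc0, of h f g, folded c_def], goal_cases)
      case 1
      show ?case by (rule 1(1)[OF 1(2-)])
    qed
    define \<Gamma> where "\<Gamma> i = mode_error N ?s (\<lambda>k. U k (real i * h) - \<alpha> i k) (\<lambda>k. V k (real i * h) - \<beta> i k)" for i
    have s0: "0 \<le> ?s k" for k using fr(1)[of k] by simp
    note bounds = mode_error_bounds[of ?s, OF s0]
    have \<Gamma>0: "\<Gamma> 0 \<le> G0 * \<delta>"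
    proof -
      have t0: "0 \<in> {0..T}" using \<open>T > 0\<close> by simp
      have m: "m \<ge> 2" using assms(8) by simp
      \<comment> \<open>The weight \<open>bracket k\<close> consumes the extra order of the
        displacement, so both components start with the rate \<open>m - 1\<close>.\<close>
      have "(\<Sum>k\<in>?I. bracket k ^ 1 * cmod (\<alpha> 0 k - U k 0)) \<le> 2 * M * (2 / real N) ^ (m - 1)"
        unfolding \<alpha>0 using series(1)[OF t0] decU'[OF t0]
        by (intro interpolation_coeff_error N m) (simp_all add: init)
      moreover have "(\<Sum>k\<in>?I. bracket k ^ 0 * cmod (\<beta> 0 k - V k 0)) \<le> 2 * M * (2 / real N) ^ (m - 1)"
        unfolding \<beta>0 using series(3)[OF t0] decV[OF t0]
        by (intro interpolation_coeff_error N m) (simp_all add: init)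
      moreover have "(\<Sum>k\<in>?I. ?s k * cmod (U k 0 - \<alpha> 0 k)) \<le> (\<Sum>k\<in>?I. sqrt (max p c) * (bracket k ^ 1 * cmod (\<alpha> 0 k - U k 0)))"
        using mult_right_mono[OF fr(4) norm_ge_zero] by (intro sum_mono) (simp add: norm_minus_commute mult.assoc)
      moreover have "\<dots> = sqrt (max p c) * (\<Sum>k\<in>?I. bracket k ^ 1 * cmod (\<alpha> 0 k - U k 0))"
        by (rule sum_distrib_left[symmetric])
      moreover have "\<dots> \<le> sqrt (max p c) * (2 * M * \<delta>)"
        using calculation(1) pc by (intro mult_left_mono) (auto simp: \<delta>_def)
      ultimately have "2 * (\<Sum>k\<in>?I. cmod (V k 0 - \<beta> 0 k)) + 2 * (\<Sum>k\<in>?I. ?s k * cmod (U k 0 - \<alpha> 0 k))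
        \<le> 2 * (2 * M * \<delta>) + 2 * (sqrt (max p c) * (2 * M * \<delta>))"
        by (simp add: norm_minus_commute \<delta>_def)
      also have "\<dots> = G0 * \<delta>" by (simp add: G0_def algebra_simps)
      finally show ?thesis
        using bounds(3)[of N "\<lambda>k. U k 0 - \<alpha> 0 k" "\<lambda>k. V k 0 - \<beta> 0 k"] by (simp add: \<Gamma>_def)
    qed
    have \<Gamma>n: "\<Gamma> n \<le> exp (T * K) * (G0 * \<delta> + T * (R2 * h\<^sup>2 + R1 * \<delta>))"
    proof -
      have step: "\<Gamma> (Suc i) \<le> (1 + h * K) * \<Gamma> i + h * (R2 * h\<^sup>2 + R1 * \<delta>)" if "i < n" for i
      proof -
        have "real i * h + h = real (Suc i) * h" by (simp add: algebra_simps)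
        also have "\<dots> \<le> real n * h" using that h by (intro mult_right_mono) auto
        finally have ih: "real i * h + h \<le> T" using h by simp
        have m: "m \<ge> 1" using assms(8) by simp
        have "mode_error N ?s (\<lambda>k. U k (real i * h + h) - \<alpha> (Suc i) k) (\<lambda>k. V k (real i * h + h) - \<beta> (Suc i) k)
          \<le> (1 + h * K) * \<Gamma> i + h * (R2 * h\<^sup>2 + R1 * \<delta>)"
          unfolding K_def R2_def R1_def C_def \<delta>_def \<Gamma>_def
          by (rule kss_error_step[OF N pc W m dU dV ode decU decV decA per' \<alpha>S \<beta>S]) (use ih h in auto)
        thus ?thesis by (simp add: \<Gamma>_def algebra_simps)
      qed
      have g0: "\<Gamma> 0 \<ge> 0" unfolding \<Gamma>_def mode_error_def by (intro sum_nonneg) auto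
      have R: "0 \<le> R2 * h\<^sup>2 + R1 * \<delta>" using nonneg \<delta> by simp
      have "\<Gamma> n \<le> exp (real n * (h * K)) * (\<Gamma> 0 + real n * (h * (R2 * h\<^sup>2 + R1 * \<delta>)))"
        by (rule discrete_gronwall) (use nonneg R h g0 step in auto)
      also have "\<dots> \<le> exp (T * K) * (G0 * \<delta> + T * (R2 * h\<^sup>2 + R1 * \<delta>))"
      proof (rule mult_mono)
        show "exp (real n * (h * K)) \<le> exp (T * K)"
          using mult_right_mono[OF h(2) nonneg(1)] by (simp add: mult.assoc)
        have "real n * (h * (R2 * h\<^sup>2 + R1 * \<delta>)) \<le> T * (R2 * h\<^sup>2 + R1 * \<delta>)"
          using mult_right_mono[OF h(2) R] by (simp only: mult.assoc)
        with \<Gamma>0 show "\<Gamma> 0 + real n * (h * (R2 * h\<^sup>2 + R1 * \<delta>)) \<le> G0 * \<delta> + T * (R2 * h\<^sup>2 + R1 * \<delta>)"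
          by (rule add_mono)
      qed (use g0 R h in auto)
      finally show ?thesis .
    qed
    define t where "t = real n * h"
    have t: "t \<in> {0..T}" using h by (simp add: t_def)
    have m: "m \<ge> 2" using assms(8) by simp
    define X where "X = 2 * M * \<delta> + \<kappa> * \<Gamma> n"
    have g: "\<Gamma> n \<ge> 0" unfolding \<Gamma>_def mode_error_def by (intro sum_nonneg) auto
    \<comment> \<open>Truncation of the exact series plus the l^1 error of the coefficients on the
      grid; \<open>r\<close> is the factor with which \<open>mode_error\<close> dominates the
      component in question.\<close>
    have diff: "cmod (w - (\<Sum>k\<in>?I. y k * cexp k x)) \<le> X"
      if w: "((\<lambda>k. z k * cexp k x) has_sum w) UNIV" "\<And>k. cmod (z k) \<le> M / bracket k ^ m"
        and d: "r * (\<Sum>k\<in>?I. cmod (z k - y k)) \<le> \<Gamma> n" "1 / r \<le> \<kappa>" "r > 0" for w y z x r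
    proof -
      have "w - (\<Sum>k\<in>?I. y k * cexp k x) = (w - (\<Sum>k\<in>?I. z k * cexp k x)) + (\<Sum>k\<in>?I. (z k - y k) * cexp k x)"
        by (simp add: sum_subtractf left_diff_distrib)
      also have "cmod \<dots> \<le> 2 * M * \<delta> + (\<Sum>k\<in>?I. cmod (z k - y k))"
        unfolding \<delta>_def
        by (intro order_trans[OF norm_triangle_ineq] add_mono fourier_tail_bound N m w sum_norm_le) (simp add: norm_mult)
      also have "(\<Sum>k\<in>?I. cmod (z k - y k)) \<le> 1 / r * \<Gamma> n" using d by (simp add: field_simps)
      also have "\<dots> \<le> \<kappa> * \<Gamma> n" using d g by (intro mult_right_mono) auto
      finally show ?thesis by (simp add: X_def)
    qed
    define \<phi> where "\<phi> = (\<lambda>x. u x t - (\<Sum>k\<in>?I. \<alpha> n k * cexp k x))"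
    define \<phi>' where "\<phi>' = (\<lambda>x. ux x t - (\<Sum>k\<in>?I. (\<i> * of_int k * \<alpha> n k) * cexp k x))"
    define \<psi> where "\<psi> = (\<lambda>x. ut x t - (\<Sum>k\<in>?I. \<beta> n k * cexp k x))"
    have err: "(\<lambda>x. u x (real n * h), \<lambda>x. ut x (real n * h)) - kss_approx p q N h (f, g) n = (\<phi>, \<psi>)"
      by (simp add: approx \<phi>_def \<psi>_def t_def fun_eq_iff)
    have se: "(\<Sum>k\<in>?I. ?s k * cmod (U k t - \<alpha> n k)) \<le> \<Gamma> n" unfolding \<Gamma>_def t_def by (rule bounds(2))
    have "C_norm p q (\<phi>, \<psi>) \<le> S * X"
      unfolding S_def c_def
    proof (rule C_norm_le)
      fix x
      show "(\<phi> has_vector_derivative \<phi>' x) (at x)"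
        unfolding \<phi>_def \<phi>'_def
      proof (intro has_vector_derivative_diff dux[OF t] has_vector_derivative_sum)
        fix k
        show "((\<lambda>x. \<alpha> n k * cexp k x) has_vector_derivative \<i> * of_int k * \<alpha> n k * cexp k x) (at x)"
          using has_vector_derivative_mult_right[OF has_vector_derivative_cexp[of k x UNIV], of "\<alpha> n k"]
          by (simp add: mult_ac)
      qed
      show "cmod (\<phi> x) \<le> X"
        unfolding \<phi>_def
      proof (rule diff[OF series(1)[OF t] decU[OF t], of "sqrt c"])
        have "sqrt c * (\<Sum>k\<in>?I. cmod (U k t - \<alpha> n k)) \<le> (\<Sum>k\<in>?I. ?s k * cmod (U k t - \<alpha> n k))"
          unfolding sum_distrib_left by (intro sum_mono mult_right_mono fr) auto
        thus "sqrt c * (\<Sum>k\<in>?I. cmod (U k t - \<alpha> n k)) \<le> \<Gamma> n" using se by linarith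
      qed (use pc in \<open>auto simp: \<kappa>_def\<close>)
      show "cmod (\<phi>' x) \<le> X"
        unfolding \<phi>'_def
      proof (rule diff[OF series(2)[OF t] decUx[OF t], of "sqrt p"])
        have "sqrt p * (\<Sum>k\<in>?I. cmod (\<i> * of_int k * U k t - \<i> * of_int k * \<alpha> n k)) =
          (\<Sum>k\<in>?I. (sqrt p * \<bar>of_int k\<bar>) * cmod (U k t - \<alpha> n k))"
          unfolding sum_distrib_left right_diff_distrib[symmetric] by (simp add: norm_mult mult_ac)
        also have "\<dots> \<le> (\<Sum>k\<in>?I. ?s k * cmod (U k t - \<alpha> n k))"
          by (intro sum_mono mult_right_mono fr) auto
        finally show "sqrt p * (\<Sum>k\<in>?I. cmod (\<i> * of_int k * U k t - \<i> * of_int k * \<alpha> n k)) \<le> \<Gamma> n" using se by linarith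
      qed (use pc in \<open>auto simp: \<kappa>_def\<close>)
      show "cmod (\<psi> x) \<le> X"
        unfolding \<psi>_def
      proof (rule diff[OF series(3)[OF t] decV[OF t], of 1])
        show "1 * (\<Sum>k\<in>?I. cmod (V k t - \<beta> n k)) \<le> \<Gamma> n"
          using bounds(1) by (simp add: \<Gamma>_def t_def)
      qed (use pc in \<open>auto simp: \<kappa>_def\<close>)
    next
      show "continuous_on UNIV \<phi>'" "continuous_on UNIV \<psi>"
        unfolding \<phi>'_def \<psi>_def by (intro continuous_intros cont t)+
    qed (use assms in auto)
    also have "\<dots> \<le> S * (2 * M * \<delta> + \<kappa> * (exp (T * K) * (G0 * \<delta> + T * (R2 * h\<^sup>2 + R1 * \<delta>))))"
      unfolding X_def using nonneg by (intro mult_left_mono add_mono \<Gamma>n order_refl) auto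
    also have "\<dots> = Ct * h\<^sup>2 + Cx * \<delta>" by (simp add: Ct_def Cx_def algebra_simps)
    also have "\<dots> \<le> Ct * h\<^sup>2 + Cx * (2 * pi / real N) ^ (m - 1)"
    proof (rule add_left_mono, rule mult_left_mono)
      \<comment> \<open>2 / N is the grid spacing divided by pi.\<close>
      show "\<delta> \<le> (2 * pi / real N) ^ (m - 1)"
        unfolding \<delta>_def using pi_ge_two by (intro power_mono divide_right_mono) auto
      show "0 \<le> Cx" unfolding Cx_def using nonneg M \<open>T > 0\<close> by (intro mult_nonneg_nonneg add_nonneg_nonneg) auto
    qed
    finally show ?thesis unfolding err .
  qed
  thus ?thesis by blast
qed

end
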